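(* Consider a two-player zero-sum stochastic game with state space $S_o=S\cup\{0\}$, $S=\{1,\dots,n\}$, as described in the context, and suppose the Continuity Condition, the Minimax Regularity Condition and the SSP Game Model Assumption hold. Then the game has a finite value function $x^*\in\mathbb{R}^n$, i.e. $\bar x^*_i=\underline x^*_i=x^*_i\in\mathbb{R}$ for all $i\in S$, and $x^*$ is the unique solution of the equation $x=Tx$. Furthermore, there exist $\mu^*\in\Pi_1^{SD}$, $\nu^*\in\Pi_2^{SD}$ with $x^*=T_{\mu^*}x^*=\tilde T_{\nu^*}x^*$; any such $\mu^*,\nu^*$ are essentially proper (hence the pair $(\mu^*,\nu^* )$ is non-prolonging), and $(\mu^*,\nu^* )$ is a pair of equilibrium policies, with $\mu^*$ optimal for player I and $\nu^*$ optimal for player II.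
   Context: Game model. $S=\{1,\dots,n\}$, $S_o=S\cup\{0\}$, where $0$ is an absorbing, cost-free termination state. At state $i\in S$, player I chooses a control $\bar u$ from a compact set $\bar U(i)$ and player II a control $\bar v$ from a compact set $\bar V(i)$ (compact subsets of complete separable metric spaces). Under $(\bar u,\bar v)$ an expected one-stage cost $c_i(\bar u,\bar v)\in\mathbb{R}$ (possibly negative) is paid by player I to player II and the state moves to $j\in S_o$ with probability $p_{ij}(\bar u,\bar v)$. Players may use the full history (past states and both players' past controls). $\Pi_1,\Pi_2$ denote the sets of history-dependent randomized policies of players I and II. For $(\pi_1,\pi_2)\in\Pi_1\times\Pi_2$ and $i\in S$, $x_i(\pi_1,\pi_2)=\liminf_{t\to\infty}E_{\pi_1\pi_2}[\sum_{k=0}^t c_{i_k}(\bar u_k,\bar v_k)\mid i_0=i]$. Upper value $\bar x^*_i=\inf_{\pi_1}\sup_{\pi_2}x_i(\pi_1,\pi_2)$, lower value $\underline x^*_i=\sup_{\pi_2}\inf_{\pi_1}x_i(\pi_1,\pi_2)$; if they coincide for all $i$ the common vector is the value function. An optimal policy for player I (II) attains the outer infimum (supremum) in $\bar x^*_i$ ($\underline x^*_i$) for all $i$. $(\pi_1^*,\pi_2^* )$ is a pair of equilibrium policies if $x(\pi_1^*,\pi_2)\le x(\pi_1^*,\pi_2^* )\le x(\pi_1,\pi_2^* )$ for all $\pi_1\in\Pi_1,\pi_2\in\Pi_2$. Stationary deterministic policies: $\Pi_1^{SD}=\{\mu: \mu(i)\in\bar U(i),\ i\in S\}$, $\Pi_2^{SD}=\{\nu:\nu(i)\in\bar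 V(i),\ i\in S\}$. For $(\mu,\nu)$ let $c(\mu,\nu)\in\mathbb{R}^n$ have components $c_i(\mu(i),\nu(i))$ and $P(\mu,\nu)$ be the $n\times n$ substochastic matrix with entries $p_{ij}(\mu(i),\nu(i))$, $i,j\in S$. Operators on $\mathbb{R}^n$ (optimizations componentwise): $T_{\mu\nu}x=c(\mu,\nu)+P(\mu,\nu)x$; $T_\mu x=\sup_{\nu\in\Pi_2^{SD}}T_{\mu\nu}x$; $\tilde T_\nu x=\inf_{\mu\in\Pi_1^{SD}}T_{\mu\nu}x$; $Tx=\inf_{\mu}\sup_{\nu}T_{\mu\nu}x$; $\tilde Tx=\sup_\nu\inf_\mu T_{\mu\nu}x$. Continuity Condition: for all $i,j\in S$, $p_{ij}(\bar u,\bar v)$ is continuous on $\bar U(i)\times\bar V(i)$, and $c_i(\bar u,\bar v)$ is lower semicontinuous in $\bar u$ for fixed $\bar v$ and upper semicontinuous in $\bar v$ for fixed $\bar u$. Minimax Regularity Condition: $Tx=\tilde Tx$ for all $x\in\mathbb{R}^n$. A pair of policies is prolonging if under it, for some initial state, the termination state is never reached with positive probability; otherwise (termination reached w.p.1 from every initial state) it is non-prolonging. SSP Game Model Assumption: (i) there is $\bar\mu\in\Pi_1^{SD}$ with $x_i(\bar\mu,\nu)<+\infty$ for all $\nu\in\Pi_2^{SD}$ and all $i$; (ii) there is $\bar\nu\in\Pi_2^{SD}$ with $x_i(\mu,\bar\nu)>-\infty$ for all $\mu\in\Pi_1^{SD}$ and all $i$; (iii) for every prolonging pair $(\mu,\nu)\in\Pi_1^{SD}\times\Pi_2^{SD}$,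 $x_i(\mu,\nu)\in\{+\infty,-\infty\}$ for at least one $i$. Essentially proper: $\mu\in\Pi_1^{SD}$ is essentially proper if there is $\nu\in\Pi_2^{SD}$ with $(\mu,\nu)$ non-prolonging and, for every $\nu\in\Pi_2^{SD}$ with $(\mu,\nu)$ prolonging, $x_i(\mu,\nu)=-\infty$ for some $i$. $\nu\in\Pi_2^{SD}$ is essentially proper if there is $\mu\in\Pi_1^{SD}$ with $(\mu,\nu)$ non-prolonging and, for every $\mu$ with $(\mu,\nu)$ prolonging, $x_i(\mu,\nu)=+\infty$ for some $i$. *)

theory Defs
  imports "HOL-Probability.Probability"
begin

definition lsc_on :: "'a::topological_space set \<Rightarrow> ('a \<Rightarrow> real) \<Rightarrow> bool" where
  "lsc_on A f \<longleftrightarrow> (\<forall>a. openin (top_of_set A) {x \<in> A. a < f x})"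

definition usc_on :: "'a::topological_space set \<Rightarrow> ('a \<Rightarrow> real) \<Rightarrow> bool" where
  "usc_on A f \<longleftrightarrow> (\<forall>a. openin (top_of_set A) {x \<in> A. f x < a})"

text \<open>States: S = {1..n}; state 0 is the absorbing cost-free termination state.
  A history up to time k consists of the triples (state, control I, control II)
  at times 0..k-1 (an extensional function on {..<k}) together with the current state.\<close>

definition HM :: "nat \<Rightarrow> (nat \<Rightarrow> nat \<times> 'u::topological_space \<times> 'v::topological_space) measure" where
  "HM k = PiM {..<k} (\<lambda>_. count_space UNIV \<Otimes>\<^sub>M (borel :: 'u measure) \<Otimes>\<^sub>M (borel :: 'v measure))"

definition XM :: "nat \<Rightarrow> ((nat \<Rightarrow> nat \<times> 'u::topological_space \<times> 'v::topological_space) \<times> nat) measure" where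
  "XM k = HM k \<Otimes>\<^sub>M count_space UNIV"

text \<open>History-dependent randomized policies: at time k, given past history h and
  current state i, a probability distribution on the control set; measurable in the history.\<close>

definition Pol1 :: "nat \<Rightarrow> (nat \<Rightarrow> 'u::topological_space set)
   \<Rightarrow> (nat \<Rightarrow> (nat \<Rightarrow> nat \<times> 'u \<times> 'v::topological_space) \<Rightarrow> nat \<Rightarrow> 'u measure) set" where
  "Pol1 n U = {\<pi>. (\<forall>k h i. i \<in> {1..n} \<longrightarrow>
        \<pi> k h i \<in> space (prob_algebra borel) \<and> emeasure (\<pi> k h i) (U i) = 1) \<and>
      (\<forall>k i. i \<in> {1..n} \<longrightarrow> (\<lambda>h. \<pi> k h i) \<in> HM k \<rightarrow>\<^sub>M prob_algebra borel)}"

definition Pol2 :: "nat \<Rightarrow> (nat \<Rightarrow> 'v::topological_space set)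
   \<Rightarrow> (nat \<Rightarrow> (nat \<Rightarrow> nat \<times> 'u::topological_space \<times> 'v) \<Rightarrow> nat \<Rightarrow> 'v measure) set" where
  "Pol2 n V = {\<pi>. (\<forall>k h i. i \<in> {1..n} \<longrightarrow>
        \<pi> k h i \<in> space (prob_algebra borel) \<and> emeasure (\<pi> k h i) (V i) = 1) \<and>
      (\<forall>k i. i \<in> {1..n} \<longrightarrow> (\<lambda>h. \<pi> k h i) \<in> HM k \<rightarrow>\<^sub>M prob_algebra borel)}"

text \<open>One step of the controlled process.  From a state i in S the controls are drawn
  independently from the players' distributions and the next state j in {0..n} is drawn with
  probability p i j u v.  From state 0 (or any state outside S) the process stays put at no cost
  (controls are irrelevant there and recorded as undefined).\<close>

definition step ::
  "nat \<Rightarrow> (nat \<Rightarrow> 'u::topological_space set) \<Rightarrow> (nat \<Rightarrow> 'v::topological_space set)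
   \<Rightarrow> (nat \<Rightarrow> nat \<Rightarrow> 'u \<Rightarrow> 'v \<Rightarrow> real)
   \<Rightarrow> (nat \<Rightarrow> (nat \<Rightarrow> nat \<times> 'u \<times> 'v) \<Rightarrow> nat \<Rightarrow> 'u measure)
   \<Rightarrow> (nat \<Rightarrow> (nat \<Rightarrow> nat \<times> 'u \<times> 'v) \<Rightarrow> nat \<Rightarrow> 'v measure)
   \<Rightarrow> nat \<Rightarrow> (nat \<Rightarrow> nat \<times> 'u \<times> 'v) \<times> nat \<Rightarrow> ((nat \<Rightarrow> nat \<times> 'u \<times> 'v) \<times> nat) measure" where
  "step n U V p \<pi>1 \<pi>2 k x =
     (case x of (h, i) \<Rightarrow>
       if i \<in> {1..n} then
         (\<pi>1 k h i \<Otimes>\<^sub>M \<pi>2 k h i) \<bind>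
           (\<lambda>(u, v). distr (density (count_space {0..n})
                         (\<lambda>j. ennreal (if u \<in> U i \<and> v \<in> V i then p i j u v else 0)))
                       (XM (Suc k)) (\<lambda>j. (h(k := (i, u, v)), j)))
       else return (XM (Suc k)) (h(k := (i, undefined, undefined)), i))"

primrec paths ::
  "nat \<Rightarrow> (nat \<Rightarrow> 'u::topological_space set) \<Rightarrow> (nat \<Rightarrow> 'v::topological_space set)
   \<Rightarrow> (nat \<Rightarrow> nat \<Rightarrow> 'u \<Rightarrow> 'v \<Rightarrow> real)
   \<Rightarrow> (nat \<Rightarrow> (nat \<Rightarrow> nat \<times> 'u \<times> 'v) \<Rightarrow> nat \<Rightarrow> 'u measure)
   \<Rightarrow> (nat \<Rightarrow> (nat \<Rightarrow> nat \<times> 'u \<times> 'v) \<Rightarrow> nat \<Rightarrow> 'v measure)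
   \<Rightarrow> nat \<Rightarrow> nat \<Rightarrow> ((nat \<Rightarrow> nat \<times> 'u \<times> 'v) \<times> nat) measure" where
  "paths n U V p \<pi>1 \<pi>2 i0 0 = return (XM 0) (\<lambda>_. undefined, i0)"
| "paths n U V p \<pi>1 \<pi>2 i0 (Suc t) = paths n U V p \<pi>1 \<pi>2 i0 t \<bind> step n U V p \<pi>1 \<pi>2 t"

definition eexp :: "'a measure \<Rightarrow> ('a \<Rightarrow> real) \<Rightarrow> ereal" where
  "eexp M f = enn2ereal (\<integral>\<^sup>+ x. ennreal (f x) \<partial>M) - enn2ereal (\<integral>\<^sup>+ x. ennreal (- f x) \<partial>M)"

definition stage_cost :: "nat \<Rightarrow> (nat \<Rightarrow> 'u \<Rightarrow> 'v \<Rightarrow> real) \<Rightarrow> nat \<times> 'u \<times> 'v \<Rightarrow> real" where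
  "stage_cost n c y = (case y of (i, u, v) \<Rightarrow> if i \<in> {1..n} then c i u v else 0)"

definition xcost ::
  "nat \<Rightarrow> (nat \<Rightarrow> 'u::topological_space set) \<Rightarrow> (nat \<Rightarrow> 'v::topological_space set)
   \<Rightarrow> (nat \<Rightarrow> 'u \<Rightarrow> 'v \<Rightarrow> real) \<Rightarrow> (nat \<Rightarrow> nat \<Rightarrow> 'u \<Rightarrow> 'v \<Rightarrow> real)
   \<Rightarrow> (nat \<Rightarrow> (nat \<Rightarrow> nat \<times> 'u \<times> 'v) \<Rightarrow> nat \<Rightarrow> 'u measure)
   \<Rightarrow> (nat \<Rightarrow> (nat \<Rightarrow> nat \<times> 'u \<times> 'v) \<Rightarrow> nat \<Rightarrow> 'v measure)
   \<Rightarrow> nat \<Rightarrow> ereal" where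
  "xcost n U V c p \<pi>1 \<pi>2 i = liminf (\<lambda>t.
     eexp (paths n U V p \<pi>1 \<pi>2 i (Suc t)) (\<lambda>(h, j). \<Sum>k\<le>t. stage_cost n c (h k)))"

definition upper_value where
  "upper_value n U V c p i = (INF \<pi>1\<in>Pol1 n U. SUP \<pi>2\<in>Pol2 n V. xcost n U V c p \<pi>1 \<pi>2 i)"

definition lower_value where
  "lower_value n U V c p i = (SUP \<pi>2\<in>Pol2 n V. INF \<pi>1\<in>Pol1 n U. xcost n U V c p \<pi>1 \<pi>2 i)"

definition non_prolonging where
  "non_prolonging n U V p \<pi>1 \<pi>2 \<longleftrightarrow>
     (\<forall>i\<in>{1..n}. (\<lambda>t. measure (paths n U V p \<pi>1 \<pi>2 i t) {x \<in> space (XM t). snd x = 0})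
                   \<longlonglongrightarrow> 1)"

definition prolonging where
  "prolonging n U V p \<pi>1 \<pi>2 \<longleftrightarrow> \<not> non_prolonging n U V p \<pi>1 \<pi>2"

definition SD1 :: "nat \<Rightarrow> (nat \<Rightarrow> 'u set) \<Rightarrow> (nat \<Rightarrow> 'u) set" where
  "SD1 n U = {\<mu>. \<forall>i\<in>{1..n}. \<mu> i \<in> U i}"

definition SD2 :: "nat \<Rightarrow> (nat \<Rightarrow> 'v set) \<Rightarrow> (nat \<Rightarrow> 'v) set" where
  "SD2 n V = {\<nu>. \<forall>i\<in>{1..n}. \<nu> i \<in> V i}"

definition stat1 :: "(nat \<Rightarrow> 'u::topological_space)
     \<Rightarrow> nat \<Rightarrow> (nat \<Rightarrow> nat \<times> 'u \<times> 'v) \<Rightarrow> nat \<Rightarrow> 'u measure" where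
  "stat1 \<mu> = (\<lambda>k h i. return borel (\<mu> i))"

definition stat2 :: "(nat \<Rightarrow> 'v::topological_space)
     \<Rightarrow> nat \<Rightarrow> (nat \<Rightarrow> nat \<times> 'u \<times> 'v) \<Rightarrow> nat \<Rightarrow> 'v measure" where
  "stat2 \<nu> = (\<lambda>k h i. return borel (\<nu> i))"

section \<open>Operators on R^n (vectors are functions on S = {1..n})\<close>

definition Tmn where
  "Tmn n c p \<mu> \<nu> x i = c i (\<mu> i) (\<nu> i) + (\<Sum>j\<in>{1..n}. p i j (\<mu> i) (\<nu> i) * x j)"

definition Tmu where
  "Tmu n V c p \<mu> x i = (SUP \<nu>\<in>SD2 n V. Tmn n c p \<mu> \<nu> x i)"

definition Tnu where
  "Tnu n U c p \<nu> x i = (INF \<mu>\<in>SD1 n U. Tmn n c p \<mu> \<nu> x i)"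

definition Top where
  "Top n U V c p x i = (INF \<mu>\<in>SD1 n U. SUP \<nu>\<in>SD2 n V. Tmn n c p \<mu> \<nu> x i)"

definition Top' where
  "Top' n U V c p x i = (SUP \<nu>\<in>SD2 n V. INF \<mu>\<in>SD1 n U. Tmn n c p \<mu> \<nu> x i)"

definition ess_proper1 where
  "ess_proper1 n U V c p \<mu> \<longleftrightarrow>
     (\<exists>\<nu>\<in>SD2 n V. non_prolonging n U V p (stat1 \<mu>) (stat2 \<nu>)) \<and>
     (\<forall>\<nu>\<in>SD2 n V. prolonging n U V p (stat1 \<mu>) (stat2 \<nu>) \<longrightarrow>
        (\<exists>i\<in>{1..n}. xcost n U V c p (stat1 \<mu>) (stat2 \<nu>) i = -\<infinity>))"

definition ess_proper2 where
  "ess_proper2 n U V c p \<nu> \<longleftrightarrow>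
     (\<exists>\<mu>\<in>SD1 n U. non_prolonging n U V p (stat1 \<mu>) (stat2 \<nu>)) \<and>
     (\<forall>\<mu>\<in>SD1 n U. prolonging n U V p (stat1 \<mu>) (stat2 \<nu>) \<longrightarrow>
        (\<exists>i\<in>{1..n}. xcost n U V c p (stat1 \<mu>) (stat2 \<nu>) i = \<infinity>))"

definition equilibrium where
  "equilibrium n U V c p \<pi>1s \<pi>2s \<longleftrightarrow>
     (\<forall>\<pi>1\<in>Pol1 n U. \<forall>\<pi>2\<in>Pol2 n V. \<forall>i\<in>{1..n}.
        xcost n U V c p \<pi>1s \<pi>2 i \<le> xcost n U V c p \<pi>1s \<pi>2s i \<and>
        xcost n U V c p \<pi>1s \<pi>2s i \<le> xcost n U V c p \<pi>1 \<pi>2s i)"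

definition optimal1 where
  "optimal1 n U V c p \<pi>1s \<longleftrightarrow>
     (\<forall>i\<in>{1..n}. (SUP \<pi>2\<in>Pol2 n V. xcost n U V c p \<pi>1s \<pi>2 i) = upper_value n U V c p i)"

definition optimal2 where
  "optimal2 n U V c p \<pi>2s \<longleftrightarrow>
     (\<forall>i\<in>{1..n}. (INF \<pi>1\<in>Pol1 n U. xcost n U V c p \<pi>1 \<pi>2s i) = lower_value n U V c p i)"


end

(*
  For a stationary policy of one player, the other player faces a single-player stochastic shortest
  path problem.  There, the policies admitting a subsolution of Bellman's equation terminate, which
  yields existence and uniqueness of the fixed point and convergence of value iteration from 0.
  Applied to the two policies given by the model assumption, this gives y <= x with y <= Ty and
  Tx <= x, so the iterates of T on x decrease to a fixed point of T.  Given any fixed point x* of T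
  and policies mu, nu attaining it, x* is a supersolution against mu and a subsolution against nu;
  hence mu and nu are essentially proper, and value iteration from 0 in the two single-player
  problems bounds the finite-horizon costs of history-dependent opponents, so that (mu, nu) is a
  saddle point with value x*.  In particular the fixed point is unique.
*)
theory Submission
  imports Defs
begin

section \<open>Semicontinuous functions\<close>

text \<open>None of the operators needs to be a contraction, and even under the policies that the
  assumption provides a prolonging pair may cost -\<infinity>. The remedy is one-sided: a
  subsolution of the affine operator of a pair bounds all its finite-horizon costs from below, so
  that any upper bound on the cost then forces termination. Value iteration from a subsolution
  increases, but finite cost of each single policy gives no bound uniform in the policy. That bound
  is the hard step; it is obtained by compactness, from a limit of policies. Iterating from 0 rather
  than comparing with x* directly matters because the cost has no terminal term. A direct comparison
  leaves the expectation of x* at the current state, which need not vanish when a history-dependent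
  opponent prolongs the play. Iterates from 0 leave no such term and still converge to x*, so
  termination of randomized policies never has to be proved. Costs are only separately
  semicontinuous. Joint measurability is avoided because one of the players is always stationary, so
  that the cost depends on a single control.\<close>

lemma lsc_on_uminus: "lsc_on A (\<lambda>x. - f x) \<longleftrightarrow> usc_on A f"
proof -
  have "{x \<in> A. a < - f x} = {x \<in> A. f x < - a}" for a
    by auto
  then have "lsc_on A (\<lambda>x. - f x) \<longleftrightarrow> (\<forall>a. openin (top_of_set A) {x \<in> A. f x < - a})"
    by (simp add: lsc_on_def)
  also have "\<dots> \<longleftrightarrow> usc_on A f"
    unfolding usc_on_def by (auto dest: spec[where x = "- _"])
  finally show ?thesis .
qed

lemma usc_on_uminus: "usc_on A (\<lambda>x. - f x) \<longleftrightarrow> lsc_on A f"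
  using lsc_on_uminus[of A "\<lambda>x. - f x"] by simp

lemma usc_on_add:
  assumes "usc_on A f" "usc_on A g"
  shows "usc_on A (\<lambda>x. f x + g x)"
  unfolding usc_on_def
proof
  fix a
  have "{x \<in> A. f x + g x < a} = (\<Union>b. {x \<in> A. f x < b} \<inter> {x \<in> A. g x < a - b})" (is "_ = ?R")
  proof
    show "{x \<in> A. f x + g x < a} \<subseteq> ?R"
    proof
      fix x assume x: "x \<in> {x \<in> A. f x + g x < a}"
      then obtain b where "f x < b" "b < a - g x"
        using dense[of "f x" "a - g x"] by auto
      then show "x \<in> ?R" using x by auto
    qed
  qed auto
  then show "openin (top_of_set A) {x \<in> A. f x + g x < a}"
    using assms unfolding usc_on_def by force
qed

lemma continuous_imp_usc_on:
  assumes "continuous_on A g"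
  shows "usc_on A g"
  unfolding usc_on_def
proof
  fix a
  have "{x \<in> A. g x < a} = A \<inter> g -` {..<a}" by auto
  then show "openin (top_of_set A) {x \<in> A. g x < a}"
    using continuous_openin_preimage_gen[OF assms, of "{..<a}"] by simp
qed

text \<open>If no point is maximal, the relatively open sets \<open>{x \<in> A. f x < f b}\<close>
  cover \<open>A\<close>. Among the points \<open>b\<close> of a finite subcover, one with the
  largest \<open>f b\<close> lies in none of its sets.\<close>

lemma usc_on_attains_sup:
  assumes "compact A" "A \<noteq> {}" "usc_on A f"
  shows "\<exists>a\<in>A. \<forall>b\<in>A. f b \<le> f a"
proof (rule ccontr)
  assume "\<not> ?thesis"
  then have ex: "\<forall>a\<in>A. \<exists>b\<in>A. f a < f b" by (auto simp: not_le)
  define C where "C = (\<lambda>b. {x \<in> A. f x < f b}) ` A"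
  have "\<forall>c\<in>C. openin (top_of_set A) c" "A \<subseteq> \<Union>C"
    using assms(3) ex by (auto simp: C_def usc_on_def)
  then obtain D where D: "D \<subseteq> C" "finite D" "A \<subseteq> \<Union>D"
    using assms(1) unfolding compact_eq_openin_cover by meson
  then obtain B where B: "B \<subseteq> A" "finite B" "D = (\<lambda>b. {x \<in> A. f x < f b}) ` B"
    unfolding C_def by (meson finite_subset_image)
  have "B \<noteq> {}" using B D assms(2) by auto
  then have "Max (f ` B) \<in> f ` B" using B(2) by simp
  then obtain b where b: "b \<in> B" "f b = Max (f ` B)" by auto
  then have b': "\<forall>x\<in>B. f x \<le> f b" using B(2) by simp
  have "b \<in> \<Union>D" using B D b by blast
  then show False using B b' by force
qed

text \<open>An infimum is below \<open>a\<close> exactly when some member is, so strict sublevel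
  sets are unions. The pointwise lower bound keeps the real-valued \<open>INF\<close>
  meaningful.\<close>

lemma usc_on_INF:
  assumes "B \<noteq> {}" "\<And>b. b \<in> B \<Longrightarrow> usc_on A (f b)"
    and "\<And>x. x \<in> A \<Longrightarrow> bdd_below ((\<lambda>b. f b x) ` B)"
  shows "usc_on A (\<lambda>x. INF b\<in>B. f b x)"
  unfolding usc_on_def
proof
  fix a
  have "{x \<in> A. (INF b\<in>B. f b x) < a} = (\<Union>b\<in>B. {x \<in> A. f b x < a})"
    using cINF_less_iff[OF assms(1,3)] by auto
  then show "openin (top_of_set A) {x \<in> A. (INF b\<in>B. f b x) < a}"
    using assms(2) by (auto simp: usc_on_def)
qed

lemma usc_on_eventually_less:
  assumes "usc_on A f" "X \<longlonglongrightarrow> a" "a \<in> A" "\<And>k. X k \<in> A" "f a < b"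
  shows "eventually (\<lambda>k. f (X k) < b) sequentially"
proof -
  obtain W where W: "open W" "{x \<in> A. f x < b} = A \<inter> W"
    using assms(1) unfolding usc_on_def openin_open by metis
  then have "a \<in> W" using assms by auto
  then have "eventually (\<lambda>k. X k \<in> W) sequentially"
    using assms(2) W(1) by (simp add: tendsto_def)
  then show ?thesis
    by eventually_elim (use W(2) assms(4) in blast)
qed

text \<open>The value 0 outside \<open>A\<close> turns a function controlled only on a control set
  into one on the whole type, where the measures of the policies live.\<close>

lemma usc_on_borel:
  assumes "usc_on A f" "A \<in> sets borel"
  shows "(\<lambda>x. if x \<in> A then f x else 0) \<in> borel_measurable borel"
proof (rule borel_measurableI_less)
  fix a
  obtain W where W: "open W" "{x \<in> A. f x < a} = A \<inter> W"
    using assms(1) unfolding usc_on_def openin_open by metis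
  have "{x. (if x \<in> A then f x else 0) < a} = (A \<inter> W) \<union> (if 0 < a then - A else {})"
    using W(2) by auto
  then show "{x \<in> space borel. (if x \<in> A then f x else 0) < a} \<in> sets borel"
    using W(1) assms(2) by auto
qed

section \<open>Substochastic matrices\<close>

definition lin :: "nat \<Rightarrow> (nat \<Rightarrow> nat \<Rightarrow> real) \<Rightarrow> (nat \<Rightarrow> real) \<Rightarrow> nat \<Rightarrow> real" where
  "lin n Q x i = (\<Sum>j\<in>{1..n}. Q i j * x j)"

definition aff :: "nat \<Rightarrow> (nat \<Rightarrow> real) \<Rightarrow> (nat \<Rightarrow> nat \<Rightarrow> real) \<Rightarrow> (nat \<Rightarrow> real) \<Rightarrow> nat \<Rightarrow> real" where
  "aff n b Q x i = b i + lin n Q x i"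

definition substoch :: "nat \<Rightarrow> (nat \<Rightarrow> nat \<Rightarrow> real) \<Rightarrow> bool" where
  "substoch n Q \<longleftrightarrow> (\<forall>i\<in>{1..n}. (\<forall>j\<in>{1..n}. 0 \<le> Q i j) \<and> (\<Sum>j\<in>{1..n}. Q i j) \<le> 1)"

text \<open>\<open>(lin n Q ^^ t) (\<lambda>_. 1) i\<close> is the probability that the chain with
  matrix \<open>Q\<close>, started at \<open>i\<close>, is still in \<open>S\<close> after
  \<open>t\<close> steps.\<close>

definition transient :: "nat \<Rightarrow> (nat \<Rightarrow> nat \<Rightarrow> real) \<Rightarrow> bool" where
  "transient n Q \<longleftrightarrow> (\<forall>i\<in>{1..n}. (\<lambda>t. (lin n Q ^^ t) (\<lambda>_. 1) i) \<longlonglongrightarrow> 0)"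

text \<open>Vectors indexed by \<open>S = {1..n}\<close> are functions on all of \<open>nat\<close>; only their values on
  \<open>S\<close> matter.\<close>

definition mono_sub :: "nat \<Rightarrow> ((nat \<Rightarrow> real) \<Rightarrow> nat \<Rightarrow> real) \<Rightarrow> bool" where
  "mono_sub n F \<longleftrightarrow>
     (\<forall>x y. (\<forall>i\<in>{1..n}. x i \<le> y i) \<longrightarrow> (\<forall>i\<in>{1..n}. F x i \<le> F y i)) \<and>
     (\<forall>x d. 0 \<le> d \<longrightarrow> (\<forall>i\<in>{1..n}. F (\<lambda>j. x j + d) i \<le> F x i + d))"

section \<open>Monotone nonexpansive maps and limits of their iterates\<close>

lemma mono_subD1:
  "mono_sub n F \<Longrightarrow> (\<And>i. i \<in> {1..n} \<Longrightarrow> x i \<le> y i) \<Longrightarrow> i \<in> {1..n} \<Longrightarrow> F x i \<le> F y i"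
  unfolding mono_sub_def by blast

lemma mono_subD2:
  "mono_sub n F \<Longrightarrow> 0 \<le> d \<Longrightarrow> i \<in> {1..n} \<Longrightarrow> F (\<lambda>j. x j + d) i \<le> F x i + d"
  unfolding mono_sub_def by blast

lemma mono_sub_funpow:
  assumes "mono_sub n F"
  shows "mono_sub n (F ^^ t)"
proof (induction t)
  case 0 show ?case by (simp add: mono_sub_def)
next
  case (Suc t)
  show ?case unfolding mono_sub_def
  proof (intro conjI allI impI ballI)
    fix x y :: "nat \<Rightarrow> real" and i assume "\<forall>i\<in>{1..n}. x i \<le> y i" "i \<in> {1..n}"
    then show "(F ^^ Suc t) x i \<le> (F ^^ Suc t) y i"
      using mono_subD1[OF assms, of "(F ^^ t) x" "(F ^^ t) y"] mono_subD1[OF Suc, of x y] by auto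
  next
    fix x :: "nat \<Rightarrow> real" and d :: real and i assume d: "0 \<le> d" and i: "i \<in> {1..n}"
    have "F ((F ^^ t) (\<lambda>j. x j + d)) i \<le> F (\<lambda>j. (F ^^ t) x j + d) i"
      using mono_subD1[OF assms _ i] mono_subD2[OF Suc d] by auto
    also have "\<dots> \<le> F ((F ^^ t) x) i + d"
      using mono_subD2[OF assms d i] by auto
    finally show "(F ^^ Suc t) (\<lambda>j. x j + d) i \<le> (F ^^ Suc t) x i + d"
      by simp
  qed
qed

lemma mono_sub_cong:
  assumes "mono_sub n F" "\<And>i. i \<in> {1..n} \<Longrightarrow> x i = y i" "i \<in> {1..n}"
  shows "F x i = F y i"
  using mono_subD1[OF assms(1), of x y] mono_subD1[OF assms(1), of y x] assms(2,3)
  by (simp add: antisym)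

lemma mono_sub_funpow_fixed:
  assumes "mono_sub n F" "\<And>i. i \<in> {1..n} \<Longrightarrow> F x i = x i" "i \<in> {1..n}"
  shows "(F ^^ t) x i = x i"
  using assms(3)
proof (induction t arbitrary: i)
  case (Suc t)
  then have "(F ^^ Suc t) x i = F x i"
    using mono_sub_cong[OF assms(1), of "(F ^^ t) x" x] by auto
  then show ?case using assms(2) Suc by simp
qed simp

lemma mono_sub_funpow_super:
  assumes "mono_sub n F" "\<And>i. i \<in> {1..n} \<Longrightarrow> F x i \<le> x i" "i \<in> {1..n}"
  shows "(F ^^ Suc t) x i \<le> (F ^^ t) x i"
  using mono_subD1[OF mono_sub_funpow[OF assms(1), of t], of "F x" x i] assms(2,3)
  by (simp add: funpow_swap1)

lemma mono_sub_funpow_sub: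
  assumes "mono_sub n F" "\<And>i. i \<in> {1..n} \<Longrightarrow> x i \<le> F x i" "i \<in> {1..n}"
  shows "(F ^^ t) x i \<le> (F ^^ Suc t) x i"
  using mono_subD1[OF mono_sub_funpow[OF assms(1), of t], of x "F x" i] assms(2,3)
  by (simp add: funpow_swap1)

text \<open>Conjugation with negation exchanges sub- and supersolutions, so decreasing iterations
  reduce to increasing ones.\<close>

lemma mono_sub_dual:
  assumes "mono_sub n F"
  shows "mono_sub n (\<lambda>x i. - F (\<lambda>j. - x j) i)"
  unfolding mono_sub_def
proof (intro conjI allI impI ballI)
  fix x y :: "nat \<Rightarrow> real" and i assume "\<forall>i\<in>{1..n}. x i \<le> y i" "i \<in> {1..n}"
  then show "- F (\<lambda>j. - x j) i \<le> - F (\<lambda>j. - y j) i"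
    using mono_subD1[OF assms, of "\<lambda>j. - y j" "\<lambda>j. - x j"] by auto
next
  fix x :: "nat \<Rightarrow> real" and d :: real and i assume d: "0 \<le> d" and i: "i \<in> {1..n}"
  show "- F (\<lambda>j. - (x j + d)) i \<le> - F (\<lambda>j. - x j) i + d"
    using mono_subD2[OF assms d i, of "\<lambda>j. - (x j + d)"] by simp
qed

lemma funpow_dual:
  "((\<lambda>x i. - F (\<lambda>j. - x j) i) ^^ t) x = (\<lambda>i. - (F ^^ t) (\<lambda>j. - x j) i)"
  for F :: "(nat \<Rightarrow> real) \<Rightarrow> nat \<Rightarrow> real"
  by (induction t) auto

text \<open>Monotonicity and the shift inequality together make \<open>F\<close> nonexpansive in the
  maximum norm on \<open>S\<close>, so \<open>F\<close> commutes with the limit of its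
  iterates.\<close>

lemma mono_sub_lim_fixed:
  assumes F: "mono_sub n F" and lim: "\<And>i. i \<in> {1..n} \<Longrightarrow> (\<lambda>t. (F ^^ t) x0 i) \<longlonglongrightarrow> x i"
    and i: "i \<in> {1..n}"
  shows "F x i = x i"
proof -
  have "(\<lambda>t. (F ^^ Suc t) x0 i) \<longlonglongrightarrow> F x i"
  proof (rule tendstoI)
    fix e :: real assume e: "0 < e"
    have "eventually (\<lambda>t. \<forall>j\<in>{1..n}. dist ((F ^^ t) x0 j) (x j) < e / 2) sequentially"
      using lim e by (intro eventually_ball_finite ballI tendstoD) auto
    then show "eventually (\<lambda>t. dist ((F ^^ Suc t) x0 i) (F x i) < e) sequentially"
    proof eventually_elim
      case (elim t)
      have *: "(F ^^ t) x0 j \<le> x j + e / 2 \<and> x j \<le> (F ^^ t) x0 j + e / 2" if "j \<in> {1..n}" for j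
        using bspec[OF elim that] unfolding dist_real_def by linarith
      let ?y = "(F ^^ t) x0"
      have "F ?y i \<le> F (\<lambda>j. x j + e / 2) i" using * by (intro mono_subD1[OF F _ i]) blast
      also have "\<dots> \<le> F x i + e / 2" using mono_subD2[OF F _ i] e by simp
      finally have 1: "F ?y i \<le> F x i + e / 2" .
      have "F x i \<le> F (\<lambda>j. ?y j + e / 2) i" using * by (intro mono_subD1[OF F _ i]) blast
      also have "\<dots> \<le> F ?y i + e / 2" using mono_subD2[OF F _ i] e by simp
      finally show ?case using 1 e by (simp add: dist_real_def abs_if)
    qed
  qed
  then show ?thesis
    using LIMSEQ_unique LIMSEQ_Suc[OF lim[OF i]] by blast
qed

lemma mono_sub_increasing:
  assumes F: "mono_sub n F" and sub: "\<And>i. i \<in> {1..n} \<Longrightarrow> x0 i \<le> F x0 i"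
    and bnd: "\<And>i t. i \<in> {1..n} \<Longrightarrow> (F ^^ t) x0 i \<le> B i"
  obtains x where "\<And>i. i \<in> {1..n} \<Longrightarrow> F x i = x i"
    "\<And>i t. i \<in> {1..n} \<Longrightarrow> (F ^^ t) x0 i \<le> x i"
    "\<And>i. i \<in> {1..n} \<Longrightarrow> (\<lambda>t. (F ^^ t) x0 i) \<longlonglongrightarrow> x i"
proof -
  have "\<exists>l. (\<lambda>t. (F ^^ t) x0 i) \<longlonglongrightarrow> l \<and> (\<forall>t. (F ^^ t) x0 i \<le> l)" if i: "i \<in> {1..n}" for i
  proof -
    have "incseq (\<lambda>t. (F ^^ t) x0 i)"
      by (intro incseq_SucI mono_sub_funpow_sub[OF F sub i])
    then obtain l where "(\<lambda>t. (F ^^ t) x0 i) \<longlonglongrightarrow> l" "\<forall>t. (F ^^ t) x0 i \<le> l"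
      using incseq_convergent[of "\<lambda>t. (F ^^ t) x0 i" "B i"] bnd[OF i] by blast
    then show ?thesis by blast
  qed
  then obtain x where x: "\<And>i. i \<in> {1..n} \<Longrightarrow> (\<lambda>t. (F ^^ t) x0 i) \<longlonglongrightarrow> x i \<and> (\<forall>t. (F ^^ t) x0 i \<le> x i)"
    by metis
  show thesis
    by (rule that[of x]) (use x mono_sub_lim_fixed[OF F, of x0 x] in auto)
qed

lemma mono_sub_decreasing:
  assumes F: "mono_sub n F" and super: "\<And>i. i \<in> {1..n} \<Longrightarrow> F x0 i \<le> x0 i"
    and bnd: "\<And>i t. i \<in> {1..n} \<Longrightarrow> B i \<le> (F ^^ t) x0 i"
  obtains x where "\<And>i. i \<in> {1..n} \<Longrightarrow> F x i = x i"
    "\<And>i t. i \<in> {1..n} \<Longrightarrow> x i \<le> (F ^^ t) x0 i"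
    "\<And>i. i \<in> {1..n} \<Longrightarrow> (\<lambda>t. (F ^^ t) x0 i) \<longlonglongrightarrow> x i"
proof -
  let ?G = "\<lambda>x i. - F (\<lambda>j. - x j) i"
  obtain y where y: "\<And>i. i \<in> {1..n} \<Longrightarrow> ?G y i = y i"
    "\<And>i t. i \<in> {1..n} \<Longrightarrow> (?G ^^ t) (\<lambda>j. - x0 j) i \<le> y i"
    "\<And>i. i \<in> {1..n} \<Longrightarrow> (\<lambda>t. (?G ^^ t) (\<lambda>j. - x0 j) i) \<longlonglongrightarrow> y i"
    by (rule mono_sub_increasing[OF mono_sub_dual[OF F], of "\<lambda>j. - x0 j" "\<lambda>j. - B j"])
      (use super bnd in \<open>auto simp: funpow_dual\<close>)
  show thesis
  proof (rule that[of "\<lambda>j. - y j"])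
    fix i assume i: "i \<in> {1..n}"
    show "F (\<lambda>j. - y j) i = - y i" using y(1)[OF i] by linarith
    show "- y i \<le> (F ^^ t) x0 i" for t using y(2)[OF i, of t] by (simp add: funpow_dual)
    show "(\<lambda>t. (F ^^ t) x0 i) \<longlonglongrightarrow> - y i"
      using tendsto_minus[OF y(3)[OF i]] by (simp add: funpow_dual)
  qed
qed

section \<open>Affine maps with substochastic matrices\<close>

lemma lin_mono:
  assumes "substoch n Q" "\<And>i. i \<in> {1..n} \<Longrightarrow> x i \<le> y i" "i \<in> {1..n}"
  shows "lin n Q x i \<le> lin n Q y i"
  using assms unfolding lin_def substoch_def by (intro sum_mono mult_left_mono) auto

lemma lin_add: "lin n Q (\<lambda>j. x j + y j) i = lin n Q x i + lin n Q y i"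
  by (simp add: lin_def distrib_left sum.distrib)

lemma lin_scale: "lin n Q (\<lambda>j. a * x j) i = a * lin n Q x i"
  by (simp add: lin_def sum_distrib_left mult.left_commute)

lemma lin_const: "lin n Q (\<lambda>j. a) i = a * (\<Sum>j\<in>{1..n}. Q i j)"
  by (simp add: lin_def sum_distrib_left mult.commute)

lemma mono_sub_aff:
  assumes "substoch n Q"
  shows "mono_sub n (aff n b Q)"
  unfolding mono_sub_def
proof (intro conjI allI impI ballI)
  fix x y :: "nat \<Rightarrow> real" and i assume "\<forall>i\<in>{1..n}. x i \<le> y i" "i \<in> {1..n}"
  then show "aff n b Q x i \<le> aff n b Q y i"
    using lin_mono[OF assms, of x y] by (simp add: aff_def)
next
  fix x :: "nat \<Rightarrow> real" and d :: real and i assume "0 \<le> d" "i \<in> {1..n}"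
  then have "d * (\<Sum>j\<in>{1..n}. Q i j) \<le> d * 1"
    using assms unfolding substoch_def by (intro mult_left_mono) auto
  then show "aff n b Q (\<lambda>j. x j + d) i \<le> aff n b Q x i + d"
    by (simp add: aff_def lin_add lin_const)
qed

lemma aff_0: "aff n (\<lambda>_. 0) Q = lin n Q"
  by (auto simp: aff_def fun_eq_iff)

lemma mono_sub_lin: "substoch n Q \<Longrightarrow> mono_sub n (lin n Q)"
  using mono_sub_aff[of n Q "\<lambda>_. 0"] by (simp add: aff_0)

lemma lin_funpow_scale: "(lin n Q ^^ t) (\<lambda>j. a * x j) i = a * (lin n Q ^^ t) x i"
proof -
  have "(lin n Q ^^ t) (\<lambda>j. a * x j) = (\<lambda>i. a * (lin n Q ^^ t) x i)"
    by (induction t) (auto simp: lin_scale)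
  then show ?thesis by simp
qed

lemma lin_funpow_const: "(lin n Q ^^ t) (\<lambda>j. a) i = a * (lin n Q ^^ t) (\<lambda>_. 1) i"
  using lin_funpow_scale[of t n Q a "\<lambda>_. 1"] by simp

text \<open>The payoff of \<open>t\<close> stages with terminal payoff \<open>x\<close> splits into
  the running payoff, which is the iterate from 0, and the expected terminal payoff.\<close>

lemma aff_funpow: "(aff n b Q ^^ t) x i = (aff n b Q ^^ t) (\<lambda>_. 0) i + (lin n Q ^^ t) x i"
proof -
  have "(aff n b Q ^^ t) x = (\<lambda>i. (aff n b Q ^^ t) (\<lambda>_. 0) i + (lin n Q ^^ t) x i)"
    by (induction t) (auto simp: aff_def lin_add)
  then show ?thesis by (rule fun_cong)
qed

lemma lin_funpow_le_const:
  assumes "substoch n Q" "\<And>i. i \<in> {1..n} \<Longrightarrow> x i \<le> K" "0 \<le> K" "i \<in> {1..n}"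
  shows "(lin n Q ^^ t) x i \<le> K"
  using assms(4)
proof (induction t arbitrary: i)
  case (Suc t)
  have "lin n Q ((lin n Q ^^ t) x) i \<le> lin n Q (\<lambda>_. K) i"
    by (intro lin_mono assms(1)) (use Suc in auto)
  also have "\<dots> \<le> K * 1"
    unfolding lin_const using assms(1,3) Suc(2) by (intro mult_left_mono) (auto simp: substoch_def)
  finally show ?case by simp
qed (use assms(2) in simp)

text \<open>On \<open>S\<close> the vector \<open>x\<close> lies between \<open>- K\<close> and
  \<open>K\<close>, and monotonicity carries this over to multiples of the survival
  probability.\<close>

lemma transient_lin_0:
  assumes "substoch n Q" "transient n Q" "i \<in> {1..n}"
  shows "(\<lambda>t. (lin n Q ^^ t) x i) \<longlonglongrightarrow> 0"
proof -
  define K where "K = Max ((\<lambda>i. \<bar>x i\<bar>) ` {1..n})"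
  have K: "\<bar>x j\<bar> \<le> K" if "j \<in> {1..n}" for j
    unfolding K_def using that by (intro Max_ge) auto
  have lim: "(\<lambda>t. K * (lin n Q ^^ t) (\<lambda>_. 1) i) \<longlonglongrightarrow> 0"
    "(\<lambda>t. - K * (lin n Q ^^ t) (\<lambda>_. 1) i) \<longlonglongrightarrow> 0"
    using assms(2,3) tendsto_mult_right_zero unfolding transient_def by blast+
  have M: "mono_sub n (lin n Q ^^ t)" for t by (rule mono_sub_funpow[OF mono_sub_lin[OF assms(1)]])
  have "(lin n Q ^^ t) x i \<le> K * (lin n Q ^^ t) (\<lambda>_. 1) i"
    "- K * (lin n Q ^^ t) (\<lambda>_. 1) i \<le> (lin n Q ^^ t) x i" for t
    using mono_subD1[OF M, of x "\<lambda>_. K" i t] mono_subD1[OF M, of "\<lambda>_. - K" x i t] assms(3) K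
      lin_funpow_const[of t n Q K i] lin_funpow_const[of t n Q "- K" i]
    by (force simp: abs_le_iff minus_le_iff)+
  then show ?thesis
    by (intro tendsto_sandwich[OF _ _ lim(2) lim(1)]) auto
qed

text \<open>The iterates from a subsolution stay above it; splitting off the terminal term leaves a
  lower bound for the running payoff. That term is bounded in \<open>t\<close>, and it vanishes in
  the limit when \<open>Q\<close> is transient.\<close>

lemma aff_funpow_sub:
  assumes "substoch n Q" "\<And>i. i \<in> {1..n} \<Longrightarrow> w i \<le> aff n b Q w i" "i \<in> {1..n}"
  shows "w i - (lin n Q ^^ t) w i \<le> (aff n b Q ^^ t) (\<lambda>_. 0) i"
proof -
  have "w i \<le> (aff n b Q ^^ t) w i"
  proof (induction t)
    case (Suc t)
    then show ?case
      using mono_sub_funpow_sub[OF mono_sub_aff[OF assms(1)] assms(2,3), of t] by simp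
  qed simp
  then show ?thesis using aff_funpow[of t n b Q w i] by simp
qed

lemma aff_funpow_super:
  assumes "substoch n Q" "\<And>i. i \<in> {1..n} \<Longrightarrow> aff n b Q w i \<le> w i" "i \<in> {1..n}"
  shows "(aff n b Q ^^ t) (\<lambda>_. 0) i \<le> w i - (lin n Q ^^ t) w i"
proof -
  have "(aff n b Q ^^ t) w i \<le> w i"
  proof (induction t)
    case (Suc t)
    then show ?case
      using mono_sub_funpow_super[OF mono_sub_aff[OF assms(1)] assms(2,3), of t] by simp
  qed simp
  then show ?thesis using aff_funpow[of t n b Q w i] by simp
qed

lemma lin_funpow_bounded:
  assumes "substoch n Q"
  obtains K where "\<And>i t. i \<in> {1..n} \<Longrightarrow> \<bar>(lin n Q ^^ t) x i\<bar> \<le> K"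
proof -
  define K where "K = Max (insert 0 ((\<lambda>i. \<bar>x i\<bar>) ` {1..n}))"
  have K0: "0 \<le> K" unfolding K_def by (intro Max_ge) auto
  have K: "\<bar>x j\<bar> \<le> K" if "j \<in> {1..n}" for j
    unfolding K_def using that by (intro Max_ge) auto
  have "\<bar>(lin n Q ^^ t) x i\<bar> \<le> K" if i: "i \<in> {1..n}" for i t
  proof -
    have "(lin n Q ^^ t) x i \<le> K"
      by (rule lin_funpow_le_const[OF assms _ K0 i]) (use K in force)
    moreover have "(lin n Q ^^ t) (\<lambda>j. - 1 * x j) i \<le> K"
      by (rule lin_funpow_le_const[OF assms _ K0 i]) (use K in force)
    ultimately show ?thesis unfolding lin_funpow_scale by simp
  qed
  then show thesis by (rule that)
qed

text \<open>\<open>W\<close> is the expected absorption time, obtained as the limit of the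
  increasing expected numbers of steps spent in \<open>S\<close> before time
  \<open>t\<close>.\<close>

lemma transient_potential:
  assumes Q: "substoch n Q" and tr: "transient n Q"
  obtains W where "\<And>i. i \<in> {1..n} \<Longrightarrow> W i = 1 + lin n Q W i"
proof -
  let ?F = "aff n (\<lambda>_. 1) Q" and ?p = "\<lambda>t. (lin n Q ^^ t) (\<lambda>_. 1)"
  have F: "mono_sub n ?F" by (rule mono_sub_aff[OF Q])
  have "eventually (\<lambda>N. \<forall>i\<in>{1..n}. ?p N i < 1 / 2) sequentially"
    using tr unfolding transient_def
    by (intro eventually_ball_finite ballI order_tendstoD(2)[of _ 0]) auto
  then obtain N where N: "\<And>i. i \<in> {1..n} \<Longrightarrow> ?p N i < 1 / 2"
    by (metis (no_types, lifting) eventually_happens' sequentially_bot)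
  have le: "(?F ^^ t) (\<lambda>_. 0) i \<le> real t" if "i \<in> {1..n}" for t i
    using that
  proof (induction t arbitrary: i)
    case (Suc t)
    have "lin n Q ((?F ^^ t) (\<lambda>_. 0)) i \<le> lin n Q (\<lambda>_. real t) i"
      by (intro lin_mono Q) (use Suc in auto)
    also have "\<dots> \<le> real t * 1"
      unfolding lin_const using Q Suc(2) by (intro mult_left_mono) (auto simp: substoch_def)
    finally show ?case by (simp add: aff_def[of n _ Q "(?F ^^ t) (\<lambda>_. 0)" i])
  qed simp
  have F0: "(0::real) \<le> ?F (\<lambda>_. 0) i" if "i \<in> {1..n}" for i
    by (simp add: aff_def lin_const)
  have inc: "(?F ^^ t) (\<lambda>_. 0) i \<le> (?F ^^ Suc t) (\<lambda>_. 0) i" if "i \<in> {1..n}" for t i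
    by (rule mono_sub_funpow_sub[OF F F0 that])
  \<comment> \<open>Survival up to time \<open>N\<close> has probability below 1/2. The first
    \<open>N\<close> steps contribute at most \<open>N\<close> and the remaining ones at most half
    of the bound; \<open>2 * N\<close> solves B = N + B / 2.\<close>
  have bnd: "(?F ^^ t) (\<lambda>_. 0) i \<le> 2 * real N" if i: "i \<in> {1..n}" for t i
    using i
  proof (induction t arbitrary: i)
    case (Suc t)
    have "(?F ^^ Suc t) (\<lambda>_. 0) i \<le> (?F ^^ (N + t)) (\<lambda>_. 0) i" if "N \<noteq> 0"
    proof -
      have "incseq (\<lambda>t. (?F ^^ t) (\<lambda>_. 0) i)"
        using inc[OF Suc(2)] by (intro incseq_SucI) auto
      then show ?thesis using incseqD[of "\<lambda>t. (?F ^^ t) (\<lambda>_. 0) i" "Suc t" "N + t"] that by simp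
    qed
    \<comment> \<open>At time 0 the survival probability is 1. That \<open>N\<close> is positive
      gives \<open>Suc t \<le> N + t\<close> above.\<close>
    moreover have "N \<noteq> 0" using N[OF Suc(2)] by (cases N) auto
    ultimately have "(?F ^^ Suc t) (\<lambda>_. 0) i \<le> (?F ^^ N) ((?F ^^ t) (\<lambda>_. 0)) i"
      by (simp add: funpow_add)
    also have "\<dots> \<le> (?F ^^ N) (\<lambda>_. 2 * real N) i"
      by (intro mono_subD1[OF mono_sub_funpow[OF F]] Suc)
    also have "\<dots> = (?F ^^ N) (\<lambda>_. 0) i + 2 * real N * ?p N i"
      using aff_funpow[of N n "\<lambda>_. 1" Q "\<lambda>_. 2 * real N" i] lin_funpow_const[of N n Q "2 * real N" i]
      by linarith
    also have "\<dots> \<le> real N + 2 * real N * (1 / 2)"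
      using le[OF Suc(2), of N] N[OF Suc(2)] by (intro add_mono mult_left_mono) auto
    finally show ?case by simp
  qed simp
  obtain W where W: "\<And>i. i \<in> {1..n} \<Longrightarrow> ?F W i = W i"
    by (rule mono_sub_increasing[OF F F0, of "\<lambda>_. 2 * real N"]) (use bnd in blast)+
  show thesis
    by (rule that[of W]) (use W in \<open>simp add: aff_def\<close>)
qed

text \<open>The expected absorption time scaled by \<open>- K\<close> is the total payoff for the
  constant stage payoff \<open>- K\<close>, and \<open>K\<close> is chosen so that
  \<open>- K\<close> is at most \<open>b\<close> on \<open>S\<close>.\<close>

lemma transient_subsolution:
  assumes "substoch n Q" "transient n Q"
  obtains w where "\<And>i. i \<in> {1..n} \<Longrightarrow> w i \<le> aff n b Q w i"
proof -
  obtain W where W: "\<And>i. i \<in> {1..n} \<Longrightarrow> W i = 1 + lin n Q W i"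
    using transient_potential[OF assms] by metis
  define K where "K = Max ((\<lambda>i. \<bar>b i\<bar>) ` {1..n})"
  have K: "\<bar>b j\<bar> \<le> K" if "j \<in> {1..n}" for j
    unfolding K_def using that by (intro Max_ge) auto
  show thesis
  proof (rule that[of "\<lambda>i. - K * W i"])
    fix i assume i: "i \<in> {1..n}"
    have "K * W i = K + K * lin n Q W i"
      using W[OF i] by (metis distrib_left mult.right_neutral)
    then show "- K * W i \<le> aff n b Q (\<lambda>i. - K * W i) i"
      using K[OF i] unfolding aff_def lin_scale by (simp add: abs_le_iff)
  qed
qed

section \<open>Single-player stochastic shortest path problems\<close>

text \<open>Subsequences are refined one index at a time; stability of \<open>P i\<close> under
  refinement preserves what was achieved for the earlier indices.\<close>

lemma finite_common_subsequence:
  fixes P :: "'i \<Rightarrow> (nat \<Rightarrow> nat) \<Rightarrow> bool"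
  assumes "finite I"
    and ex: "\<And>i r. i \<in> I \<Longrightarrow> strict_mono (r :: nat \<Rightarrow> nat) \<Longrightarrow> \<exists>s :: nat \<Rightarrow> nat. strict_mono s \<and> P i (r \<circ> s)"
    and sub: "\<And>i r s. i \<in> I \<Longrightarrow> P i r \<Longrightarrow> strict_mono (s :: nat \<Rightarrow> nat) \<Longrightarrow> P i (r \<circ> s)"
  shows "\<exists>r. strict_mono r \<and> (\<forall>i\<in>I. P i r)"
proof -
  have "\<exists>r. strict_mono r \<and> (\<forall>i\<in>J. P i r)" if "finite J" "J \<subseteq> I" for J
    using that
  proof (induction J rule: finite_induct)
    case empty
    show ?case by (auto intro: strict_mono_id)
  next
    case (insert i J)
    then obtain r where r: "strict_mono r" "\<forall>j\<in>J. P j r" by auto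
    obtain s where s: "strict_mono s" "P i (r \<circ> s)" using ex[of i r] r(1) insert.prems by blast
    have "strict_mono (r \<circ> s)" using r(1) s(1) by (rule strict_mono_o)
    moreover have "P j (r \<circ> s)" if "j \<in> J" for j
      using sub[of j r s] r(2) s(1) that insert.prems by blast
    ultimately show ?case using s(2) by blast
  qed
  then show ?thesis using assms(1) by blast
qed

text \<open>A maximization problem. Player II facing a stationary policy of player I is an instance
  with the costs as rewards; player I facing a stationary policy of player II is one after negating
  the costs.\<close>

locale decision =
  fixes n :: nat
    and A :: "nat \<Rightarrow> 'a::metric_space set"
    and r :: "nat \<Rightarrow> 'a \<Rightarrow> real"
    and q :: "nat \<Rightarrow> nat \<Rightarrow> 'a \<Rightarrow> real"
  assumes compact: "i \<in> {1..n} \<Longrightarrow> compact (A i)"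
    and nonempty: "i \<in> {1..n} \<Longrightarrow> A i \<noteq> {}"
    and usc: "i \<in> {1..n} \<Longrightarrow> usc_on (A i) (r i)"
    and cont: "i \<in> {1..n} \<Longrightarrow> j \<in> {1..n} \<Longrightarrow> continuous_on (A i) (q i j)"
    and q_nonneg: "i \<in> {1..n} \<Longrightarrow> j \<in> {1..n} \<Longrightarrow> a \<in> A i \<Longrightarrow> 0 \<le> q i j a"
    and q_sum: "i \<in> {1..n} \<Longrightarrow> a \<in> A i \<Longrightarrow> (\<Sum>j\<in>{1..n}. q i j a) \<le> 1"
begin

definition look :: "(nat \<Rightarrow> real) \<Rightarrow> nat \<Rightarrow> 'a \<Rightarrow> real" where
  "look x i a = r i a + (\<Sum>j\<in>{1..n}. q i j a * x j)"

definition bell :: "(nat \<Rightarrow> real) \<Rightarrow> nat \<Rightarrow> real" where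
  "bell x i = (SUP a\<in>A i. look x i a)"

definition act :: "(nat \<Rightarrow> 'a) \<Rightarrow> (nat \<Rightarrow> real) \<Rightarrow> nat \<Rightarrow> real" where
  "act \<nu> = aff n (\<lambda>i. r i (\<nu> i)) (\<lambda>i j. q i j (\<nu> i))"

definition Q :: "(nat \<Rightarrow> 'a) \<Rightarrow> nat \<Rightarrow> nat \<Rightarrow> real" where
  "Q \<nu> i j = q i j (\<nu> i)"

lemma act_look: "act \<nu> x i = look x i (\<nu> i)"
  by (simp add: act_def look_def aff_def lin_def)

lemma act_aff: "act \<nu> = aff n (\<lambda>i. r i (\<nu> i)) (Q \<nu>)"
  by (simp add: act_def Q_def[abs_def])

lemma substoch_Q: "\<nu> \<in> SD1 n A \<Longrightarrow> substoch n (Q \<nu>)"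
  using q_nonneg q_sum by (auto simp: substoch_def Q_def SD1_def)

lemma usc_look: "i \<in> {1..n} \<Longrightarrow> usc_on (A i) (look x i)"
  unfolding look_def[abs_def]
  by (intro usc_on_add usc continuous_imp_usc_on continuous_on_sum continuous_on_mult
      cont continuous_on_const)

lemma look_attained:
  assumes "i \<in> {1..n}"
  shows "\<exists>a\<in>A i. bell x i = look x i a" "\<And>a. a \<in> A i \<Longrightarrow> look x i a \<le> bell x i"
proof -
  obtain a where a: "a \<in> A i" "\<And>b. b \<in> A i \<Longrightarrow> look x i b \<le> look x i a"
    using usc_on_attains_sup[OF compact nonempty usc_look] assms by metis
  have "bell x i = look x i a"
    unfolding bell_def using a by (intro cSup_eq_maximum) auto
  then show "\<exists>a\<in>A i. bell x i = look x i a" "\<And>a. a \<in> A i \<Longrightarrow> look x i a \<le> bell x i"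
    using a by auto
qed

lemma act_le_bell: "\<nu> \<in> SD1 n A \<Longrightarrow> i \<in> {1..n} \<Longrightarrow> act \<nu> x i \<le> bell x i"
  unfolding act_look by (rule look_attained) (auto simp: SD1_def)

lemma greedy_exists: "\<exists>\<nu>\<in>SD1 n A. \<forall>i\<in>{1..n}. bell x i = act \<nu> x i"
proof -
  have "\<forall>i\<in>{1..n}. \<exists>a. a \<in> A i \<and> bell x i = look x i a"
    using look_attained(1) by blast
  then obtain \<nu> where "\<forall>i\<in>{1..n}. \<nu> i \<in> A i \<and> bell x i = look x i (\<nu> i)"
    by (rule bchoice[THEN exE])
  then show ?thesis by (auto simp: SD1_def act_look)
qed

lemma mono_sub_act: "\<nu> \<in> SD1 n A \<Longrightarrow> mono_sub n (act \<nu>)"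
  unfolding act_aff by (intro mono_sub_aff substoch_Q)

lemma mono_sub_bell: "mono_sub n bell"
  unfolding mono_sub_def
proof (intro conjI allI impI ballI)
  fix x y :: "nat \<Rightarrow> real" and i assume *: "\<forall>i\<in>{1..n}. x i \<le> y i" "i \<in> {1..n}"
  obtain \<nu> where \<nu>: "\<nu> \<in> SD1 n A" "\<And>i. i \<in> {1..n} \<Longrightarrow> bell x i = act \<nu> x i"
    using greedy_exists by blast
  have "act \<nu> x i \<le> act \<nu> y i" using mono_subD1[OF mono_sub_act[OF \<nu>(1)]] * by blast
  then show "bell x i \<le> bell y i" using \<nu>(2)[OF *(2)] act_le_bell[OF \<nu>(1) *(2), of y] by simp
next
  fix x :: "nat \<Rightarrow> real" and d :: real and i assume d: "0 \<le> d" and i: "i \<in> {1..n}"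
  obtain \<nu> where \<nu>: "\<nu> \<in> SD1 n A" "\<And>i. i \<in> {1..n} \<Longrightarrow> bell (\<lambda>j. x j + d) i = act \<nu> (\<lambda>j. x j + d) i"
    using greedy_exists by blast
  have "act \<nu> (\<lambda>j. x j + d) i \<le> act \<nu> x i + d" by (rule mono_subD2[OF mono_sub_act[OF \<nu>(1)] d i])
  then show "bell (\<lambda>j. x j + d) i \<le> bell x i + d"
    using \<nu>(2)[OF i] act_le_bell[OF \<nu>(1) i, of x] by simp
qed

end

text \<open>A policy with a subsolution has total reward bounded below; prolonging policies of the game
  with this property are excluded by the model assumption.\<close>

locale proper_decision = decision +
  assumes proper: "\<And>\<nu> w. \<nu> \<in> SD1 n A \<Longrightarrow> (\<And>i. i \<in> {1..n} \<Longrightarrow> w i \<le> act \<nu> w i) \<Longrightarrow> transient n (Q \<nu>)"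
begin

section \<open>Uniqueness of the fixed point and convergence of value iteration\<close>

lemma transient_act_lim:
  assumes "\<nu> \<in> SD1 n A" "transient n (Q \<nu>)" "\<And>i. i \<in> {1..n} \<Longrightarrow> act \<nu> x i = x i" "i \<in> {1..n}"
  shows "(\<lambda>t. (act \<nu> ^^ t) y i) \<longlonglongrightarrow> x i"
proof -
  have "(act \<nu> ^^ t) y i = x i + (lin n (Q \<nu>) ^^ t) y i - (lin n (Q \<nu>) ^^ t) x i" for t
    using mono_sub_funpow_fixed[OF mono_sub_act[OF assms(1)] assms(3,4), of t]
      aff_funpow[of t n _ "Q \<nu>" y i] aff_funpow[of t n _ "Q \<nu>" x i]
    unfolding act_aff by simp
  moreover have "(\<lambda>t. x i + (lin n (Q \<nu>) ^^ t) y i - (lin n (Q \<nu>) ^^ t) x i) \<longlonglongrightarrow> x i + 0 - 0"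
    by (intro tendsto_intros transient_lin_0[OF substoch_Q[OF assms(1)] assms(2,4)])
  ultimately show ?thesis by simp
qed

text \<open>A policy greedy for \<open>x\<close> has \<open>x\<close> as a fixed point, so it is
  transient by \<open>proper\<close> and its iterates from any start tend to \<open>x\<close>. As
  \<open>y\<close> is a supersolution for this policy, the iterates from \<open>y\<close> stay below
  \<open>y\<close>.\<close>

lemma fixed_point_le:
  assumes x: "\<And>i. i \<in> {1..n} \<Longrightarrow> bell x i = x i" and y: "\<And>i. i \<in> {1..n} \<Longrightarrow> bell y i = y i"
    and i: "i \<in> {1..n}"
  shows "x i \<le> y i"
proof -
  obtain \<nu> where \<nu>: "\<nu> \<in> SD1 n A" "\<And>i. i \<in> {1..n} \<Longrightarrow> bell x i = act \<nu> x i"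
    using greedy_exists by blast
  have fx: "act \<nu> x i = x i" if "i \<in> {1..n}" for i using \<nu>(2) x that by simp
  have tr: "transient n (Q \<nu>)" by (rule proper[OF \<nu>(1), of x]) (simp add: fx)
  have sup: "act \<nu> y j \<le> y j" if "j \<in> {1..n}" for j
    using act_le_bell[OF \<nu>(1) that, of y] y[OF that] by simp
  have "(act \<nu> ^^ t) y i \<le> y i" for t
  proof (induction t)
    case (Suc t)
    then show ?case using mono_sub_funpow_super[OF mono_sub_act[OF \<nu>(1)] sup i, of t] by simp
  qed simp
  then show ?thesis
    by (intro LIMSEQ_le_const2[OF transient_act_lim[OF \<nu>(1) tr fx i, of y]]) auto
qed

text \<open>The iterates are squeezed: from below by those of a policy greedy for \<open>x\<close>,
  from above by the Bellman iterates of \<open>x\<close> raised by a constant \<open>d\<close>. The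
  latter decrease to a fixed point, which is \<open>x\<close> by uniqueness.\<close>

lemma value_iteration:
  assumes x: "\<And>i. i \<in> {1..n} \<Longrightarrow> bell x i = x i" and i: "i \<in> {1..n}"
  shows "(\<lambda>t. (bell ^^ t) y i) \<longlonglongrightarrow> x i"
proof -
  obtain \<nu> where \<nu>: "\<nu> \<in> SD1 n A" "\<And>i. i \<in> {1..n} \<Longrightarrow> bell x i = act \<nu> x i"
    using greedy_exists by blast
  have fx: "act \<nu> x i = x i" if "i \<in> {1..n}" for i using \<nu>(2) x that by simp
  have tr: "transient n (Q \<nu>)" by (rule proper[OF \<nu>(1), of x]) (simp add: fx)
  have low: "(act \<nu> ^^ t) y i \<le> (bell ^^ t) y i" for t
    using i
  proof (induction t arbitrary: i)
    case (Suc t)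
    have "act \<nu> ((act \<nu> ^^ t) y) i \<le> act \<nu> ((bell ^^ t) y) i"
      by (rule mono_subD1[OF mono_sub_act[OF \<nu>(1)] Suc.IH Suc.prems])
    also have "\<dots> \<le> bell ((bell ^^ t) y) i" by (rule act_le_bell[OF \<nu>(1) Suc.prems])
    finally show ?case by simp
  qed simp
  define d where "d = Max (insert 0 ((\<lambda>i. y i - x i) ` {1..n}))"
  have d0: "0 \<le> d" unfolding d_def by (intro Max_ge) auto
  have d: "y j \<le> x j + d" if "j \<in> {1..n}" for j
  proof -
    have "y j - x j \<le> d" unfolding d_def using that by (intro Max_ge) auto
    then show ?thesis by simp
  qed
  let ?z = "\<lambda>j. x j + d"
  have "bell ?z j \<le> ?z j" if "j \<in> {1..n}" for j
    using mono_subD2[OF mono_sub_bell d0 that, of x] x[OF that] by simp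
  moreover have "x j \<le> (bell ^^ t) ?z j" if "j \<in> {1..n}" for t j
    using mono_subD1[OF mono_sub_funpow[OF mono_sub_bell] _ that, of x ?z t] d0
      mono_sub_funpow_fixed[OF mono_sub_bell x that, of t] by simp
  ultimately obtain x' where x': "\<And>i. i \<in> {1..n} \<Longrightarrow> bell x' i = x' i"
    "\<And>i. i \<in> {1..n} \<Longrightarrow> (\<lambda>t. (bell ^^ t) ?z i) \<longlonglongrightarrow> x' i"
    using mono_sub_decreasing[OF mono_sub_bell, of ?z x] by metis
  have "x' i = x i" using fixed_point_le[OF x x'(1) i] fixed_point_le[OF x'(1) x i] by simp
  then have up: "(\<lambda>t. (bell ^^ t) ?z i) \<longlonglongrightarrow> x i" using x'(2)[OF i] by simp
  have "(bell ^^ t) y i \<le> (bell ^^ t) ?z i" for t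
    by (rule mono_subD1[OF mono_sub_funpow[OF mono_sub_bell] d i])
  then show ?thesis
    by (intro tendsto_sandwich[OF _ _ transient_act_lim[OF \<nu>(1) tr fx i, of y] up])
      (auto simp: low)
qed

text \<open>If subsolutions were unbounded, subtracting from each its maximum would produce in the limit a policy with a set \<open>D\<close> of states (those staying within bounded distance of the
  maximum) that is never left, together with a subsolution of this policy on \<open>D\<close>; pasting it with
  the given subsolution off \<open>D\<close> contradicts \<open>proper\<close>.\<close>

lemma subsolutions_bounded:
  assumes \<nu>0: "\<nu>0 \<in> SD1 n A" and y: "\<And>i. i \<in> {1..n} \<Longrightarrow> y i \<le> act \<nu>0 y i"
  shows "\<exists>B. \<forall>x. (\<forall>i\<in>{1..n}. x i \<le> bell x i) \<longrightarrow> (\<forall>i\<in>{1..n}. x i \<le> B)"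
proof (rule ccontr)
  assume "\<not> ?thesis"
  then have "\<forall>k::nat. \<exists>x. (\<forall>i\<in>{1..n}. x i \<le> bell x i) \<and> (\<exists>i\<in>{1..n}. real k < x i)"
    by (meson not_le)
  then obtain X where X: "\<And>k i. i \<in> {1..n} \<Longrightarrow> X k i \<le> bell (X k) i"
    and Xbig: "\<And>k. \<exists>i\<in>{1..n}. real k < X k i" by metis
  have "\<forall>k. \<exists>\<nu>\<in>SD1 n A. \<forall>i\<in>{1..n}. X k i \<le> act \<nu> (X k) i"
    using greedy_exists X by metis
  then obtain N where N: "\<And>k. N k \<in> SD1 n A" "\<And>k i. i \<in> {1..n} \<Longrightarrow> X k i \<le> act (N k) (X k) i"
    by metis
  define M where "M k = Max (X k ` {1..n})" for k
  \<comment> \<open>The vectors themselves diverge; only the depths below their maximum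
    \<open>M k\<close> can have useful limits.\<close>
  define d where "d k i = M k - X k i" for k i
  have ne: "{1..n} \<noteq> {}" using Xbig by blast
  have XM: "X k i \<le> M k" if "i \<in> {1..n}" for k i
    unfolding M_def using that by (intro Max_ge) auto
  have d0: "0 \<le> d k i" if "i \<in> {1..n}" for k i using XM[OF that, of k] by (simp add: d_def)
  have att: "\<exists>i\<in>{1..n}. d k i = 0" for k
  proof -
    have "M k \<in> X k ` {1..n}" unfolding M_def using ne by (intro Max_in) auto
    then show ?thesis by (auto simp: d_def)
  qed
  have Mk: "real k \<le> M k" for k using Xbig[of k] XM[of _ k] by fastforce
  \<comment> \<open>The depths may be unbounded at some states, so their limits are sought in the
    extended reals, where compactness needs no bound.\<close>
  define P where "P i s \<longleftrightarrow> (\<exists>a\<in>A i. (\<lambda>k. N (s k) i) \<longlonglongrightarrow> a) \<and>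
      (\<exists>l. (\<lambda>k. ereal (d (s k) i)) \<longlonglongrightarrow> l)" for i s
  have "\<exists>s. strict_mono s \<and> (\<forall>i\<in>{1..n}. P i s)"
  proof (rule finite_common_subsequence)
    fix i and s :: "nat \<Rightarrow> nat" assume i: "i \<in> {1..n}"
    have "\<forall>k. N (s k) i \<in> A i" using N(1) i by (auto simp: SD1_def)
    then obtain a s1 where a: "a \<in> A i" "strict_mono s1" "((\<lambda>k. N (s k) i) \<circ> s1) \<longlonglongrightarrow> a"
      using compact[OF i] unfolding compact_eq_seq_compact_metric seq_compact_def by metis
    obtain l s2 where l: "strict_mono s2" "((\<lambda>k. ereal (d (s (s1 k)) i)) \<circ> s2) \<longlonglongrightarrow> l"
      using compact_complete_linorder[of "\<lambda>k. ereal (d (s (s1 k)) i)"] by blast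
    have "((\<lambda>k. N (s k) i) \<circ> s1 \<circ> s2) \<longlonglongrightarrow> a" by (rule LIMSEQ_subseq_LIMSEQ[OF a(3) l(1)])
    then show "\<exists>s'. strict_mono s' \<and> P i (s \<circ> s')"
      using a l by (intro exI[of _ "s1 \<circ> s2"]) (auto simp: P_def o_def intro: strict_mono_o[unfolded o_def])
  next
    fix i s s' assume "P i s" "strict_mono (s' :: nat \<Rightarrow> nat)"
    then show "P i (s \<circ> s')"
      using LIMSEQ_subseq_LIMSEQ[of "\<lambda>k. N (s k) i" _ s']
        LIMSEQ_subseq_LIMSEQ[of "\<lambda>k. ereal (d (s k) i)" _ s']
      unfolding P_def o_def by blast
  qed simp
  then obtain s where s: "strict_mono s" "\<And>i. i \<in> {1..n} \<Longrightarrow> P i s" by blast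
  from s(2) obtain \<nu> l where \<nu>A: "\<And>i. i \<in> {1..n} \<Longrightarrow> \<nu> i \<in> A i"
    and \<nu>lim: "\<And>i. i \<in> {1..n} \<Longrightarrow> (\<lambda>k. N (s k) i) \<longlonglongrightarrow> \<nu> i"
    and llim: "\<And>i. i \<in> {1..n} \<Longrightarrow> (\<lambda>k. ereal (d (s k) i)) \<longlonglongrightarrow> l i"
    unfolding P_def by metis
  have NA: "N k i \<in> A i" if "i \<in> {1..n}" for k i using N(1) that by (auto simp: SD1_def)
  have l0: "0 \<le> l i" if "i \<in> {1..n}" for i
    by (rule LIMSEQ_le_const[OF llim[OF that]]) (use d0[OF that] in auto)
  have qlim: "(\<lambda>k. q i j (N (s k) i)) \<longlonglongrightarrow> q i j (\<nu> i)" if "i \<in> {1..n}" "j \<in> {1..n}" for i j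
    using continuous_on_tendsto_compose[OF cont[OF that] \<nu>lim[OF that(1)] \<nu>A[OF that(1)]] NA[OF that(1)]
    by simp
  have Mlim: "filterlim (\<lambda>k. M (s k)) at_top sequentially"
  proof (rule filterlim_at_top_mono[OF filterlim_real_sequentially])
    show "\<forall>\<^sub>F k in sequentially. real k \<le> M (s k)"
      using Mk seq_suble[OF s(1)] by (intro always_eventually allI) (meson le_trans of_nat_mono order_trans)
  qed
  define D where "D = {i\<in>{1..n}. l i \<noteq> \<infinity>}"
  define e where "e i = real_of_ereal (l i)" for i
  have dlim: "(\<lambda>k. d (s k) i) \<longlonglongrightarrow> e i" if "i \<in> D" for i
  proof -
    have "l i = ereal (e i)" using that l0[of i] by (cases "l i") (auto simp: D_def e_def)
    then show ?thesis using llim[of i] that by (simp add: D_def)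
  qed
  have dinf: "filterlim (\<lambda>k. d (s k) i) at_top sequentially" if "i \<in> {1..n}" "i \<notin> D" for i
    using llim[OF that(1)] that by (simp add: D_def tendsto_PInfty_eq_at_top)
  \<comment> \<open>For each \<open>k\<close> some state has depth 0, so among finitely many states
    not all depths can diverge.\<close>
  have Dne: "D \<noteq> {}"
  proof
    assume "D = {}"
    then have "\<forall>i\<in>{1..n}. \<forall>\<^sub>F k in sequentially. 0 < d (s k) i"
      using dinf by (simp add: filterlim_at_top_dense)
    then have "\<forall>\<^sub>F k in sequentially. \<forall>i\<in>{1..n}. 0 < d (s k) i"
      by (intro eventually_ball_finite) auto
    then obtain k where "\<forall>i\<in>{1..n}. 0 < d (s k) i" by (metis (no_types, lifting) eventually_happens' sequentially_bot)
    then show False using att[of "s k"] by force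
  qed
  have DS: "D \<subseteq> {1..n}" by (auto simp: D_def)
  \<comment> \<open>The subsolution inequality in terms of depths. Both summands on the left are
    nonnegative, and along \<open>s\<close> the right side stays bounded above at states of
    \<open>D\<close>. Hence a coefficient on the left whose cofactor diverges must vanish in the
    limit: this applies to transitions out of \<open>D\<close> and, through \<open>M k\<close>, to
    termination.\<close>
  have key: "(\<Sum>j\<in>{1..n}. q i j (N k i) * d k j) + (1 - (\<Sum>j\<in>{1..n}. q i j (N k i))) * M k
      \<le> r i (N k i) + d k i" if i: "i \<in> {1..n}" for i k
  proof -
    have "(\<Sum>j\<in>{1..n}. q i j (N k i) * d k j)
        = (\<Sum>j\<in>{1..n}. q i j (N k i)) * M k - (\<Sum>j\<in>{1..n}. q i j (N k i) * X k j)"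
      by (simp add: d_def right_diff_distrib sum_subtractf sum_distrib_right)
    then show ?thesis
      using N(2)[OF i, of k] by (simp add: act_look look_def d_def left_diff_distrib)
  qed
  \<comment> \<open>Upper semicontinuity controls the rewards along the subsequence only from above,
    which is the direction that \<open>key\<close> asks for.\<close>
  have R: "\<forall>\<^sub>F k in sequentially. r i (N (s k) i) + d (s k) i < b"
    if "i \<in> D" "r i (\<nu> i) + e i < b" for i b
  proof -
    define h where "h = (b - r i (\<nu> i) - e i) / 2"
    have h: "0 < h" using that by (simp add: h_def)
    have i: "i \<in> {1..n}" using that DS by auto
    have "\<forall>\<^sub>F k in sequentially. r i (N (s k) i) < r i (\<nu> i) + h"
      by (rule usc_on_eventually_less[OF usc[OF i] \<nu>lim[OF i] \<nu>A[OF i] NA[OF i]]) (use h in simp)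
    moreover have "\<forall>\<^sub>F k in sequentially. d (s k) i < e i + h"
      using order_tendstoD(2)[OF dlim[OF that(1)]] h by simp
    ultimately show ?thesis
      by eventually_elim (simp add: h_def field_simps)
  qed
  have q0M: "0 \<le> (1 - (\<Sum>j\<in>{1..n}. q i j (N k i))) * M k" if "i \<in> {1..n}" for i k
    using q_sum[OF that NA[OF that, of k]] Mk[of k] by (intro mult_nonneg_nonneg) (auto intro: order_trans[rotated])
  have qd: "0 \<le> q i j (N k i) * d k j" if "i \<in> {1..n}" "j \<in> {1..n}" for i j k
    using q_nonneg[OF that NA[OF that(1)]] d0[OF that(2)] by simp
  have unb: False if "filterlim f at_top sequentially"
    "\<And>k. f k \<le> r i (N (s k) i) + d (s k) i" "i \<in> D" for f i
  proof -
    have "\<forall>\<^sub>F k in sequentially. r i (\<nu> i) + e i + 1 < f k"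
      using that(1) by (simp add: filterlim_at_top_dense)
    moreover have "\<forall>\<^sub>F k in sequentially. r i (N (s k) i) + d (s k) i < r i (\<nu> i) + e i + 1"
      by (rule R[OF that(3)]) simp
    ultimately have "\<forall>\<^sub>F k in sequentially. False"
      by eventually_elim (use that(2) in \<open>smt (verit, best)\<close>)
    then show False by simp
  qed
  have qD: "q i j (\<nu> i) = 0" if "i \<in> D" "j \<in> {1..n}" "j \<notin> D" for i j
  proof (rule ccontr)
    have i: "i \<in> {1..n}" using that DS by auto
    assume "q i j (\<nu> i) \<noteq> 0"
    then have "0 < q i j (\<nu> i)" using q_nonneg[OF i that(2) \<nu>A[OF i]] by simp
    from filterlim_tendsto_pos_mult_at_top[OF qlim[OF i that(2)] this dinf[OF that(2,3)]]
    show False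
    proof (rule unb[OF _ _ that(1)])
      fix k
      have "q i j (N (s k) i) * d (s k) j \<le> (\<Sum>j\<in>{1..n}. q i j (N (s k) i) * d (s k) j)"
        using that(2) qd[OF i] by (intro member_le_sum) auto
      then show "q i j (N (s k) i) * d (s k) j \<le> r i (N (s k) i) + d (s k) i"
        using key[OF i, of "s k"] q0M[OF i, of "s k"] by linarith
    qed
  qed
  have q1: "(\<Sum>j\<in>{1..n}. q i j (\<nu> i)) = 1" if "i \<in> D" for i
  proof (rule ccontr)
    have i: "i \<in> {1..n}" using that DS by auto
    assume "(\<Sum>j\<in>{1..n}. q i j (\<nu> i)) \<noteq> 1"
    then have pos: "0 < 1 - (\<Sum>j\<in>{1..n}. q i j (\<nu> i))" using q_sum[OF i \<nu>A[OF i]] by simp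
    have lim: "(\<lambda>k. 1 - (\<Sum>j\<in>{1..n}. q i j (N (s k) i))) \<longlonglongrightarrow> 1 - (\<Sum>j\<in>{1..n}. q i j (\<nu> i))"
      by (intro tendsto_intros qlim[OF i])
    from filterlim_tendsto_pos_mult_at_top[OF lim pos Mlim] show False
    proof (rule unb[OF _ _ that])
      fix k
      have "0 \<le> (\<Sum>j\<in>{1..n}. q i j (N (s k) i) * d (s k) j)"
        using qd[OF i] by (intro sum_nonneg) auto
      then show "(1 - (\<Sum>j\<in>{1..n}. q i j (N (s k) i))) * M (s k) \<le> r i (N (s k) i) + d (s k) i"
        using key[OF i, of "s k"] by linarith
    qed
  qed
  \<comment> \<open>In the limit \<open>- e\<close> becomes a subsolution of \<open>\<nu>\<close> on
    \<open>D\<close>; the terms of \<open>key\<close> that are dropped here are nonnegative.\<close>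
  have wD: "(\<Sum>j\<in>D. q i j (\<nu> i) * e j) \<le> r i (\<nu> i) + e i" if "i \<in> D" for i
  proof (rule field_le_epsilon)
    have i: "i \<in> {1..n}" using that DS by auto
    fix b :: real assume "0 < b"
    then have "\<forall>\<^sub>F k in sequentially. r i (N (s k) i) + d (s k) i < r i (\<nu> i) + e i + b"
      by (intro R that) simp
    then have "\<forall>\<^sub>F k in sequentially. (\<Sum>j\<in>D. q i j (N (s k) i) * d (s k) j) \<le> r i (\<nu> i) + e i + b"
    proof eventually_elim
      case (elim k)
      have "(\<Sum>j\<in>D. q i j (N (s k) i) * d (s k) j) \<le> (\<Sum>j\<in>{1..n}. q i j (N (s k) i) * d (s k) j)"
        using DS qd[OF i] by (intro sum_mono2) auto
      then show ?case using elim key[OF i, of "s k"] q0M[OF i, of "s k"] by linarith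
    qed
    moreover have "(\<lambda>k. \<Sum>j\<in>D. q i j (N (s k) i) * d (s k) j) \<longlonglongrightarrow> (\<Sum>j\<in>D. q i j (\<nu> i) * e j)"
      using DS by (intro tendsto_intros qlim[OF i] dlim) auto
    ultimately show "(\<Sum>j\<in>D. q i j (\<nu> i) * e j) \<le> r i (\<nu> i) + e i + b"
      by (intro tendsto_upperbound[of _ _ sequentially]) auto
  qed
  \<comment> \<open>Lowering a subsolution by a nonnegative constant preserves it, since rows sum to
    at most 1. \<open>K\<close> is so large that the lowered \<open>y\<close> lies below
    \<open>- e\<close>; replacing it by \<open>- e\<close> on \<open>D\<close> then only helps the
    inequalities off \<open>D\<close>. Off \<open>D\<close> the number \<open>e i\<close> is 0, the
    value of \<open>real_of_ereal\<close> at infinity.\<close>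
  define K where "K = Max (insert 0 ((\<lambda>i. y i + e i) ` {1..n}))"
  have K0: "0 \<le> K" unfolding K_def by (intro Max_ge) auto
  have K: "y i - K \<le> - e i" if "i \<in> {1..n}" for i
  proof -
    have "y i + e i \<le> K" unfolding K_def using that by (intro Max_ge) auto
    then show ?thesis by simp
  qed
  define \<nu>' where "\<nu>' i = (if i \<in> D then \<nu> i else \<nu>0 i)" for i
  define w where "w i = (if i \<in> D then - e i else y i - K)" for i
  have \<nu>': "\<nu>' \<in> SD1 n A" using \<nu>A \<nu>0 by (auto simp: SD1_def \<nu>'_def)
  have "w i \<le> act \<nu>' w i" if i: "i \<in> {1..n}" for i
  proof (cases "i \<in> D")
    case True
    have "(\<Sum>j\<in>{1..n}. q i j (\<nu> i) * w j) = (\<Sum>j\<in>D. q i j (\<nu> i) * w j)"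
      using DS qD[OF True] by (intro sum.mono_neutral_right) auto
    also have "\<dots> = - (\<Sum>j\<in>D. q i j (\<nu> i) * e j)"
      by (simp add: w_def sum_negf)
    finally show ?thesis
      using wD[OF True] True by (simp add: act_look look_def \<nu>'_def w_def)
  next
    case False
    have \<nu>0i: "\<nu>0 i \<in> A i" using \<nu>0 i by (auto simp: SD1_def)
    have "(\<Sum>j\<in>{1..n}. q i j (\<nu>0 i)) * K \<le> 1 * K"
      using q_sum[OF i \<nu>0i] K0 by (intro mult_right_mono)
    then have "y i - K \<le> r i (\<nu>0 i) + (\<Sum>j\<in>{1..n}. q i j (\<nu>0 i) * (y j - K))"
      using y[OF i] by (simp add: act_look look_def right_diff_distrib sum_subtractf sum_distrib_right)
    also have "(\<Sum>j\<in>{1..n}. q i j (\<nu>0 i) * (y j - K)) \<le> (\<Sum>j\<in>{1..n}. q i j (\<nu>0 i) * w j)"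
      using q_nonneg[OF i _ \<nu>0i] K by (intro sum_mono mult_left_mono) (auto simp: w_def)
    finally show ?thesis using False by (simp add: act_look look_def \<nu>'_def w_def)
  qed
  then have tr: "transient n (Q \<nu>')" by (rule proper[OF \<nu>'])
  \<comment> \<open>At states of \<open>D\<close> the rows of \<open>Q \<nu>'\<close> have full mass
    inside \<open>D\<close>, so the chain started there never terminates.\<close>
  have one: "1 \<le> (lin n (Q \<nu>') ^^ t) (\<lambda>_. 1) i" if "i \<in> D" for i t
    using that
  proof (induction t arbitrary: i)
    case (Suc t)
    let ?p = "(lin n (Q \<nu>') ^^ t) (\<lambda>_. 1)"
    have i: "i \<in> {1..n}" using Suc DS by auto
    have "1 = (\<Sum>j\<in>{1..n}. q i j (\<nu> i))" using q1[OF Suc.prems] by simp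
    also have "\<dots> \<le> (\<Sum>j\<in>{1..n}. q i j (\<nu> i) * ?p j)"
    proof (rule sum_mono)
      fix j assume j: "j \<in> {1..n}"
      show "q i j (\<nu> i) \<le> q i j (\<nu> i) * ?p j"
      proof (cases "j \<in> D")
        case True
        then show ?thesis
          using mult_left_mono[OF Suc.IH[OF True] q_nonneg[OF i j \<nu>A[OF i]]] by simp
      qed (use qD[OF Suc.prems j] in simp)
    qed
    finally show ?case
      using Suc.prems by (simp add: lin_def[of n "Q \<nu>'" ?p i] Q_def[of \<nu>' i] \<nu>'_def[of i])
  qed simp
  obtain i where "i \<in> D" using Dne by blast
  then have "(\<lambda>t. (lin n (Q \<nu>') ^^ t) (\<lambda>_. 1) i) \<longlonglongrightarrow> 0"
    using tr DS unfolding transient_def by blast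
  then have "1 \<le> (0::real)"
    by (rule LIMSEQ_le_const) (use one[OF \<open>i \<in> D\<close>] in auto)
  then show False by simp
qed

text \<open>Value iteration from \<open>y\<close> increases, and each iterate is again a
  subsolution, so the one bound \<open>B\<close> covers all of them.\<close>

lemma fixed_point_exists:
  assumes \<nu>0: "\<nu>0 \<in> SD1 n A" and y: "\<And>i. i \<in> {1..n} \<Longrightarrow> y i \<le> act \<nu>0 y i"
  shows "\<exists>x. \<forall>i\<in>{1..n}. bell x i = x i"
proof -
  obtain B where B: "\<And>x i. (\<And>i. i \<in> {1..n} \<Longrightarrow> x i \<le> bell x i) \<Longrightarrow> i \<in> {1..n} \<Longrightarrow> x i \<le> B"
    using subsolutions_bounded[OF assms] by blast
  have sub: "y i \<le> bell y i" if "i \<in> {1..n}" for i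
    using y[OF that] act_le_bell[OF \<nu>0 that, of y] by simp
  have "(bell ^^ t) y i \<le> B" if "i \<in> {1..n}" for t i
    by (rule B[OF _ that]) (use mono_sub_funpow_sub[OF mono_sub_bell sub] in simp)
  then obtain x where "\<And>i. i \<in> {1..n} \<Longrightarrow> bell x i = x i"
    using mono_sub_increasing[OF mono_sub_bell sub, of "\<lambda>_. B"] by metis
  then show ?thesis by blast
qed

end

section \<open>The controlled process\<close>

text \<open>Since \<open>ennreal\<close> truncates at 0, this is sublinearity of the positive part;
  it plays the part of Jensen's inequality below.\<close>

lemma sum_ennreal_mult_ge:
  assumes "finite I" "\<And>i. i \<in> I \<Longrightarrow> 0 \<le> w i"
  shows "ennreal (\<Sum>i\<in>I. w i * a i) \<le> (\<Sum>i\<in>I. ennreal (w i) * ennreal (a i))"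
proof -
  have "ennreal (\<Sum>i\<in>I. w i * a i) \<le> ennreal (\<Sum>i\<in>I. w i * max 0 (a i))"
    using assms by (intro ennreal_leI sum_mono mult_left_mono) auto
  also have "\<dots> = (\<Sum>i\<in>I. ennreal (w i) * ennreal (a i))"
  proof -
    have "ennreal (w i * max 0 (a i)) = ennreal (w i) * ennreal (a i)" if "i \<in> I" for i
      using assms(2)[OF that] by (auto simp: ennreal_mult max_def ennreal_neg)
    moreover have "ennreal (\<Sum>i\<in>I. w i * max 0 (a i)) = (\<Sum>i\<in>I. ennreal (w i * max 0 (a i)))"
      using assms(2) by (intro sum_ennreal[symmetric]) auto
    ultimately show ?thesis by simp
  qed
  finally show ?thesis .
qed

section \<open>Extended-real expectations under one-sided bounds\<close>

lemma eexp_cong_AE: "AE x in M. f x = g x \<Longrightarrow> eexp M f = eexp M g"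
  unfolding eexp_def by (intro arg_cong2[where f = minus] arg_cong[where f = enn2ereal] nn_integral_cong_AE) auto

lemma eexp_uminus:
  assumes "eexp M (\<lambda>x. - f x) \<le> ereal (- L)" "(\<integral>\<^sup>+x. ennreal (- f x) \<partial>M) < \<infinity>"
  shows "ereal L \<le> eexp M f"
  using assms unfolding eexp_def
  by (cases "\<integral>\<^sup>+x. ennreal (f x) \<partial>M"; cases "\<integral>\<^sup>+x. ennreal (- f x) \<partial>M") (auto simp: enn2ereal_ennreal)

text \<open>The hypotheses for the various \<open>K\<close> concern expectations truncated at 0.
  Because \<open>f \<le> R\<close>, choosing \<open>K\<close> at least \<open>R\<close> makes the
  truncation inactive. If the negative part has infinite integral, the extended expectation is
  -\<infinity>.\<close>

lemma eexp_le:
  assumes M: "prob_space M" and f[measurable]: "f \<in> borel_measurable M" and R: "\<And>x. f x \<le> R"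
    and K: "\<And>K. ennreal (K - L) \<le> (\<integral>\<^sup>+x. ennreal (K - f x) \<partial>M)"
  shows "eexp M f \<le> ereal L \<and> (\<integral>\<^sup>+x. ennreal (f x) \<partial>M) < \<infinity>"
proof -
  interpret prob_space M by fact
  have "(\<integral>\<^sup>+x. ennreal (f x) \<partial>M) \<le> (\<integral>\<^sup>+x. ennreal R \<partial>M)"
    using R by (intro nn_integral_mono ennreal_leI)
  also have "\<dots> = ennreal R" by (simp add: emeasure_space_1)
  finally have fin: "(\<integral>\<^sup>+x. ennreal (f x) \<partial>M) < \<infinity>"
    using le_less_trans by fastforce
  have "eexp M f \<le> ereal L"
  proof (cases "(\<integral>\<^sup>+x. ennreal (- f x) \<partial>M) < \<infinity>")
    case False
    then have "(\<integral>\<^sup>+x. ennreal (- f x) \<partial>M) = \<infinity>" by (simp add: less_top[symmetric])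
    then show ?thesis using fin unfolding eexp_def
      by (cases "\<integral>\<^sup>+x. ennreal (f x) \<partial>M") auto
  next
    case True
    have int: "integrable M f"
      unfolding real_integrable_def using fin True by auto
    have "eexp M f = ereal (\<integral>x. f x \<partial>M)"
      unfolding eexp_def real_lebesgue_integral_def[OF int] using fin True
      by (cases "\<integral>\<^sup>+x. ennreal (f x) \<partial>M"; cases "\<integral>\<^sup>+x. ennreal (- f x) \<partial>M") (auto simp: enn2ereal_ennreal)
    moreover have "(\<integral>x. f x \<partial>M) \<le> L"
    proof -
      define b where "b = max R L"
      have "ennreal (b - L) \<le> (\<integral>\<^sup>+x. ennreal (b - f x) \<partial>M)" by (rule K)
      also have "\<dots> = ennreal (\<integral>x. b - f x \<partial>M)"
      proof (rule nn_integral_eq_integral)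
        show "integrable M (\<lambda>x. b - f x)" using int by simp
        have "0 \<le> b - f x" for x using R[of x] by (simp add: b_def)
        then show "AE x in M. 0 \<le> b - f x" by simp
      qed
      also have "(\<integral>x. b - f x \<partial>M) = b - (\<integral>x. f x \<partial>M)"
        using int by (simp add: prob_space)
      finally have *: "ennreal (b - L) \<le> ennreal (b - (\<integral>x. f x \<partial>M))" .
      have "(\<integral>x. f x \<partial>M) \<le> (\<integral>x. R \<partial>M)" using int R by (intro integral_mono) auto
      then have "(\<integral>x. f x \<partial>M) \<le> b" by (simp add: prob_space b_def)
      then show ?thesis using * by (simp add: ennreal_le_iff)
    qed
    ultimately show ?thesis by simp
  qed
  then show ?thesis using fin by simp
qed

lemma measurable_HM_update:
  assumes [measurable]: "f \<in> M \<rightarrow>\<^sub>M HM k"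
    "g \<in> M \<rightarrow>\<^sub>M count_space UNIV \<Otimes>\<^sub>M borel \<Otimes>\<^sub>M borel"
  shows "(\<lambda>x. (f x)(k := g x)) \<in> M \<rightarrow>\<^sub>M HM (Suc k)"
proof -
  have "(\<lambda>x. (f x, g x)) \<in> M \<rightarrow>\<^sub>M HM k \<Otimes>\<^sub>M (count_space UNIV \<Otimes>\<^sub>M borel \<Otimes>\<^sub>M borel)"
    by measurable
  then have "(\<lambda>x. (\<lambda>(f, y). f(k := y)) (f x, g x)) \<in> M \<rightarrow>\<^sub>M HM (Suc k)"
    unfolding HM_def lessThan_Suc by (rule measurable_compose) (rule measurable_add_dim)
  then show ?thesis by simp
qed

text \<open>\<open>A\<close> and \<open>B\<close> are carriers of the two policies: singletons for a
  stationary policy, the full control sets for an arbitrary one. The cost estimates below require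
  their inequalities only on these carriers.\<close>

locale game_process =
  fixes n :: nat
    and U :: "nat \<Rightarrow> 'u::polish_space set"
    and V :: "nat \<Rightarrow> 'v::polish_space set"
    and p :: "nat \<Rightarrow> nat \<Rightarrow> 'u \<Rightarrow> 'v \<Rightarrow> real"
    and \<pi>1 :: "nat \<Rightarrow> (nat \<Rightarrow> nat \<times> 'u \<times> 'v) \<Rightarrow> nat \<Rightarrow> 'u measure"
    and \<pi>2 :: "nat \<Rightarrow> (nat \<Rightarrow> nat \<times> 'u \<times> 'v) \<Rightarrow> nat \<Rightarrow> 'v measure"
    and A :: "nat \<Rightarrow> 'u set" and B :: "nat \<Rightarrow> 'v set"
  assumes U_compact: "\<And>i. i \<in> {1..n} \<Longrightarrow> compact (U i)"
    and V_compact: "\<And>i. i \<in> {1..n} \<Longrightarrow> compact (V i)"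
    and p_nonneg: "\<And>i j u v. i \<in> {1..n} \<Longrightarrow> u \<in> U i \<Longrightarrow> v \<in> V i \<Longrightarrow> j \<in> {0..n} \<Longrightarrow> 0 \<le> p i j u v"
    and p_sum: "\<And>i u v. i \<in> {1..n} \<Longrightarrow> u \<in> U i \<Longrightarrow> v \<in> V i \<Longrightarrow> (\<Sum>j\<in>{0..n}. p i j u v) = 1"
    and p_cont: "\<And>i j. i \<in> {1..n} \<Longrightarrow> j \<in> {1..n} \<Longrightarrow> continuous_on (U i \<times> V i) (\<lambda>(u, v). p i j u v)"
    and \<pi>1: "\<pi>1 \<in> Pol1 n U" and \<pi>2: "\<pi>2 \<in> Pol2 n V"
    and A_sets: "\<And>i. i \<in> {1..n} \<Longrightarrow> A i \<in> sets borel" and A_sub: "\<And>i. i \<in> {1..n} \<Longrightarrow> A i \<subseteq> U i"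
    and B_sets: "\<And>i. i \<in> {1..n} \<Longrightarrow> B i \<in> sets borel" and B_sub: "\<And>i. i \<in> {1..n} \<Longrightarrow> B i \<subseteq> V i"
    and \<pi>1_A: "\<And>k h i. i \<in> {1..n} \<Longrightarrow> emeasure (\<pi>1 k h i) (A i) = 1"
    and \<pi>2_B: "\<And>k h i. i \<in> {1..n} \<Longrightarrow> emeasure (\<pi>2 k h i) (B i) = 1"
begin

section \<open>The one-step transition kernel\<close>

definition w :: "nat \<Rightarrow> nat \<Rightarrow> 'u \<times> 'v \<Rightarrow> real" where
  "w i j x = (if fst x \<in> U i \<and> snd x \<in> V i then p i j (fst x) (snd x) else 0)"

lemma w_nonneg: "i \<in> {1..n} \<Longrightarrow> j \<in> {0..n} \<Longrightarrow> 0 \<le> w i j x"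
  by (auto simp: w_def p_nonneg)

lemma w_sum: "i \<in> {1..n} \<Longrightarrow> fst x \<in> U i \<Longrightarrow> snd x \<in> V i \<Longrightarrow> (\<Sum>j\<in>{0..n}. w i j x) = 1"
  using p_sum by (simp add: w_def)

lemma w_sum_le: "i \<in> {1..n} \<Longrightarrow> (\<Sum>j\<in>{0..n}. w i j x) \<le> 1"
  using w_sum[of i x] by (cases "fst x \<in> U i \<and> snd x \<in> V i") (auto simp: w_def)

text \<open>Continuity is assumed for targets in \<open>S\<close> only; the probability of
  termination is recovered as the complement of the others.\<close>

lemma w_measurable:
  assumes i: "i \<in> {1..n}" and j: "j \<in> {0..n}"
  shows "w i j \<in> borel_measurable (borel \<Otimes>\<^sub>M borel)"
proof -
  have UV: "U i \<times> V i \<in> sets borel"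
    by (intro borel_closed closed_Times compact_imp_closed U_compact V_compact i)
  have pos: "w i j \<in> borel_measurable (borel \<Otimes>\<^sub>M borel)" if "j \<in> {1..n}" for j
  proof -
    have "(\<lambda>x. if x \<in> U i \<times> V i then (\<lambda>(u, v). p i j u v) x else 0) \<in> borel_measurable borel"
      using borel_measurable_continuous_on_indicator[OF UV p_cont[OF i that]]
      by (rule measurable_cong[THEN iffD1, rotated]) (auto simp: indicator_def)
    then show ?thesis
      unfolding borel_prod by (rule measurable_cong[THEN iffD1, rotated]) (auto simp: w_def)
  qed
  show ?thesis
  proof (cases "j = 0")
    case True
    have "w i 0 = (\<lambda>x. indicator (U i \<times> V i) x - (\<Sum>j\<in>{1..n}. w i j x))"
    proof
      fix x
      have "{0..n} = insert 0 {1..n}" by auto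
      then show "w i 0 x = indicator (U i \<times> V i) x - (\<Sum>j\<in>{1..n}. w i j x)"
        using w_sum[OF i, of x]
        by (cases "fst x \<in> U i \<and> snd x \<in> V i") (auto simp: w_def indicator_def mem_Times_iff)
    qed
    moreover have "(\<lambda>x. indicator (U i \<times> V i) x - (\<Sum>j\<in>{1..n}. w i j x)) \<in> borel_measurable (borel \<Otimes>\<^sub>M borel)"
      using UV pos unfolding borel_prod by (intro borel_measurable_diff borel_measurable_indicator borel_measurable_sum) auto
    ultimately show ?thesis using True by simp
  qed (use pos j in auto)
qed

definition jump :: "nat \<Rightarrow> (nat \<Rightarrow> nat \<times> 'u \<times> 'v) \<Rightarrow> nat \<Rightarrow> 'u \<times> 'v \<Rightarrow> ((nat \<Rightarrow> nat \<times> 'u \<times> 'v) \<times> nat) measure" where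
  "jump k h i x = distr (density (count_space {0..n}) (\<lambda>j. ennreal (w i j x))) (XM (Suc k)) (\<lambda>j. (h(k := (i, x)), j))"

lemma upd_space: "h \<in> space (HM k) \<Longrightarrow> (h(k := y), j) \<in> space (XM (Suc k))"
  by (auto simp: XM_def HM_def space_pair_measure space_PiM lessThan_Suc PiE_def Pi_def extensional_def)

lemma sets_jump[simp]: "sets (jump k h i x) = sets (XM (Suc k))"
  by (simp add: jump_def)

lemma nn_integral_jump:
  assumes "h \<in> space (HM k)" "F \<in> borel_measurable (XM (Suc k))"
  shows "(\<integral>\<^sup>+y. F y \<partial>jump k h i x) = (\<Sum>j\<in>{0..n}. ennreal (w i j x) * F (h(k := (i, x)), j))"
  unfolding jump_def using assms
  by (subst nn_integral_distr) (auto simp: upd_space nn_integral_density nn_integral_count_space_finite)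

lemma emeasure_jump:
  assumes "h \<in> space (HM k)" "E \<in> sets (XM (Suc k))"
  shows "emeasure (jump k h i x) E = (\<Sum>j\<in>{0..n}. ennreal (w i j x) * indicator E (h(k := (i, x)), j))"
  using nn_integral_jump[OF assms(1), of "indicator E" i x] assms(2) by (simp add: nn_integral_indicator)

lemma jump_measurable:
  assumes i: "i \<in> {1..n}"
  shows "(\<lambda>(h, x). jump k h i x) \<in> HM k \<Otimes>\<^sub>M (borel \<Otimes>\<^sub>M borel) \<rightarrow>\<^sub>M subprob_algebra (XM (Suc k))"
    (is "?K \<in> ?M \<rightarrow>\<^sub>M _")
proof (rule measurable_subprob_algebra)
  fix y assume "y \<in> space ?M"
  then have h: "fst y \<in> space (HM k)" by (auto simp: space_pair_measure)
  have "emeasure (jump k (fst y) i (snd y)) (space (XM (Suc k))) = (\<Sum>j\<in>{0..n}. ennreal (w i j (snd y)))"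
    using emeasure_jump[OF h sets.top, of i "snd y"] upd_space[OF h] by simp
  also have "\<dots> = ennreal (\<Sum>j\<in>{0..n}. w i j (snd y))" using w_nonneg[OF i] by (intro sum_ennreal) auto
  also have "\<dots> \<le> 1" using w_sum_le[OF i] by (simp add: ennreal_le_1)
  finally show "subprob_space (?K y)"
    using upd_space[OF h] sets_eq_imp_space_eq[OF sets_jump, of k "fst y" i "snd y"]
    by (auto intro!: subprob_spaceI simp: split_beta)
  show "sets (?K y) = sets (XM (Suc k))"
    by (simp add: split_beta)
next
  fix E :: "((nat \<Rightarrow> nat \<times> 'u \<times> 'v) \<times> nat) set" assume E[measurable]: "E \<in> sets (XM (Suc k))"
  have "(\<lambda>y. (\<Sum>j\<in>{0..n}. ennreal (w i j (snd y)) * indicator E ((fst y)(k := (i, snd y)), j))) \<in> borel_measurable ?M"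
  proof (rule borel_measurable_sum)
    fix j assume j: "j \<in> {0..n}"
    have [measurable]: "(\<lambda>y. ennreal (w i j (snd y))) \<in> borel_measurable ?M"
      using measurable_compose[OF measurable_snd w_measurable[OF i j], of "HM k"] by measurable
    have "(\<lambda>y. (fst y)(k := (i, snd y))) \<in> ?M \<rightarrow>\<^sub>M HM (Suc k)"
      by (intro measurable_HM_update) measurable
    then have "(\<lambda>y. ((fst y)(k := (i, snd y)), j)) \<in> ?M \<rightarrow>\<^sub>M XM (Suc k)"
      unfolding XM_def by measurable
    then have [measurable]: "(\<lambda>y. indicator E ((fst y)(k := (i, snd y)), j) :: ennreal) \<in> borel_measurable ?M"
      by (rule measurable_compose) measurable
    show "(\<lambda>y. ennreal (w i j (snd y)) * indicator E ((fst y)(k := (i, snd y)), j)) \<in> borel_measurable ?M"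
      by measurable
  qed
  then show "(\<lambda>y. emeasure (?K y) E) \<in> borel_measurable ?M"
    by (rule measurable_cong[THEN iffD1, rotated])
      (auto simp: emeasure_jump E split_beta space_pair_measure)
qed

definition P :: "nat \<Rightarrow> (nat \<Rightarrow> nat \<times> 'u \<times> 'v) \<Rightarrow> nat \<Rightarrow> ('u \<times> 'v) measure" where
  "P k h i = \<pi>1 k h i \<Otimes>\<^sub>M \<pi>2 k h i"

lemma step_S: "i \<in> {1..n} \<Longrightarrow> step n U V p \<pi>1 \<pi>2 k (h, i) = P k h i \<bind> jump k h i"
  by (simp add: step_def) (simp add: P_def jump_def[abs_def] w_def case_prod_beta')

lemma step_off: "i \<notin> {1..n} \<Longrightarrow>
    step n U V p \<pi>1 \<pi>2 k (h, i) = return (XM (Suc k)) (h(k := (i, undefined, undefined)), i)"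
  unfolding step_def by (simp only: prod.case if_False)

lemma P_measurable: "i \<in> {1..n} \<Longrightarrow> (\<lambda>h. P k h i) \<in> HM k \<rightarrow>\<^sub>M prob_algebra (borel \<Otimes>\<^sub>M borel)"
  using \<pi>1 \<pi>2 unfolding P_def Pol1_def Pol2_def by (intro measurable_pair_prob) auto

lemma P_in: "i \<in> {1..n} \<Longrightarrow> P k h i \<in> space (prob_algebra (borel \<Otimes>\<^sub>M borel))"
  using \<pi>1 \<pi>2 unfolding P_def Pol1_def Pol2_def
  by (auto simp: space_prob_algebra prob_space_pair intro!: sets_pair_measure_cong)

lemma P_AE:
  assumes i: "i \<in> {1..n}"
  shows "AE x in P k h i. fst x \<in> A i \<and> snd x \<in> B i"
proof -
  have 1: "prob_space (\<pi>1 k h i)" "sets (\<pi>1 k h i) = sets borel"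
    and 2: "prob_space (\<pi>2 k h i)" "sets (\<pi>2 k h i) = sets borel"
    using \<pi>1 \<pi>2 i unfolding Pol1_def Pol2_def by (auto simp: space_prob_algebra)
  interpret P: prob_space "P k h i" using P_in[OF i] by (simp add: space_prob_algebra)
  interpret p2: prob_space "\<pi>2 k h i" by fact
  have "emeasure (P k h i) (A i \<times> B i) = 1"
    unfolding P_def using A_sets[OF i] B_sets[OF i] 1 2 \<pi>1_A[OF i] \<pi>2_B[OF i]
    by (subst p2.emeasure_pair_measure_Times) auto
  then have "P.prob (A i \<times> B i) = 1" by (simp add: measure_def)
  from P.AE_prob_1[OF this] show ?thesis by eventually_elim auto
qed

lemma jump_measurable': "i \<in> {1..n} \<Longrightarrow> h \<in> space (HM k) \<Longrightarrow>
    jump k h i \<in> P k h i \<rightarrow>\<^sub>M subprob_algebra (XM (Suc k))"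
  using measurable_Pair2[OF jump_measurable, of i h k] P_in[of i k h]
  by (simp add: space_prob_algebra cong: measurable_cong_sets)

lemma nn_integral_step:
  assumes i: "i \<in> {1..n}" and h: "h \<in> space (HM k)" and F: "F \<in> borel_measurable (XM (Suc k))"
  shows "(\<integral>\<^sup>+y. F y \<partial>step n U V p \<pi>1 \<pi>2 k (h, i)) =
    (\<integral>\<^sup>+x. (\<Sum>j\<in>{0..n}. ennreal (w i j x) * F (h(k := (i, x)), j)) \<partial>P k h i)"
  unfolding step_S[OF i]
  by (simp add: nn_integral_bind[OF F jump_measurable'[OF i h]] nn_integral_jump[OF h F])

lemma nn_integral_step_off:
  assumes i: "i \<notin> {1..n}" and h: "h \<in> space (HM k)" and F: "F \<in> borel_measurable (XM (Suc k))"
  shows "(\<integral>\<^sup>+y. F y \<partial>step n U V p \<pi>1 \<pi>2 k (h, i)) = F (h(k := (i, undefined, undefined)), i)"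
  unfolding step_off[OF i] by (rule nn_integral_return[OF upd_space[OF h] F])

text \<open>The state is discrete, so measurability in the history for each fixed state
  suffices.\<close>

lemma step_subprob: "step n U V p \<pi>1 \<pi>2 k \<in> XM k \<rightarrow>\<^sub>M subprob_algebra (XM (Suc k))"
proof -
  have "(\<lambda>x. step n U V p \<pi>1 \<pi>2 k (fst x, i)) \<in> XM k \<rightarrow>\<^sub>M subprob_algebra (XM (Suc k))" for i
  proof (cases "i \<in> {1..n}")
    case True
    have "(\<lambda>h. P k h i \<bind> jump k h i) \<in> HM k \<rightarrow>\<^sub>M subprob_algebra (XM (Suc k))"
      by (rule measurable_bind'[OF measurable_prob_algebraD[OF P_measurable[OF True]] jump_measurable[OF True]])
    then show ?thesis
      unfolding step_S[OF True] XM_def[of k] by (rule measurable_compose[OF measurable_fst])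
  next
    case False
    have "(\<lambda>x. (fst x)(k := (i, undefined, undefined))) \<in> XM k \<rightarrow>\<^sub>M HM (Suc k)"
      by (intro measurable_HM_update) (auto simp: XM_def)
    then have "(\<lambda>x. ((fst x)(k := (i, undefined, undefined)), i)) \<in> XM k \<rightarrow>\<^sub>M XM (Suc k)"
      unfolding XM_def[of "Suc k"] by measurable
    then show ?thesis
      unfolding step_off[OF False] by (rule measurable_compose[OF _ return_measurable])
  qed
  then have "(\<lambda>x. step n U V p \<pi>1 \<pi>2 k (fst x, snd x)) \<in> XM k \<rightarrow>\<^sub>M subprob_algebra (XM (Suc k))"
    by (rule measurable_compose_countable) (simp add: XM_def)
  then show ?thesis by simp
qed

lemma step_prob: "step n U V p \<pi>1 \<pi>2 k \<in> XM k \<rightarrow>\<^sub>M prob_algebra (XM (Suc k))"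
proof (rule measurable_prob_algebraI[OF _ step_subprob])
  fix x :: "(nat \<Rightarrow> nat \<times> 'u \<times> 'v) \<times> nat" assume x: "x \<in> space (XM k)"
  obtain h i where hi: "x = (h, i)" by (cases x)
  have h: "h \<in> space (HM k)" using x hi by (simp add: XM_def space_pair_measure)
  have one: "(\<integral>\<^sup>+y. 1 \<partial>step n U V p \<pi>1 \<pi>2 k (h, i)) = 1"
  proof (cases "i \<in> {1..n}")
    case True
    interpret P: prob_space "P k h i" using P_in[OF True] by (simp add: space_prob_algebra)
    \<comment> \<open>Control pairs outside \<open>U i \<times> V i\<close> lead to the zero
      measure, so unit mass holds only for almost every pair.\<close>
    have "AE x in P k h i. (\<Sum>j\<in>{0..n}. ennreal (w i j x) * 1) = 1"
      using P_AE[OF True]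
    proof eventually_elim
      case (elim x)
      then have "(\<Sum>j\<in>{0..n}. w i j x) = 1" using w_sum[OF True] A_sub[OF True] B_sub[OF True] by blast
      then show ?case using sum_ennreal[of "{0..n}" "\<lambda>j. w i j x"] w_nonneg[OF True] by simp
    qed
    then have "(\<integral>\<^sup>+x. (\<Sum>j\<in>{0..n}. ennreal (w i j x) * 1) \<partial>P k h i) = (\<integral>\<^sup>+x. 1 \<partial>P k h i)"
      by (rule nn_integral_cong_AE)
    then show ?thesis
      using nn_integral_step[OF True h, of "\<lambda>_. 1"] by (simp add: P.emeasure_space_1)
  qed (use nn_integral_step_off[OF _ h, of i "\<lambda>_. 1"] in simp)
  then show "prob_space (step n U V p \<pi>1 \<pi>2 k x)"
    by (intro prob_spaceI) (simp add: hi)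
qed

section \<open>Path measures and bounds for expected costs\<close>

abbreviation paths_of :: "nat \<Rightarrow> nat \<Rightarrow> ((nat \<Rightarrow> nat \<times> 'u \<times> 'v) \<times> nat) measure" where
  "paths_of \<equiv> paths n U V p \<pi>1 \<pi>2"

lemma paths_in: "paths_of i0 t \<in> space (prob_algebra (XM t))"
proof (induction t)
  case 0
  have "(\<lambda>_. undefined, i0) \<in> space (XM 0)"
    by (auto simp: XM_def HM_def space_pair_measure space_PiM)
  then show ?case by (auto simp: space_prob_algebra intro: prob_space_return)
next
  case (Suc t)
  then show ?case
    using prob_space_bind'[OF Suc step_prob] sets_bind'[OF Suc step_prob] by (simp add: space_prob_algebra)
qed

lemma sets_paths: "sets (paths_of i0 t) = sets (XM t)" and prob_space_paths: "prob_space (paths_of i0 t)"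
  using paths_in by (auto simp: space_prob_algebra)

lemma space_paths: "space (paths_of i0 t) = space (XM t)"
  by (rule sets_eq_imp_space_eq[OF sets_paths])

lemma step_paths: "step n U V p \<pi>1 \<pi>2 t \<in> paths_of i0 t \<rightarrow>\<^sub>M subprob_algebra (XM (Suc t))"
  using step_subprob[of t] by (simp add: measurable_cong_sets[OF sets_paths])

lemma nn_integral_paths_Suc:
  assumes "F \<in> borel_measurable (XM (Suc t))"
  shows "(\<integral>\<^sup>+y. F y \<partial>paths_of i0 (Suc t)) = (\<integral>\<^sup>+x. (\<integral>\<^sup>+y. F y \<partial>step n U V p \<pi>1 \<pi>2 t x) \<partial>paths_of i0 t)"
  using nn_integral_bind[OF assms step_paths] by simp

lemma measurable_coord:
  assumes "k < t"
  shows "(\<lambda>x. fst x k) \<in> XM t \<rightarrow>\<^sub>M count_space UNIV \<Otimes>\<^sub>M borel \<Otimes>\<^sub>M borel"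
proof -
  have "(\<lambda>h. h k) \<in> HM t \<rightarrow>\<^sub>M count_space UNIV \<Otimes>\<^sub>M borel \<Otimes>\<^sub>M borel"
    unfolding HM_def using assms by (intro measurable_component_singleton) auto
  then show ?thesis unfolding XM_def by (rule measurable_compose[OF measurable_fst])
qed

text \<open>The process \<open>K - s\<^sub>0 - \<dots> - s\<^sub>t\<^sub>-\<^sub>1 - J\<^sub>T\<^sub>-\<^sub>t\<close> is a submartingale.  Its positive part still
  is one, so no integrability and no bound on \<open>K\<close> is needed when truncating at 0.\<close>

lemma dynamic_programming_bound:
  fixes s :: "nat \<times> 'u \<times> 'v \<Rightarrow> real" and J :: "nat \<Rightarrow> nat \<Rightarrow> real"
  assumes s: "s \<in> borel_measurable (count_space UNIV \<Otimes>\<^sub>M borel \<Otimes>\<^sub>M borel)"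
    and on: "\<And>t i u v. i \<in> {1..n} \<Longrightarrow> u \<in> A i \<Longrightarrow> v \<in> B i \<Longrightarrow>
      s (i, u, v) + (\<Sum>j\<in>{0..n}. p i j u v * J t j) \<le> J (Suc t) i"
    and off: "\<And>t i. i \<notin> {1..n} \<Longrightarrow> s (i, undefined, undefined) + J t i \<le> J (Suc t) i"
  shows "ennreal (K - J (t + m) i0) \<le>
    (\<integral>\<^sup>+x. ennreal (K - (\<Sum>k<t. s (fst x k)) - J m (snd x)) \<partial>paths_of i0 t)"
\<comment> \<open>Elapsed and remaining stages trade places: the induction hypothesis is applied
  with \<open>Suc m\<close> remaining stages.\<close>
proof (induction t arbitrary: m)
  case 0
  have "(\<lambda>_. undefined, i0) \<in> space (XM 0)"
    by (auto simp: XM_def HM_def space_pair_measure space_PiM)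
  moreover have "(\<lambda>x. ennreal (K - J m (snd x))) \<in> borel_measurable (XM 0)"
    unfolding XM_def by measurable
  ultimately show ?case by (subst paths.simps, subst nn_integral_return) simp_all
next
  case (Suc t)
  let ?F = "\<lambda>x. ennreal (K - (\<Sum>k<Suc t. s (fst x k)) - J m (snd x))"
  have F: "?F \<in> borel_measurable (XM (Suc t))"
  proof -
    have "(\<lambda>x. \<Sum>k<Suc t. s (fst x k)) \<in> borel_measurable (XM (Suc t))"
      using measurable_compose[OF measurable_coord s] by (intro borel_measurable_sum) auto
    moreover have "(\<lambda>x. J m (snd x)) \<in> borel_measurable (XM (Suc t))"
      unfolding XM_def by measurable
    ultimately show ?thesis by measurable
  qed
  have "ennreal (K - J (t + Suc m) i0) \<le>
      (\<integral>\<^sup>+x. ennreal (K - (\<Sum>k<t. s (fst x k)) - J (Suc m) (snd x)) \<partial>paths_of i0 t)"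
    by (rule Suc)
  also have "\<dots> \<le> (\<integral>\<^sup>+x. (\<integral>\<^sup>+y. ?F y \<partial>step n U V p \<pi>1 \<pi>2 t x) \<partial>paths_of i0 t)"
  proof (rule nn_integral_mono)
    fix x assume "x \<in> space (paths_of i0 t)"
    then obtain h i where x: "x = (h, i)" and h: "h \<in> space (HM t)"
      by (cases x) (auto simp: space_paths XM_def space_pair_measure)
    define C where "C = K - (\<Sum>k<t. s (h k))"
    have upd: "?F (h(t := y), j) = ennreal (C - s y - J m j)" for y j
    proof -
      have "(\<Sum>k<t. s ((h(t := y)) k)) = (\<Sum>k<t. s (h k))" by (intro sum.cong) auto
      then show ?thesis by (simp add: C_def algebra_simps)
    qed
    have "ennreal (C - J (Suc m) i) \<le> (\<integral>\<^sup>+y. ?F y \<partial>step n U V p \<pi>1 \<pi>2 t (h, i))"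
    proof (cases "i \<in> {1..n}")
      case True
      interpret P: prob_space "P t h i" using P_in[OF True] by (simp add: space_prob_algebra)
      have "ennreal (C - J (Suc m) i) = (\<integral>\<^sup>+x. ennreal (C - J (Suc m) i) \<partial>P t h i)"
        by (simp add: P.emeasure_space_1)
      also have "\<dots> \<le> (\<integral>\<^sup>+x. (\<Sum>j\<in>{0..n}. ennreal (w i j x) * ?F (h(t := (i, x)), j)) \<partial>P t h i)"
      proof (rule nn_integral_mono_AE)
        show "AE x in P t h i. ennreal (C - J (Suc m) i)
            \<le> (\<Sum>j\<in>{0..n}. ennreal (w i j x) * ?F (h(t := (i, x)), j))"
          using P_AE[OF True]
        proof eventually_elim
          case (elim x)
          obtain u v where uv: "x = (u, v)" by (cases x)
          have mem: "u \<in> A i" "v \<in> B i" "u \<in> U i" "v \<in> V i"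
            using elim A_sub[OF True] B_sub[OF True] by (auto simp: uv)
          have "(\<Sum>j\<in>{0..n}. w i j x * (C - s (i, x) - J m j))
              = (\<Sum>j\<in>{0..n}. w i j x) * (C - s (i, x)) - (\<Sum>j\<in>{0..n}. w i j x * J m j)"
            by (simp add: right_diff_distrib sum_subtractf sum_distrib_right)
          also have "\<dots> = C - (s (i, u, v) + (\<Sum>j\<in>{0..n}. p i j u v * J m j))"
            using w_sum[OF True, of x] mem by (simp add: uv w_def)
          also have "\<dots> \<ge> C - J (Suc m) i" using on[OF True mem(1,2), of m] by simp
          finally have "ennreal (C - J (Suc m) i) \<le> ennreal (\<Sum>j\<in>{0..n}. w i j x * (C - s (i, x) - J m j))"
            by (rule ennreal_leI)
          \<comment> \<open>Truncation at 0 may be moved inside the average over successor states,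
            as the positive part is convex.\<close>
          also have "\<dots> \<le> (\<Sum>j\<in>{0..n}. ennreal (w i j x) * ennreal (C - s (i, x) - J m j))"
            by (intro sum_ennreal_mult_ge w_nonneg True) auto
          finally show ?case unfolding upd .
        qed
      qed
      also have "\<dots> = (\<integral>\<^sup>+y. ?F y \<partial>step n U V p \<pi>1 \<pi>2 t (h, i))"
        by (rule nn_integral_step[OF True h F, symmetric])
      finally show ?thesis .
    next
      case False
      show ?thesis
        unfolding nn_integral_step_off[OF False h F] upd using off[OF False, of m]
        by (intro ennreal_leI) simp
    qed
    then show "ennreal (K - (\<Sum>k<t. s (fst x k)) - J (Suc m) (snd x)) \<le>
        (\<integral>\<^sup>+y. ?F y \<partial>step n U V p \<pi>1 \<pi>2 t x)"
      by (simp add: x C_def)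
  qed
  also have "\<dots> = (\<integral>\<^sup>+y. ?F y \<partial>paths_of i0 (Suc t))"
    by (rule nn_integral_paths_Suc[OF F, symmetric])
  finally show ?case by simp
qed

text \<open>Vacuous outside \<open>S\<close>, where the recorded controls are
  \<open>undefined\<close>.\<close>

definition good :: "(nat \<times> 'u \<times> 'v) \<Rightarrow> bool" where
  "good y \<longleftrightarrow> (fst y \<in> {1..n} \<longrightarrow> fst (snd y) \<in> A (fst y) \<and> snd (snd y) \<in> B (fst y))"

lemma good_measurable: "Measurable.pred (count_space UNIV \<Otimes>\<^sub>M borel \<Otimes>\<^sub>M borel) good"
proof -
  have "(\<lambda>y :: nat \<times> 'u \<times> 'v. i \<in> {1..n} \<longrightarrow> fst (snd y) \<in> A i \<and> snd (snd y) \<in> B i) \<in>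
      count_space UNIV \<Otimes>\<^sub>M borel \<Otimes>\<^sub>M borel \<rightarrow>\<^sub>M count_space UNIV" for i :: nat
  proof (cases "i \<in> {1..n}")
    case True
    note [measurable] = A_sets[OF True] B_sets[OF True]
    have "Measurable.pred (count_space UNIV \<Otimes>\<^sub>M borel \<Otimes>\<^sub>M borel)
        (\<lambda>y :: nat \<times> 'u \<times> 'v. fst (snd y) \<in> A i \<and> snd (snd y) \<in> B i)"
      by measurable
    then show ?thesis by (simp only: True simp_thms)
  next
    case False
    then show ?thesis by (simp only: simp_thms) measurable
  qed
  then show ?thesis
    unfolding good_def[abs_def] by (rule measurable_compose_countable[where g = fst]) simp
qed

text \<open>This allows the stage cost to be altered off the carriers without changing any
  expectation.\<close>

lemma AE_good: "AE x in paths_of i0 t. \<forall>k<t. good (fst x k)"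
proof (induction t)
  case (Suc t)
  have pred: "Measurable.pred (XM (Suc t)) (\<lambda>x. \<forall>k<Suc t. good (fst x k))"
  proof -
    have "Measurable.pred (XM (Suc t)) (\<lambda>x. \<forall>k\<in>{..<Suc t}. good (fst x k))"
      using measurable_compose[OF measurable_coord good_measurable]
      by (intro pred_intros_finite) auto
    then show ?thesis by (simp only: Ball_def lessThan_iff)
  qed
  have "AE x in paths_of i0 t. AE y in step n U V p \<pi>1 \<pi>2 t x. \<forall>k<Suc t. good (fst y k)"
    using Suc AE_space
  proof eventually_elim
    case (elim x)
    then obtain h i where x: "x = (h, i)" and h: "h \<in> space (HM t)"
      by (cases x) (auto simp: space_paths XM_def space_pair_measure)
    have upd: "(\<forall>k<Suc t. good ((h(t := y)) k)) \<longleftrightarrow> good y" for y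
      using elim(1) by (auto simp: x less_Suc_eq)
    let ?E = "{y \<in> space (XM (Suc t)). \<not> (\<forall>k<Suc t. good (fst y k))}"
    have Es: "?E \<in> sets (XM (Suc t))"
      by (rule sets.sets_Collect_neg) (rule pred[unfolded pred_def])
    then have E: "(indicator ?E :: _ \<Rightarrow> ennreal) \<in> borel_measurable (XM (Suc t))"
      by (rule borel_measurable_indicator)
    have ind: "indicator ?E (h(t := y), j) = (0::ennreal)" if "good y" for y j
    proof (rule indicator_simps(2))
      show "(h(t := y), j) \<notin> ?E" using that upd[of y] unfolding mem_Collect_eq fst_conv by blast
    qed
    have "(\<integral>\<^sup>+y. indicator ?E y \<partial>step n U V p \<pi>1 \<pi>2 t (h, i)) = 0"
    proof (cases "i \<in> {1..n}")
      case True
      have "AE x in P t h i. (\<Sum>j\<in>{0..n}. ennreal (w i j x) * indicator ?E (h(t := (i, x)), j)) = 0"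
        using P_AE[OF True]
      proof eventually_elim
        case (elim x)
        then have "good (i, x)" by (simp add: good_def)
        then show ?case by (simp only: ind mult_zero_right sum.neutral_const)
      qed
      then show ?thesis
        unfolding nn_integral_step[OF True h E] by (subst nn_integral_cong_AE[where v = "\<lambda>_. 0"]) auto
    next
      case False
      then show ?thesis
        unfolding nn_integral_step_off[OF False h E] by (intro ind) (simp only: good_def fst_conv simp_thms)
    qed
    moreover have S: "sets (step n U V p \<pi>1 \<pi>2 t (h, i)) = sets (XM (Suc t))"
      using measurable_space[OF step_prob, of x] elim(2) by (simp add: x space_paths space_prob_algebra)
    ultimately have "?E \<in> null_sets (step n U V p \<pi>1 \<pi>2 t (h, i))"
      using Es by (simp only: null_sets_def mem_Collect_eq nn_integral_indicator S simp_thms)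
    then have "AE y in step n U V p \<pi>1 \<pi>2 t (h, i). y \<notin> ?E"
      by (rule AE_not_in)
    then show ?case
      using AE_space unfolding x
      by eventually_elim (use sets_eq_imp_space_eq[OF S] in blast)
  qed
  then show ?case
    unfolding paths.simps(2) AE_bind[OF step_paths pred] .
qed simp

text \<open>Only the values of the cost on the supports \<open>A i \<times> B i\<close> of the policies are assumed
  measurable: the cost itself is separately semicontinuous on \<open>U i \<times> V i\<close> and arbitrary
  elsewhere.\<close>

lemma expected_cost_le:
  fixes c :: "nat \<Rightarrow> 'u \<Rightarrow> 'v \<Rightarrow> real" and J :: "nat \<Rightarrow> nat \<Rightarrow> real"
  assumes c: "\<And>i. i \<in> {1..n} \<Longrightarrow>
      (\<lambda>x. if fst x \<in> A i \<and> snd x \<in> B i then c i (fst x) (snd x) else 0) \<in> borel_measurable (borel \<Otimes>\<^sub>M borel)"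
    and R: "\<And>i u v. i \<in> {1..n} \<Longrightarrow> u \<in> A i \<Longrightarrow> v \<in> B i \<Longrightarrow> c i u v \<le> R"
    and J0: "\<And>i. J 0 i = 0" and off: "\<And>t i. i \<notin> {1..n} \<Longrightarrow> J t i = 0"
    and on: "\<And>t i u v. i \<in> {1..n} \<Longrightarrow> u \<in> A i \<Longrightarrow> v \<in> B i \<Longrightarrow>
      c i u v + (\<Sum>j\<in>{1..n}. p i j u v * J t j) \<le> J (Suc t) i"
  shows "eexp (paths_of i0 (Suc t)) (\<lambda>(h, j). \<Sum>k\<le>t. stage_cost n c (h k)) \<le> ereal (J (Suc t) i0) \<and>
    (\<integral>\<^sup>+x. ennreal ((\<lambda>(h, j). \<Sum>k\<le>t. stage_cost n c (h k)) x) \<partial>paths_of i0 (Suc t)) < \<infinity>"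
proof -
  \<comment> \<open>A version of the stage cost that is measurable and bounded above everywhere and
    agrees with \<open>stage_cost\<close> along almost every path. Its value 0 off the carriers is
    why the bound used below is \<open>max 0 R\<close>.\<close>
  define s where "s y = (if fst y \<in> {1..n} then
      if fst (snd y) \<in> A (fst y) \<and> snd (snd y) \<in> B (fst y) then c (fst y) (fst (snd y)) (snd (snd y)) else 0
      else 0)" for y
  have s: "s \<in> borel_measurable (count_space UNIV \<Otimes>\<^sub>M borel \<Otimes>\<^sub>M borel)"
  proof -
    have "(\<lambda>y :: nat \<times> 'u \<times> 'v. if i \<in> {1..n} then
        if fst (snd y) \<in> A i \<and> snd (snd y) \<in> B i then c i (fst (snd y)) (snd (snd y)) else 0
        else 0) \<in> borel_measurable (count_space UNIV \<Otimes>\<^sub>M borel \<Otimes>\<^sub>M borel)" for i :: nat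
      using measurable_compose[OF measurable_snd c[of i]] by (cases "i \<in> {1..n}") auto
    then show ?thesis
      unfolding s_def[abs_def] by (rule measurable_compose_countable[where g = fst]) simp
  qed
  have sum0: "(\<Sum>j\<in>{0..n}. g j * J t j) = (\<Sum>j\<in>{1..n}. g j * J t j)" for g t
    using off[of 0 t] by (intro sum.mono_neutral_right) (auto simp: Suc_le_eq)
  let ?f = "\<lambda>x. \<Sum>k<Suc t. s (fst x k)"
  have bound: "ennreal (K - J (Suc t) i0) \<le> (\<integral>\<^sup>+x. ennreal (K - ?f x) \<partial>paths_of i0 (Suc t))" for K
  proof -
    have "s (i, u, v) + (\<Sum>j\<in>{0..n}. p i j u v * J t j) \<le> J (Suc t) i"
      if "i \<in> {1..n}" "u \<in> A i" "v \<in> B i" for t i u v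
      using on[OF that, of t] that unfolding sum0 by (simp add: s_def)
    moreover have "s (i, undefined, undefined) + J t i \<le> J (Suc t) i" if "i \<notin> {1..n}" for t i
      unfolding off[OF that] s_def using that by (simp only: fst_conv if_False)
    ultimately show ?thesis
      using dynamic_programming_bound[OF s, of J K "Suc t" 0 i0]
      by (simp add: J0 del: paths.simps sum.lessThan_Suc)
  qed
  have "?f x \<le> (\<Sum>k<Suc t. max 0 R)" for x
    by (intro sum_mono) (auto simp: s_def R max.coboundedI2)
  moreover have "?f \<in> borel_measurable (paths_of i0 (Suc t))"
    using measurable_compose[OF measurable_coord s] unfolding measurable_cong_sets[OF sets_paths refl]
    by (intro borel_measurable_sum) auto
  ultimately have "eexp (paths_of i0 (Suc t)) ?f \<le> ereal (J (Suc t) i0) \<and>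
      (\<integral>\<^sup>+x. ennreal (?f x) \<partial>paths_of i0 (Suc t)) < \<infinity>"
    by (intro eexp_le[OF prob_space_paths _ _ bound])
  moreover have AE: "AE x in paths_of i0 (Suc t). ?f x = (\<lambda>(h, j). \<Sum>k\<le>t. stage_cost n c (h k)) x"
    using AE_good
  proof eventually_elim
    case (elim x)
    have "s (fst x k) = stage_cost n c (fst x k)" if "k < Suc t" for k
      using elim that by (auto simp: good_def s_def stage_cost_def split: prod.splits)
    then show ?case by (auto simp: split_beta lessThan_Suc_atMost intro!: sum.cong)
  qed
  moreover have "(\<integral>\<^sup>+x. ennreal (?f x) \<partial>paths_of i0 (Suc t)) =
      (\<integral>\<^sup>+x. ennreal ((\<lambda>(h, j). \<Sum>k\<le>t. stage_cost n c (h k)) x) \<partial>paths_of i0 (Suc t))"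
    by (rule nn_integral_cong_AE) (use AE in eventually_elim, simp)
  ultimately show ?thesis using eexp_cong_AE[OF AE] by simp
qed

text \<open>The upper estimate for \<open>- c\<close> and \<open>- J\<close>; its finiteness clause
  is what lets the sign be moved out of \<open>eexp\<close>.\<close>

lemma expected_cost_ge:
  fixes c :: "nat \<Rightarrow> 'u \<Rightarrow> 'v \<Rightarrow> real" and J :: "nat \<Rightarrow> nat \<Rightarrow> real"
  assumes c: "\<And>i. i \<in> {1..n} \<Longrightarrow>
      (\<lambda>x. if fst x \<in> A i \<and> snd x \<in> B i then c i (fst x) (snd x) else 0) \<in> borel_measurable (borel \<Otimes>\<^sub>M borel)"
    and R: "\<And>i u v. i \<in> {1..n} \<Longrightarrow> u \<in> A i \<Longrightarrow> v \<in> B i \<Longrightarrow> R \<le> c i u v"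
    and J0: "\<And>i. J 0 i = 0" and off: "\<And>t i. i \<notin> {1..n} \<Longrightarrow> J t i = 0"
    and on: "\<And>t i u v. i \<in> {1..n} \<Longrightarrow> u \<in> A i \<Longrightarrow> v \<in> B i \<Longrightarrow>
      J (Suc t) i \<le> c i u v + (\<Sum>j\<in>{1..n}. p i j u v * J t j)"
  shows "ereal (J (Suc t) i0) \<le> eexp (paths_of i0 (Suc t)) (\<lambda>(h, j). \<Sum>k\<le>t. stage_cost n c (h k))"
proof (rule eexp_uminus)
  have neg: "(\<lambda>(h, j). \<Sum>k\<le>t. stage_cost n (\<lambda>i u v. - c i u v) (h k)) =
      (\<lambda>x. - (\<lambda>(h, j). \<Sum>k\<le>t. stage_cost n c (h k)) x)"
    by (auto simp: fun_eq_iff stage_cost_def sum_negf[symmetric] intro!: sum.cong split: prod.splits)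
  have m: "(\<lambda>x. if fst x \<in> A i \<and> snd x \<in> B i then - c i (fst x) (snd x) else 0)
      \<in> borel_measurable (borel \<Otimes>\<^sub>M borel)" if "i \<in> {1..n}" for i
    using borel_measurable_uminus[OF c[OF that]]
    by (rule measurable_cong[THEN iffD1, rotated]) auto
  have "eexp (paths_of i0 (Suc t)) (\<lambda>(h, j). \<Sum>k\<le>t. stage_cost n (\<lambda>i u v. - c i u v) (h k)) \<le> ereal (- J (Suc t) i0) \<and>
    (\<integral>\<^sup>+x. ennreal ((\<lambda>(h, j). \<Sum>k\<le>t. stage_cost n (\<lambda>i u v. - c i u v) (h k)) x) \<partial>paths_of i0 (Suc t)) < \<infinity>"
  proof (rule expected_cost_le[where R = "- R"])
    fix t i u v assume "i \<in> {1..n}" "u \<in> A i" "v \<in> B i"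
    from on[OF this, of t] show "- c i u v + (\<Sum>j\<in>{1..n}. p i j u v * - J t j) \<le> - J (Suc t) i"
      by (simp add: sum_negf)
  qed (use m R J0 off in auto)
  then show "eexp (paths_of i0 (Suc t)) (\<lambda>x. - (\<lambda>(h, j). \<Sum>k\<le>t. stage_cost n c (h k)) x) \<le> ereal (- J (Suc t) i0)"
    "(\<integral>\<^sup>+x. ennreal (- (\<lambda>(h, j). \<Sum>k\<le>t. stage_cost n c (h k)) x) \<partial>paths_of i0 (Suc t)) < \<infinity>"
    unfolding neg by auto
qed

end

section \<open>The dynamic programming operators of the game\<close>

lemma SD2_eq_SD1: "SD2 = SD1"
  by (simp add: SD1_def[abs_def] SD2_def[abs_def])

lemma SD1_update: "\<mu> \<in> SD1 n U \<Longrightarrow> u \<in> U i \<Longrightarrow> \<mu>(i := u) \<in> SD1 n U"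
  by (auto simp: SD1_def)

locale game =
  fixes n :: nat
    and U :: "nat \<Rightarrow> 'u::metric_space set"
    and V :: "nat \<Rightarrow> 'v::metric_space set"
    and c :: "nat \<Rightarrow> 'u \<Rightarrow> 'v \<Rightarrow> real"
    and p :: "nat \<Rightarrow> nat \<Rightarrow> 'u \<Rightarrow> 'v \<Rightarrow> real"
  assumes U_compact: "i \<in> {1..n} \<Longrightarrow> compact (U i)"
    and V_compact: "i \<in> {1..n} \<Longrightarrow> compact (V i)"
    and p_nonneg: "i \<in> {1..n} \<Longrightarrow> u \<in> U i \<Longrightarrow> v \<in> V i \<Longrightarrow> j \<in> {1..n} \<Longrightarrow> 0 \<le> p i j u v"
    and p_sum: "i \<in> {1..n} \<Longrightarrow> u \<in> U i \<Longrightarrow> v \<in> V i \<Longrightarrow> (\<Sum>j\<in>{1..n}. p i j u v) \<le> 1"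
    and cont_p: "i \<in> {1..n} \<Longrightarrow> j \<in> {1..n} \<Longrightarrow> continuous_on (U i \<times> V i) (\<lambda>(u, v). p i j u v)"
    and lsc_c: "i \<in> {1..n} \<Longrightarrow> v \<in> V i \<Longrightarrow> lsc_on (U i) (\<lambda>u. c i u v)"
    and usc_c: "i \<in> {1..n} \<Longrightarrow> u \<in> U i \<Longrightarrow> usc_on (V i) (\<lambda>v. c i u v)"
    and SD1_ne: "SD1 n U \<noteq> {}" and SD2_ne: "SD2 n V \<noteq> {}"
begin

lemma U_ne: "i \<in> {1..n} \<Longrightarrow> U i \<noteq> {}" and V_ne: "i \<in> {1..n} \<Longrightarrow> V i \<noteq> {}"
  using SD1_ne SD2_ne by (auto simp: SD1_def SD2_def)

text \<open>Statements about \<open>Tnu\<close> and \<open>Top'\<close> become those about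
  \<open>Tmu\<close> and \<open>Top\<close> in the game with the players exchanged and the costs
  negated.\<close>

lemma swap: "game n V U (\<lambda>i v u. - c i u v) (\<lambda>i j v u. p i j u v)"
proof
  fix i j assume ij: "i \<in> {1..n}" "j \<in> {1..n}"
  have "continuous_on (V i \<times> U i) ((\<lambda>(u, v). p i j u v) \<circ> prod.swap)"
    using cont_p[OF ij] by (intro continuous_on_compose continuous_on_swap) (simp add: product_swap)
  then show "continuous_on (V i \<times> U i) (\<lambda>(v, u). p i j u v)"
    by (rule continuous_on_cong[THEN iffD1, rotated 2]) auto
next
  show "SD1 n V \<noteq> {}" "SD2 n U \<noteq> {}" using SD1_ne SD2_ne by (simp_all add: SD2_eq_SD1)
qed (use U_compact V_compact p_nonneg p_sum lsc_c usc_c in \<open>simp_all add: lsc_on_uminus usc_on_uminus\<close>)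

section \<open>Player II's best-response problem and attainment of the minimax\<close>

abbreviation cost1 :: "(nat \<Rightarrow> 'u) \<Rightarrow> nat \<Rightarrow> 'v \<Rightarrow> real" where
  "cost1 \<mu> \<equiv> \<lambda>i v. c i (\<mu> i) v"

abbreviation prob1 :: "(nat \<Rightarrow> 'u) \<Rightarrow> nat \<Rightarrow> nat \<Rightarrow> 'v \<Rightarrow> real" where
  "prob1 \<mu> \<equiv> \<lambda>i j v. p i j (\<mu> i) v"

lemma decision1:
  assumes \<mu>: "\<mu> \<in> SD1 n U"
  shows "decision n V (cost1 \<mu>) (prob1 \<mu>)"
proof
  fix i j assume ij: "i \<in> {1..n}" "j \<in> {1..n}"
  have "continuous_on (V i) ((\<lambda>(u, v). p i j u v) \<circ> (\<lambda>v. (\<mu> i, v)))"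
    using \<mu> ij by (intro continuous_on_compose continuous_intros continuous_on_subset[OF cont_p[OF ij]])
      (auto simp: SD1_def)
  then show "continuous_on (V i) (prob1 \<mu> i j)" by (simp add: o_def)
qed (use \<mu> V_compact V_ne usc_c p_nonneg p_sum in \<open>auto simp: SD1_def\<close>)

lemma Tmn_act: "Tmn n c p \<mu> \<nu> = decision.act n (cost1 \<mu>) (prob1 \<mu>) \<nu>" if "\<mu> \<in> SD1 n U"
  by (simp add: fun_eq_iff Tmn_def decision.act_look[OF decision1[OF that]] decision.look_def[OF decision1[OF that]])

text \<open>At \<open>i\<close> only player II's action at \<open>i\<close> matters, and every such
  action belongs to a policy obtained by altering an existing one at \<open>i\<close>.\<close>

lemma Tmu_bell:
  assumes \<mu>: "\<mu> \<in> SD1 n U" and i: "i \<in> {1..n}"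
  shows "Tmu n V c p \<mu> x i = decision.bell n V (cost1 \<mu>) (prob1 \<mu>) x i"
proof -
  note look = decision.look_def[OF decision1[OF \<mu>]]
  have "(\<lambda>\<nu>. Tmn n c p \<mu> \<nu> x i) ` SD2 n V = decision.look n (cost1 \<mu>) (prob1 \<mu>) x i ` V i"
  proof (intro equalityI subsetI)
    fix y assume "y \<in> decision.look n (cost1 \<mu>) (prob1 \<mu>) x i ` V i"
    then obtain v where v: "v \<in> V i" "y = decision.look n (cost1 \<mu>) (prob1 \<mu>) x i v" by blast
    obtain \<nu> where "\<nu> \<in> SD2 n V" using SD2_ne by blast
    then have "\<nu>(i := v) \<in> SD2 n V" using SD1_update[of \<nu> n V v i] v(1) by (simp add: SD2_eq_SD1)
    then show "y \<in> (\<lambda>\<nu>. Tmn n c p \<mu> \<nu> x i) ` SD2 n V"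
      using v by (intro rev_image_eqI[of "\<nu>(i := v)"]) (auto simp: Tmn_def look)
  qed (use i in \<open>auto simp: Tmn_def look SD2_def\<close>)
  then show ?thesis
    unfolding Tmu_def decision.bell_def[OF decision1[OF \<mu>]] by simp
qed

lemma mono_sub_Tmn: "\<mu> \<in> SD1 n U \<Longrightarrow> \<nu> \<in> SD2 n V \<Longrightarrow> mono_sub n (Tmn n c p \<mu> \<nu>)"
  unfolding SD2_eq_SD1 by (simp add: Tmn_act decision.mono_sub_act[OF decision1])

lemma Tmn_le_Tmu: "\<mu> \<in> SD1 n U \<Longrightarrow> \<nu> \<in> SD2 n V \<Longrightarrow> i \<in> {1..n} \<Longrightarrow> Tmn n c p \<mu> \<nu> x i \<le> Tmu n V c p \<mu> x i"
  unfolding SD2_eq_SD1 by (simp add: Tmn_act Tmu_bell decision.act_le_bell[OF decision1])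

lemma mono_sub_Tmu:
  assumes "\<mu> \<in> SD1 n U"
  shows "mono_sub n (Tmu n V c p \<mu>)"
  using decision.mono_sub_bell[OF decision1[OF assms]] unfolding mono_sub_def
  by (simp add: Tmu_bell[OF assms])

lemma Tmu_local:
  assumes "\<mu> i = \<mu>' i"
  shows "Tmu n V c p \<mu> x i = Tmu n V c p \<mu>' x i"
  using assms by (simp add: Tmu_def Tmn_def)

text \<open>The worst case over player II is a supremum of lower semicontinuous functions of player
  I's action. Negation brings it into the form that \<open>usc_on_INF\<close> and
  \<open>usc_on_attains_sup\<close> handle.\<close>

lemma usc_uminus_Tmu:
  assumes i: "i \<in> {1..n}" and \<mu>: "\<mu> \<in> SD1 n U"
  shows "usc_on (U i) (\<lambda>u. - Tmu n V c p (\<mu>(i := u)) x i)"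
proof -
  let ?f = "\<lambda>v u. - (c i u v + (\<Sum>j\<in>{1..n}. p i j u v * x j))"
  have eq: "- Tmu n V c p (\<mu>(i := u)) x i = (INF v\<in>V i. ?f v u)" if "u \<in> U i" for u
  proof -
    note D = decision1[OF SD1_update[OF \<mu> that]]
    have "Tmu n V c p (\<mu>(i := u)) x i = (SUP v\<in>V i. c i u v + (\<Sum>j\<in>{1..n}. p i j u v * x j))"
      unfolding Tmu_bell[OF SD1_update[OF \<mu> that] i] decision.bell_def[OF D] decision.look_def[OF D] by simp
    then show ?thesis by (simp add: Inf_real_def image_image del: minus_add_distrib)
  qed
  have "usc_on (U i) (\<lambda>u. INF v\<in>V i. ?f v u)"
  proof (rule usc_on_INF[OF V_ne[OF i]])
    fix v assume v: "v \<in> V i"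
    have "continuous_on (U i) ((\<lambda>(u, v). p i j u v) \<circ> (\<lambda>u. (u, v)))" if "j \<in> {1..n}" for j
      using v by (intro continuous_on_compose continuous_intros continuous_on_subset[OF cont_p[OF i that]]) auto
    then have "continuous_on (U i) (\<lambda>u. - (\<Sum>j\<in>{1..n}. p i j u v * x j))"
      by (intro continuous_intros) (simp add: o_def)
    then have "usc_on (U i) (\<lambda>u. - c i u v + - (\<Sum>j\<in>{1..n}. p i j u v * x j))"
      using lsc_c[OF i v] by (intro usc_on_add[OF _ continuous_imp_usc_on]) (simp_all add: usc_on_uminus)
    then show "usc_on (U i) (?f v)" by simp
  next
    fix u assume u: "u \<in> U i"
    note D = decision1[OF SD1_update[OF \<mu> u]]
    show "bdd_below ((\<lambda>v. ?f v u) ` V i)"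
    proof (rule bdd_belowI2)
      fix v assume "v \<in> V i"
      then show "- decision.bell n V (cost1 (\<mu>(i := u))) (prob1 (\<mu>(i := u))) x i \<le> ?f v u"
        using decision.look_attained(2)[OF D i, of v x] unfolding decision.look_def[OF D] by simp
    qed
  qed
  then show ?thesis
    unfolding usc_on_def using eq by (metis (mono_tags, lifting) Collect_cong)
qed

lemma Top_Tmu: "Top n U V c p x i = (INF \<mu>\<in>SD1 n U. Tmu n V c p \<mu> x i)"
  by (simp add: Top_def Tmu_def)

text \<open>Letting \<open>\<mu>'\<close> range over everything with \<open>\<mu>' i = u\<close>
  records that only the action at \<open>i\<close> counts, so that minimizers found separately at
  each state can be assembled into one policy.\<close>

lemma Tmu_attains_inf:
  assumes i: "i \<in> {1..n}"
  shows "\<exists>u\<in>U i. \<forall>\<mu>\<in>SD1 n U. \<forall>\<mu>'. \<mu>' i = u \<longrightarrow> Tmu n V c p \<mu>' x i \<le> Tmu n V c p \<mu> x i"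
proof -
  obtain \<mu>0 where \<mu>0: "\<mu>0 \<in> SD1 n U" using SD1_ne by blast
  obtain u where u: "u \<in> U i" "\<And>u'. u' \<in> U i \<Longrightarrow>
      - Tmu n V c p (\<mu>0(i := u')) x i \<le> - Tmu n V c p (\<mu>0(i := u)) x i"
    using usc_on_attains_sup[OF U_compact[OF i] U_ne[OF i] usc_uminus_Tmu[OF i \<mu>0]] by blast
  have "Tmu n V c p \<mu>' x i \<le> Tmu n V c p \<mu> x i" if "\<mu> \<in> SD1 n U" "\<mu>' i = u" for \<mu> \<mu>'
  proof -
    have "\<mu> i \<in> U i" using that(1) i by (auto simp: SD1_def)
    from u(2)[OF this] show ?thesis
      using Tmu_local[of \<mu>' i "\<mu>0(i := u)" x] Tmu_local[of \<mu> i "\<mu>0(i := \<mu> i)" x] that(2) by simp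
  qed
  then show ?thesis using u(1) by blast
qed

lemma Top_attained: "\<exists>\<mu>\<in>SD1 n U. \<forall>i\<in>{1..n}. Top n U V c p x i = Tmu n V c p \<mu> x i"
  and Top_le_Tmu: "\<mu> \<in> SD1 n U \<Longrightarrow> i \<in> {1..n} \<Longrightarrow> Top n U V c p x i \<le> Tmu n V c p \<mu> x i"
proof -
  have "\<forall>i\<in>{1..n}. \<exists>u. u \<in> U i \<and> (\<forall>\<mu>\<in>SD1 n U. \<forall>\<mu>'. \<mu>' i = u \<longrightarrow> Tmu n V c p \<mu>' x i \<le> Tmu n V c p \<mu> x i)"
    using Tmu_attains_inf[of _ x] by blast
  then obtain \<mu> where \<mu>: "\<forall>i\<in>{1..n}. \<mu> i \<in> U i \<and>
      (\<forall>\<mu>1\<in>SD1 n U. \<forall>\<mu>'. \<mu>' i = \<mu> i \<longrightarrow> Tmu n V c p \<mu>' x i \<le> Tmu n V c p \<mu>1 x i)"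
    by (rule bchoice[THEN exE])
  have SD: "\<mu> \<in> SD1 n U" using \<mu> by (simp add: SD1_def)
  have le: "Tmu n V c p \<mu> x i \<le> Tmu n V c p \<mu>1 x i" if "\<mu>1 \<in> SD1 n U" "i \<in> {1..n}" for \<mu>1 i
    using \<mu> that by blast
  have eq: "Top n U V c p x i = Tmu n V c p \<mu> x i" if "i \<in> {1..n}" for i
    unfolding Top_Tmu using SD le[OF _ that] by (intro cInf_eq_minimum) auto
  show "\<exists>\<mu>\<in>SD1 n U. \<forall>i\<in>{1..n}. Top n U V c p x i = Tmu n V c p \<mu> x i" using SD eq by blast
  show "\<mu> \<in> SD1 n U \<Longrightarrow> i \<in> {1..n} \<Longrightarrow> Top n U V c p x i \<le> Tmu n V c p \<mu> x i" for \<mu> i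
    using eq le by simp
qed

lemma mono_sub_Top: "mono_sub n (Top n U V c p)"
  unfolding mono_sub_def
proof (intro conjI allI impI ballI)
  fix x y :: "nat \<Rightarrow> real" and i assume *: "\<forall>i\<in>{1..n}. x i \<le> y i" "i \<in> {1..n}"
  obtain \<mu> where \<mu>: "\<mu> \<in> SD1 n U" "\<forall>i\<in>{1..n}. Top n U V c p y i = Tmu n V c p \<mu> y i"
    using Top_attained by blast
  have "Tmu n V c p \<mu> x i \<le> Tmu n V c p \<mu> y i" using mono_subD1[OF mono_sub_Tmu[OF \<mu>(1)]] * by blast
  then show "Top n U V c p x i \<le> Top n U V c p y i" using \<mu>(2) *(2) Top_le_Tmu[OF \<mu>(1) *(2), of x] by simp
next
  fix x :: "nat \<Rightarrow> real" and d :: real and i assume d: "0 \<le> d" and i: "i \<in> {1..n}"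
  obtain \<mu> where \<mu>: "\<mu> \<in> SD1 n U" "\<forall>i\<in>{1..n}. Top n U V c p x i = Tmu n V c p \<mu> x i"
    using Top_attained by blast
  show "Top n U V c p (\<lambda>j. x j + d) i \<le> Top n U V c p x i + d"
    using Top_le_Tmu[OF \<mu>(1) i, of "\<lambda>j. x j + d"] mono_subD2[OF mono_sub_Tmu[OF \<mu>(1)] d i, of x] \<mu>(2) i by simp
qed

section \<open>Transfer to player II's operators by exchanging the players\<close>

lemma Tmn_swap: "Tmn n (\<lambda>i v u. - c i u v) (\<lambda>i j v u. p i j u v) \<nu> \<mu> x i = - Tmn n c p \<mu> \<nu> (\<lambda>j. - x j) i"
  by (simp add: Tmn_def sum_negf)

lemma Tnu_swap:
  "Tnu n U c p \<nu> x i = - Tmu n U (\<lambda>i v u. - c i u v) (\<lambda>i j v u. p i j u v) \<nu> (\<lambda>j. - x j) i"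
  by (simp add: Tnu_def Tmu_def Tmn_swap Inf_real_def image_image SD2_eq_SD1)

lemma Top'_swap:
  "Top' n U V c p x i = - Top n V U (\<lambda>i v u. - c i u v) (\<lambda>i j v u. p i j u v) (\<lambda>j. - x j) i"
  by (simp add: Top'_def Top_def Tmn_swap Inf_real_def image_image SD2_eq_SD1)

lemma Tnu_le_Tmn: "\<mu> \<in> SD1 n U \<Longrightarrow> \<nu> \<in> SD2 n V \<Longrightarrow> i \<in> {1..n} \<Longrightarrow> Tnu n U c p \<nu> x i \<le> Tmn n c p \<mu> \<nu> x i"
  using game.Tmn_le_Tmu[OF swap, of \<nu> \<mu> i "\<lambda>j. - x j"] by (simp add: Tnu_swap Tmn_swap SD2_eq_SD1)

lemma Top'_attained: "\<exists>\<nu>\<in>SD2 n V. \<forall>i\<in>{1..n}. Top' n U V c p x i = Tnu n U c p \<nu> x i"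
  using game.Top_attained[OF swap, of "\<lambda>j. - x j"] by (simp add: Top'_swap Tnu_swap SD2_eq_SD1)

lemma Tnu_le_Top': "\<nu> \<in> SD2 n V \<Longrightarrow> i \<in> {1..n} \<Longrightarrow> Tnu n U c p \<nu> x i \<le> Top' n U V c p x i"
  using game.Top_le_Tmu[OF swap, of \<nu> i "\<lambda>j. - x j"] by (simp add: Top'_swap Tnu_swap SD2_eq_SD1)

end

section \<open>Stationary and history-dependent policies\<close>

lemma stat1_Pol1:
  assumes "\<And>i. i \<in> {1..n} \<Longrightarrow> U i \<in> sets borel" "\<mu> \<in> SD1 n U"
  shows "stat1 \<mu> \<in> Pol1 n U"
  using assms by (auto simp: stat1_def Pol1_def SD1_def space_prob_algebra prob_space_return
      intro!: measurable_const)

lemma stat2_Pol2: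
  assumes "\<And>i. i \<in> {1..n} \<Longrightarrow> V i \<in> sets borel" "\<nu> \<in> SD2 n V"
  shows "stat2 \<nu> \<in> Pol2 n V"
  using assms by (auto simp: stat2_def Pol2_def SD2_def space_prob_algebra prob_space_return
      intro!: measurable_const)

lemma liminf_le_real:
  fixes f :: "nat \<Rightarrow> ereal"
  assumes "\<And>t. f t \<le> ereal B"
  shows "liminf f \<le> ereal B"
  using Liminf_mono[of f "\<lambda>_. ereal B" sequentially] assms by (simp add: Liminf_const)

lemma liminf_ge_real:
  fixes f :: "nat \<Rightarrow> ereal"
  assumes "\<And>t. ereal B \<le> f t"
  shows "ereal B \<le> liminf f"
  by (rule Liminf_bounded) (simp add: assms)

text \<open>Of the model assumption only part (iii) is built in. One-sided finiteness is a
  hypothesis of the individual lemmas, since it is needed both for the policies granted by (i) and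
  (ii) and for those attaining a fixed point, where it has to be derived.\<close>

locale ssp_game = game n U V c p
  for n :: nat
    and U :: "nat \<Rightarrow> 'u::polish_space set"
    and V :: "nat \<Rightarrow> 'v::polish_space set"
    and c p +
  assumes p_nonneg0: "i \<in> {1..n} \<Longrightarrow> u \<in> U i \<Longrightarrow> v \<in> V i \<Longrightarrow> j \<in> {0..n} \<Longrightarrow> 0 \<le> p i j u v"
    and p_sum0: "i \<in> {1..n} \<Longrightarrow> u \<in> U i \<Longrightarrow> v \<in> V i \<Longrightarrow> (\<Sum>j\<in>{0..n}. p i j u v) = 1"
    and prolonging_infinite: "\<mu> \<in> SD1 n U \<Longrightarrow> \<nu> \<in> SD2 n V \<Longrightarrow> prolonging n U V p (stat1 \<mu>) (stat2 \<nu>) \<Longrightarrow>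
      \<exists>i\<in>{1..n}. xcost n U V c p (stat1 \<mu>) (stat2 \<nu>) i \<in> {\<infinity>, -\<infinity>}"
begin

lemma U_sets: "i \<in> {1..n} \<Longrightarrow> U i \<in> sets borel" and V_sets: "i \<in> {1..n} \<Longrightarrow> V i \<in> sets borel"
  using U_compact V_compact by (auto intro: borel_closed compact_imp_closed)

lemma stat1_Pol: "\<mu> \<in> SD1 n U \<Longrightarrow> stat1 \<mu> \<in> Pol1 n U"
  by (rule stat1_Pol1[OF U_sets])

lemma stat2_Pol: "\<nu> \<in> SD2 n V \<Longrightarrow> stat2 \<nu> \<in> Pol2 n V"
  by (rule stat2_Pol2[OF V_sets])

lemma process1:
  assumes "\<mu> \<in> SD1 n U" "\<pi>2 \<in> Pol2 n V"
  shows "game_process n U V p (stat1 \<mu>) \<pi>2 (\<lambda>i. {\<mu> i}) V"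
proof
  show "stat1 \<mu> \<in> Pol1 n U" by (rule stat1_Pol[OF assms(1)])
  show "emeasure (stat1 \<mu> k h i) {\<mu> i} = 1" if "i \<in> {1..n}" for k h i
    by (simp add: stat1_def)
qed (use assms U_compact V_compact p_nonneg0 p_sum0 cont_p V_sets in \<open>auto simp: SD1_def Pol2_def\<close>)

lemma process2:
  assumes "\<pi>1 \<in> Pol1 n U" "\<nu> \<in> SD2 n V"
  shows "game_process n U V p \<pi>1 (stat2 \<nu>) U (\<lambda>i. {\<nu> i})"
proof
  show "stat2 \<nu> \<in> Pol2 n V" by (rule stat2_Pol[OF assms(2)])
  show "emeasure (stat2 \<nu> k h i) {\<nu> i} = 1" if "i \<in> {1..n}" for k h i
    by (simp add: stat2_def)
qed (use assms U_compact V_compact p_nonneg0 p_sum0 cont_p U_sets in \<open>auto simp: SD2_def Pol1_def\<close>)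

lemma process12:
  assumes "\<mu> \<in> SD1 n U" "\<nu> \<in> SD2 n V"
  shows "game_process n U V p (stat1 \<mu>) (stat2 \<nu>) (\<lambda>i. {\<mu> i}) (\<lambda>i. {\<nu> i})"
proof
  show "stat1 \<mu> \<in> Pol1 n U" by (rule stat1_Pol[OF assms(1)])
  show "stat2 \<nu> \<in> Pol2 n V" by (rule stat2_Pol[OF assms(2)])
  show "emeasure (stat1 \<mu> k h i) {\<mu> i} = 1" if "i \<in> {1..n}" for k h i
    by (simp add: stat1_def)
  show "emeasure (stat2 \<nu> k h i) {\<nu> i} = 1" if "i \<in> {1..n}" for k h i
    by (simp add: stat2_def)
qed (use assms U_compact V_compact p_nonneg0 p_sum0 cont_p in \<open>auto simp: SD1_def SD2_def\<close>)

section \<open>Costs and termination under a pair of stationary policies\<close>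

definition PM :: "(nat \<Rightarrow> 'u) \<Rightarrow> (nat \<Rightarrow> 'v) \<Rightarrow> nat \<Rightarrow> nat \<Rightarrow> real" where
  "PM \<mu> \<nu> i j = p i j (\<mu> i) (\<nu> i)"

lemma Tmn_aff: "Tmn n c p \<mu> \<nu> = aff n (\<lambda>i. c i (\<mu> i) (\<nu> i)) (PM \<mu> \<nu>)"
  by (simp add: fun_eq_iff Tmn_def aff_def lin_def PM_def)

lemma substoch_PM: "\<mu> \<in> SD1 n U \<Longrightarrow> \<nu> \<in> SD2 n V \<Longrightarrow> substoch n (PM \<mu> \<nu>)"
  using p_nonneg p_sum by (auto simp: substoch_def PM_def SD1_def SD2_def)

text \<open>Both carriers are singletons, so the dynamic programming inequality is an equality and
  the upper and lower estimates coincide.\<close>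

lemma expected_cost_stationary:
  assumes \<mu>: "\<mu> \<in> SD1 n U" and \<nu>: "\<nu> \<in> SD2 n V" and i: "i \<in> {1..n}"
  shows "eexp (paths n U V p (stat1 \<mu>) (stat2 \<nu>) i (Suc t)) (\<lambda>(h, j). \<Sum>k\<le>t. stage_cost n c (h k)) =
    ereal ((Tmn n c p \<mu> \<nu> ^^ Suc t) (\<lambda>_. 0) i)"
proof -
  interpret game_process n U V p "stat1 \<mu>" "stat2 \<nu>" "\<lambda>i. {\<mu> i}" "\<lambda>i. {\<nu> i}" by (rule process12[OF \<mu> \<nu>])
  define J where "J t i = (if i \<in> {1..n} then (Tmn n c p \<mu> \<nu> ^^ t) (\<lambda>_. 0) i else 0)" for t i
  have J: "J (Suc t) i = c i (\<mu> i) (\<nu> i) + (\<Sum>j\<in>{1..n}. p i j (\<mu> i) (\<nu> i) * J t j)"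
    if "i \<in> {1..n}" for t i
  proof -
    have "J (Suc t) i = Tmn n c p \<mu> \<nu> ((Tmn n c p \<mu> \<nu> ^^ t) (\<lambda>_. 0)) i"
      using that by (simp add: J_def)
    also have "\<dots> = c i (\<mu> i) (\<nu> i) + (\<Sum>j\<in>{1..n}. p i j (\<mu> i) (\<nu> i) * (Tmn n c p \<mu> \<nu> ^^ t) (\<lambda>_. 0) j)"
      by (rule Tmn_def)
    also have "\<dots> = c i (\<mu> i) (\<nu> i) + (\<Sum>j\<in>{1..n}. p i j (\<mu> i) (\<nu> i) * J t j)"
      by (intro arg_cong2[where f = plus] sum.cong refl) (simp add: J_def)
    finally show ?thesis .
  qed
  have m: "(\<lambda>x. if fst x \<in> {\<mu> i} \<and> snd x \<in> {\<nu> i} then c i (fst x) (snd x) else 0)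
      \<in> borel_measurable (borel \<Otimes>\<^sub>M borel)" for i
  proof -
    have "(\<lambda>x. if fst x \<in> {\<mu> i} \<and> snd x \<in> {\<nu> i} then c i (fst x) (snd x) else 0) =
        (\<lambda>x. if fst x \<in> {\<mu> i} \<and> snd x \<in> {\<nu> i} then c i (\<mu> i) (\<nu> i) else 0)"
      by auto
    also have "\<dots> \<in> borel_measurable (borel \<Otimes>\<^sub>M borel)" by measurable
    finally show ?thesis .
  qed
  define R where "R = Max ((\<lambda>i. \<bar>c i (\<mu> i) (\<nu> i)\<bar>) ` {1..n})"
  have R: "\<bar>c i (\<mu> i) (\<nu> i)\<bar> \<le> R" if "i \<in> {1..n}" for i
    unfolding R_def using that by (intro Max_ge) auto
  let ?e = "eexp (paths_of i (Suc t)) (\<lambda>(h, j). \<Sum>k\<le>t. stage_cost n c (h k))"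
  have "?e \<le> ereal (J (Suc t) i)"
    by (rule expected_cost_le[where R = R, THEN conjunct1])
      (use m R J in \<open>force simp: J_def abs_le_iff simp del: funpow.simps\<close>)+
  moreover have "ereal (J (Suc t) i) \<le> ?e"
    by (rule expected_cost_ge[where R = "- R"])
      (use m R J in \<open>force simp: J_def abs_le_iff simp del: funpow.simps\<close>)+
  ultimately show ?thesis using i by (simp add: J_def del: funpow.simps paths.simps)
qed

lemma xcost_stationary:
  assumes "\<mu> \<in> SD1 n U" "\<nu> \<in> SD2 n V" "i \<in> {1..n}"
  shows "xcost n U V c p (stat1 \<mu>) (stat2 \<nu>) i = liminf (\<lambda>t. ereal ((Tmn n c p \<mu> \<nu> ^^ Suc t) (\<lambda>_. 0) i))"
  unfolding xcost_def expected_cost_stationary[OF assms] ..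

text \<open>\<open>dynamic_programming_bound\<close> is used with zero stage cost and the indicator
  of the nonzero states as terminal function. \<open>K = 1\<close> bounds absorption from below; the
  negated function with \<open>K = 0\<close> bounds it from above.\<close>

lemma absorption_probability:
  assumes \<mu>: "\<mu> \<in> SD1 n U" and \<nu>: "\<nu> \<in> SD2 n V" and i: "i \<in> {1..n}"
  shows "measure (paths n U V p (stat1 \<mu>) (stat2 \<nu>) i t) {x \<in> space (XM t). snd x = 0} =
    1 - (lin n (PM \<mu> \<nu>) ^^ t) (\<lambda>_. 1) i"
proof -
  interpret game_process n U V p "stat1 \<mu>" "stat2 \<nu>" "\<lambda>i. {\<mu> i}" "\<lambda>i. {\<nu> i}" by (rule process12[OF \<mu> \<nu>])
  interpret M: prob_space "paths_of i t" by (rule prob_space_paths)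
  \<comment> \<open>\<open>J t i\<close> is the probability of not being in state 0 after
    \<open>t\<close> steps. States above \<open>n\<close> stay put, whence the value 1.\<close>
  define J where "J t i = (if i \<in> {1..n} then (lin n (PM \<mu> \<nu>) ^^ t) (\<lambda>_. 1) i else if i = 0 then 0 else 1)" for t i
  have J: "J (Suc t) i = (\<Sum>j\<in>{0..n}. p i j (\<mu> i) (\<nu> i) * J t j)" if "i \<in> {1..n}" for t i
  proof -
    have "J (Suc t) i = lin n (PM \<mu> \<nu>) ((lin n (PM \<mu> \<nu>) ^^ t) (\<lambda>_. 1)) i"
      using that by (simp add: J_def)
    also have "\<dots> = (\<Sum>j\<in>{1..n}. p i j (\<mu> i) (\<nu> i) * (lin n (PM \<mu> \<nu>) ^^ t) (\<lambda>_. 1) j)"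
      unfolding lin_def[of n _ "(lin n (PM \<mu> \<nu>) ^^ t) (\<lambda>_. 1)"] PM_def[of \<mu> \<nu> i] ..
    also have "\<dots> = (\<Sum>j\<in>{1..n}. p i j (\<mu> i) (\<nu> i) * J t j)"
      by (intro sum.cong refl) (simp add: J_def)
    also have "\<dots> = (\<Sum>j\<in>{0..n}. p i j (\<mu> i) (\<nu> i) * J t j)"
      by (intro sum.mono_neutral_left) (auto simp: J_def)
    finally show ?thesis .
  qed
  have off: "J (Suc t) i = J t i" if "i \<notin> {1..n}" for t i
    using that by (simp only: J_def if_False)
  have J0: "J 0 j = (if j = 0 then 0 else 1)" for j by (simp add: J_def)
  have sets: "{x \<in> space (XM t). snd x = 0} \<in> sets (paths_of i t)" (is "?E \<in> _")
    unfolding sets_paths XM_def by measurable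
  have "ennreal (1 - J t i) \<le> (\<integral>\<^sup>+x. ennreal (1 - J 0 (snd x)) \<partial>paths_of i t)"
    using dynamic_programming_bound[of "\<lambda>_. 0" J 1 t 0 i] J off by simp
  also have "\<dots> = (\<integral>\<^sup>+x. indicator ?E x \<partial>paths_of i t)"
    by (intro nn_integral_cong) (auto simp: space_paths J0 indicator_def)
  also have "\<dots> = ennreal (measure (paths_of i t) ?E)"
    using sets by (simp add: M.emeasure_eq_measure)
  finally have "1 - J t i \<le> measure (paths_of i t) ?E"
    by simp
  moreover have "J t i \<le> 1 - measure (paths_of i t) ?E"
  proof -
    have "ennreal (J t i) \<le> (\<integral>\<^sup>+x. ennreal (J 0 (snd x)) \<partial>paths_of i t)"
      using dynamic_programming_bound[of "\<lambda>_. 0" "\<lambda>t i. - J t i" 0 t 0 i] J off by (simp add: sum_negf)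
    also have "\<dots> = (\<integral>\<^sup>+x. indicator (space (paths_of i t) - ?E) x \<partial>paths_of i t)"
      by (intro nn_integral_cong) (auto simp: space_paths J0 indicator_def)
    also have "\<dots> = ennreal (measure (paths_of i t) (space (paths_of i t) - ?E))"
      using sets by (simp add: M.emeasure_eq_measure)
    also have "measure (paths_of i t) (space (paths_of i t) - ?E) = 1 - measure (paths_of i t) ?E"
      by (rule M.prob_compl[OF sets])
    finally show ?thesis by simp
  qed
  ultimately show ?thesis using i by (simp add: J_def)
qed

lemma non_prolonging_iff:
  assumes "\<mu> \<in> SD1 n U" "\<nu> \<in> SD2 n V"
  shows "non_prolonging n U V p (stat1 \<mu>) (stat2 \<nu>) \<longleftrightarrow> transient n (PM \<mu> \<nu>)"
proof -
  have "((\<lambda>t. 1 - f t) \<longlonglongrightarrow> 1) \<longleftrightarrow> (f \<longlonglongrightarrow> 0)" for f :: "nat \<Rightarrow> real"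
    using tendsto_diff[of "\<lambda>_. 1" 1 sequentially f 0] tendsto_diff[of "\<lambda>_. 1" 1 sequentially "\<lambda>t. 1 - f t" 1] by auto
  then show ?thesis
    unfolding non_prolonging_def transient_def
    by (intro ball_cong refl) (simp add: absorption_probability[OF assms])
qed

text \<open>Termination is not known here, so the terminal term left by the subsolution need not
  vanish; being bounded, it still keeps the limit inferior above -\<infinity>.\<close>

lemma xcost_gt_minf:
  assumes "\<mu> \<in> SD1 n U" "\<nu> \<in> SD2 n V" "\<And>i. i \<in> {1..n} \<Longrightarrow> w i \<le> Tmn n c p \<mu> \<nu> w i" "i \<in> {1..n}"
  shows "- \<infinity> < xcost n U V c p (stat1 \<mu>) (stat2 \<nu>) i"
proof -
  note Q = substoch_PM[OF assms(1,2)]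
  obtain K where K: "\<And>i t. i \<in> {1..n} \<Longrightarrow> \<bar>(lin n (PM \<mu> \<nu>) ^^ t) w i\<bar> \<le> K"
    using lin_funpow_bounded[OF Q] by metis
  have "w i - K \<le> (Tmn n c p \<mu> \<nu> ^^ Suc t) (\<lambda>_. 0) i" for t
    using aff_funpow_sub[OF Q assms(3)[unfolded Tmn_aff] assms(4), of "Suc t"] K[OF assms(4), of "Suc t"]
    unfolding Tmn_aff by linarith
  then have "ereal (w i - K) \<le> xcost n U V c p (stat1 \<mu>) (stat2 \<nu>) i"
    unfolding xcost_stationary[OF assms(1,2,4)] by (intro liminf_ge_real) simp
  then show ?thesis by (rule less_le_trans[rotated]) simp
qed

lemma xcost_lt_inf:
  assumes "\<mu> \<in> SD1 n U" "\<nu> \<in> SD2 n V" "\<And>i. i \<in> {1..n} \<Longrightarrow> Tmn n c p \<mu> \<nu> w i \<le> w i" "i \<in> {1..n}"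
  shows "xcost n U V c p (stat1 \<mu>) (stat2 \<nu>) i < \<infinity>"
proof -
  note Q = substoch_PM[OF assms(1,2)]
  obtain K where K: "\<And>i t. i \<in> {1..n} \<Longrightarrow> \<bar>(lin n (PM \<mu> \<nu>) ^^ t) w i\<bar> \<le> K"
    using lin_funpow_bounded[OF Q] by metis
  have "(Tmn n c p \<mu> \<nu> ^^ Suc t) (\<lambda>_. 0) i \<le> w i + K" for t
    using aff_funpow_super[OF Q assms(3)[unfolded Tmn_aff] assms(4), of "Suc t"] K[OF assms(4), of "Suc t"]
    unfolding Tmn_aff by linarith
  then have "xcost n U V c p (stat1 \<mu>) (stat2 \<nu>) i \<le> ereal (w i + K)"
    unfolding xcost_stationary[OF assms(1,2,4)] by (intro liminf_le_real) simp
  then show ?thesis by (rule le_less_trans) simp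
qed

lemma finite_imp_transient:
  assumes "\<mu> \<in> SD1 n U" "\<nu> \<in> SD2 n V"
    and "\<And>i. i \<in> {1..n} \<Longrightarrow> xcost n U V c p (stat1 \<mu>) (stat2 \<nu>) i < \<infinity>"
    and "\<And>i. i \<in> {1..n} \<Longrightarrow> - \<infinity> < xcost n U V c p (stat1 \<mu>) (stat2 \<nu>) i"
  shows "transient n (PM \<mu> \<nu>)"
proof (rule ccontr)
  assume "\<not> transient n (PM \<mu> \<nu>)"
  then have "prolonging n U V p (stat1 \<mu>) (stat2 \<nu>)"
    using non_prolonging_iff[OF assms(1,2)] by (simp add: prolonging_def)
  then show False using prolonging_infinite[OF assms(1,2)] assms(3,4) by force
qed

text \<open>A subsolution keeps the cost of the pair above -\<infinity> and \<open>fin\<close> keeps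
  it below \<infinity>, which part (iii) forbids for prolonging pairs.\<close>

lemma proper1:
  assumes \<mu>: "\<mu> \<in> SD1 n U"
    and fin: "\<And>\<nu> i. \<nu> \<in> SD2 n V \<Longrightarrow> i \<in> {1..n} \<Longrightarrow> xcost n U V c p (stat1 \<mu>) (stat2 \<nu>) i < \<infinity>"
  shows "proper_decision n V (cost1 \<mu>) (prob1 \<mu>)"
proof (intro proper_decision.intro decision1[OF \<mu>] proper_decision_axioms.intro)
  fix \<nu> w
  assume \<nu>: "\<nu> \<in> SD1 n V" and w: "\<And>i. i \<in> {1..n} \<Longrightarrow> w i \<le> decision.act n (cost1 \<mu>) (prob1 \<mu>) \<nu> w i"
  have \<nu>2: "\<nu> \<in> SD2 n V" using \<nu> by (simp add: SD2_eq_SD1)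
  have "transient n (PM \<mu> \<nu>)"
    using finite_imp_transient[OF \<mu> \<nu>2 fin[OF \<nu>2] xcost_gt_minf[OF \<mu> \<nu>2, of w]] w
    unfolding Tmn_act[OF \<mu>] by blast
  then show "transient n (decision.Q (prob1 \<mu>) \<nu>)"
    by (simp add: PM_def[abs_def] decision.Q_def[OF decision1[OF \<mu>], abs_def])
qed

section \<open>Player I's best-response problem\<close>

abbreviation cost2 :: "(nat \<Rightarrow> 'v) \<Rightarrow> nat \<Rightarrow> 'u \<Rightarrow> real" where
  "cost2 \<nu> \<equiv> \<lambda>i u. - c i u (\<nu> i)"

abbreviation prob2 :: "(nat \<Rightarrow> 'v) \<Rightarrow> nat \<Rightarrow> nat \<Rightarrow> 'u \<Rightarrow> real" where
  "prob2 \<nu> \<equiv> \<lambda>i j u. p i j u (\<nu> i)"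

lemma decision2: "\<nu> \<in> SD2 n V \<Longrightarrow> decision n U (cost2 \<nu>) (prob2 \<nu>)"
  using game.decision1[OF swap] by (simp add: SD2_eq_SD1)

lemma Tnu_bell: "\<nu> \<in> SD2 n V \<Longrightarrow> i \<in> {1..n} \<Longrightarrow>
    Tnu n U c p \<nu> x i = - decision.bell n U (cost2 \<nu>) (prob2 \<nu>) (\<lambda>j. - x j) i"
  using game.Tmu_bell[OF swap] by (simp add: SD2_eq_SD1 Tnu_swap)

lemma Tmn_act2: "\<nu> \<in> SD2 n V \<Longrightarrow>
    Tmn n c p \<mu> \<nu> x i = - decision.act n (cost2 \<nu>) (prob2 \<nu>) \<mu> (\<lambda>j. - x j) i"
  using game.Tmn_act[OF swap, of \<nu> \<mu>] Tmn_swap[of \<nu> \<mu> "\<lambda>j. - x j" i] by (simp add: SD2_eq_SD1)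

lemma proper2:
  assumes \<nu>: "\<nu> \<in> SD2 n V"
    and fin: "\<And>\<mu> i. \<mu> \<in> SD1 n U \<Longrightarrow> i \<in> {1..n} \<Longrightarrow> - \<infinity> < xcost n U V c p (stat1 \<mu>) (stat2 \<nu>) i"
  shows "proper_decision n U (cost2 \<nu>) (prob2 \<nu>)"
proof (intro proper_decision.intro decision2[OF \<nu>] proper_decision_axioms.intro)
  fix \<mu> w
  assume \<mu>: "\<mu> \<in> SD1 n U" and w: "\<And>i. i \<in> {1..n} \<Longrightarrow> w i \<le> decision.act n (cost2 \<nu>) (prob2 \<nu>) \<mu> w i"
  have "Tmn n c p \<mu> \<nu> (\<lambda>j. - w j) i \<le> - w i" if "i \<in> {1..n}" for i
    using w[OF that] unfolding Tmn_act2[OF \<nu>] by simp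
  then have "transient n (PM \<mu> \<nu>)"
    using finite_imp_transient[OF \<mu> \<nu> xcost_lt_inf[OF \<mu> \<nu>, of "\<lambda>j. - w j"] fin[OF \<mu>]] by blast
  then show "transient n (decision.Q (prob2 \<nu>) \<mu>)"
    by (simp add: PM_def[abs_def] decision.Q_def[OF decision2[OF \<nu>], abs_def])
qed

text \<open>\<open>J t\<close> is the optimal \<open>t\<close>-stage payoff of player II with
  terminal payoff 0. It dominates the \<open>t\<close>-stage cost of every history-dependent
  randomized reply and tends to \<open>x\<close> by value iteration.\<close>

lemma xcost_le_fixed_point:
  assumes \<mu>: "\<mu> \<in> SD1 n U" and x: "\<And>i. i \<in> {1..n} \<Longrightarrow> Tmu n V c p \<mu> x i = x i"
    and fin: "\<And>\<nu> i. \<nu> \<in> SD2 n V \<Longrightarrow> i \<in> {1..n} \<Longrightarrow> xcost n U V c p (stat1 \<mu>) (stat2 \<nu>) i < \<infinity>"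
    and \<pi>2: "\<pi>2 \<in> Pol2 n V" and i: "i \<in> {1..n}"
  shows "xcost n U V c p (stat1 \<mu>) \<pi>2 i \<le> ereal (x i)"
proof -
  interpret game_process n U V p "stat1 \<mu>" \<pi>2 "\<lambda>i. {\<mu> i}" V by (rule process1[OF \<mu> \<pi>2])
  interpret D: proper_decision n V "cost1 \<mu>" "prob1 \<mu>" by (rule proper1[OF \<mu> fin])
  define J where "J t i = (if i \<in> {1..n} then (D.bell ^^ t) (\<lambda>_. 0) i else 0)" for t i
  have on: "c i u v + (\<Sum>j\<in>{1..n}. p i j u v * J t j) \<le> J (Suc t) i"
    if "i \<in> {1..n}" "u \<in> {\<mu> i}" "v \<in> V i" for t i u v
  proof -
    have "(\<Sum>j\<in>{1..n}. p i j u v * J t j) = (\<Sum>j\<in>{1..n}. p i j (\<mu> i) v * (D.bell ^^ t) (\<lambda>_. 0) j)"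
      using that by (intro sum.cong) (auto simp: J_def)
    then show ?thesis
      using D.look_attained(2)[OF that(1,3), of "(D.bell ^^ t) (\<lambda>_. 0)"] that
      by (simp add: D.look_def J_def)
  qed
  \<comment> \<open>With player I's control pinned to \<open>\<mu> i\<close>, the cost depends on
    one control only, and semicontinuity in it gives Borel measurability.\<close>
  have m: "(\<lambda>x. if fst x \<in> {\<mu> i} \<and> snd x \<in> V i then c i (fst x) (snd x) else 0)
      \<in> borel_measurable (borel \<Otimes>\<^sub>M borel)" if i: "i \<in> {1..n}" for i
  proof -
    have [measurable]: "(\<lambda>v. if v \<in> V i then c i (\<mu> i) v else 0) \<in> borel_measurable borel"
      by (rule usc_on_borel[OF D.usc[OF i] V_sets[OF i]])
    have "(\<lambda>x. if fst x \<in> {\<mu> i} then (\<lambda>v. if v \<in> V i then c i (\<mu> i) v else 0) (snd x) else 0)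
        \<in> borel_measurable (borel \<Otimes>\<^sub>M borel)"
      by measurable
    then show ?thesis
      by (rule measurable_cong[THEN iffD1, rotated]) auto
  qed
  have "\<exists>R. \<forall>i\<in>{1..n}. \<forall>v\<in>V i. c i (\<mu> i) v \<le> R"
  proof -
    have "\<forall>i\<in>{1..n}. \<exists>v. \<forall>v'\<in>V i. c i (\<mu> i) v' \<le> c i (\<mu> i) v"
      using usc_on_attains_sup[OF D.compact D.nonempty D.usc] by blast
    then obtain f where f: "\<forall>i\<in>{1..n}. \<forall>v'\<in>V i. c i (\<mu> i) v' \<le> c i (\<mu> i) (f i)"
      by (rule bchoice[THEN exE])
    have "c i (\<mu> i) v \<le> Max ((\<lambda>i. c i (\<mu> i) (f i)) ` {1..n})" if "i \<in> {1..n}" "v \<in> V i" for i v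
      using f that by (intro order_trans[OF _ Max_ge[of _ "c i (\<mu> i) (f i)"]]) auto
    then show ?thesis by blast
  qed
  then obtain R where R: "\<And>i v. i \<in> {1..n} \<Longrightarrow> v \<in> V i \<Longrightarrow> c i (\<mu> i) v \<le> R" by blast
  have "eexp (paths_of i (Suc t)) (\<lambda>(h, j). \<Sum>k\<le>t. stage_cost n c (h k)) \<le> ereal (J (Suc t) i)" for t
    by (rule expected_cost_le[where R = R and c = c and J = J, THEN conjunct1, OF m _ _ _ on]) (auto simp: R J_def)
  then have "xcost n U V c p (stat1 \<mu>) \<pi>2 i \<le> liminf (\<lambda>t. ereal (J (Suc t) i))"
    unfolding xcost_def by (intro Liminf_mono always_eventually allI)
  also have "(\<lambda>t. ereal (J (Suc t) i)) \<longlonglongrightarrow> ereal (x i)"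
  proof -
    have "D.bell x i = x i" if "i \<in> {1..n}" for i
      using x[OF that] Tmu_bell[OF \<mu> that] by simp
    from LIMSEQ_Suc[OF D.value_iteration[OF this i]] show ?thesis using i by (simp add: J_def del: funpow.simps)
  qed
  then have "liminf (\<lambda>t. ereal (J (Suc t) i)) = ereal (x i)"
    by (rule lim_imp_Liminf[rotated]) simp
  finally show ?thesis .
qed

text \<open>\<open>swap\<close> exchanges the operators but not the path measures, whose histories
  list player I's control first. The sign is therefore carried by \<open>J\<close>, with
  \<open>expected_cost_ge\<close> in place of \<open>expected_cost_le\<close>.\<close>

lemma xcost_ge_fixed_point:
  assumes \<nu>: "\<nu> \<in> SD2 n V" and x: "\<And>i. i \<in> {1..n} \<Longrightarrow> Tnu n U c p \<nu> x i = x i"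
    and fin: "\<And>\<mu> i. \<mu> \<in> SD1 n U \<Longrightarrow> i \<in> {1..n} \<Longrightarrow> - \<infinity> < xcost n U V c p (stat1 \<mu>) (stat2 \<nu>) i"
    and \<pi>1: "\<pi>1 \<in> Pol1 n U" and i: "i \<in> {1..n}"
  shows "ereal (x i) \<le> xcost n U V c p \<pi>1 (stat2 \<nu>) i"
proof -
  interpret game_process n U V p \<pi>1 "stat2 \<nu>" U "\<lambda>i. {\<nu> i}" by (rule process2[OF \<pi>1 \<nu>])
  interpret D: proper_decision n U "cost2 \<nu>" "prob2 \<nu>" by (rule proper2[OF \<nu> fin])
  define J where "J t i = (if i \<in> {1..n} then - (D.bell ^^ t) (\<lambda>_. 0) i else 0)" for t i
  have on: "J (Suc t) i \<le> c i u v + (\<Sum>j\<in>{1..n}. p i j u v * J t j)"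
    if "i \<in> {1..n}" "u \<in> U i" "v \<in> {\<nu> i}" for t i u v
  proof -
    have "(\<Sum>j\<in>{1..n}. p i j u v * J t j) = - (\<Sum>j\<in>{1..n}. p i j u (\<nu> i) * (D.bell ^^ t) (\<lambda>_. 0) j)"
      unfolding sum_negf[symmetric] using that by (intro sum.cong) (auto simp: J_def)
    then show ?thesis
      using D.look_attained(2)[OF that(1,2), of "(D.bell ^^ t) (\<lambda>_. 0)"] that
      by (simp add: D.look_def J_def)
  qed
  have m: "(\<lambda>x. if fst x \<in> U i \<and> snd x \<in> {\<nu> i} then c i (fst x) (snd x) else 0)
      \<in> borel_measurable (borel \<Otimes>\<^sub>M borel)" if i: "i \<in> {1..n}" for i
  proof -
    have [measurable]: "(\<lambda>u. if u \<in> U i then - c i u (\<nu> i) else 0) \<in> borel_measurable borel"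
      by (rule usc_on_borel[OF D.usc[OF i] U_sets[OF i]])
    have "(\<lambda>x. if snd x \<in> {\<nu> i} then - (\<lambda>u. if u \<in> U i then - c i u (\<nu> i) else 0) (fst x) else 0)
        \<in> borel_measurable (borel \<Otimes>\<^sub>M borel)"
      by measurable
    then show ?thesis
      by (rule measurable_cong[THEN iffD1, rotated]) auto
  qed
  have "\<exists>R. \<forall>i\<in>{1..n}. \<forall>u\<in>U i. - c i u (\<nu> i) \<le> R"
  proof -
    have "\<forall>i\<in>{1..n}. \<exists>u. \<forall>u'\<in>U i. - c i u' (\<nu> i) \<le> - c i u (\<nu> i)"
      using usc_on_attains_sup[OF D.compact D.nonempty D.usc] by blast
    then obtain f where f: "\<forall>i\<in>{1..n}. \<forall>u'\<in>U i. - c i u' (\<nu> i) \<le> - c i (f i) (\<nu> i)"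
      by (rule bchoice[THEN exE])
    have "- c i u (\<nu> i) \<le> Max ((\<lambda>i. - c i (f i) (\<nu> i)) ` {1..n})" if "i \<in> {1..n}" "u \<in> U i" for i u
      using f that by (intro order_trans[OF _ Max_ge[of _ "- c i (f i) (\<nu> i)"]]) auto
    then show ?thesis by blast
  qed
  then obtain R where R: "\<And>i u. i \<in> {1..n} \<Longrightarrow> u \<in> U i \<Longrightarrow> - R \<le> c i u (\<nu> i)"
    by (metis minus_le_iff)
  have "ereal (J (Suc t) i) \<le> eexp (paths_of i (Suc t)) (\<lambda>(h, j). \<Sum>k\<le>t. stage_cost n c (h k))" for t
    by (rule expected_cost_ge[where R = "- R" and c = c and J = J, OF m _ _ _ on]) (auto simp: R J_def)
  then have "liminf (\<lambda>t. ereal (J (Suc t) i)) \<le> xcost n U V c p \<pi>1 (stat2 \<nu>) i"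
    unfolding xcost_def by (intro Liminf_mono always_eventually allI)
  moreover have "(\<lambda>t. ereal (J (Suc t) i)) \<longlonglongrightarrow> ereal (x i)"
  proof -
    have "D.bell (\<lambda>j. - x j) i = - x i" if "i \<in> {1..n}" for i
      using x[OF that] Tnu_bell[OF \<nu> that, of x] by simp
    from tendsto_minus[OF LIMSEQ_Suc[OF D.value_iteration[OF this i]]]
    show ?thesis using i by (simp add: J_def del: funpow.simps)
  qed
  then have "liminf (\<lambda>t. ereal (J (Suc t) i)) = ereal (x i)"
    by (rule lim_imp_Liminf[rotated]) simp
  ultimately show ?thesis by simp
qed

lemma saddle_point:
  assumes \<mu>: "\<mu> \<in> SD1 n U" and \<nu>: "\<nu> \<in> SD2 n V"
    and x1: "\<And>i. i \<in> {1..n} \<Longrightarrow> Tmu n V c p \<mu> x i = x i"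
    and x2: "\<And>i. i \<in> {1..n} \<Longrightarrow> Tnu n U c p \<nu> x i = x i"
  shows "ess_proper1 n U V c p \<mu>" "ess_proper2 n U V c p \<nu>"
    "non_prolonging n U V p (stat1 \<mu>) (stat2 \<nu>)"
    "equilibrium n U V c p (stat1 \<mu>) (stat2 \<nu>)"
    "optimal1 n U V c p (stat1 \<mu>)" "optimal2 n U V c p (stat2 \<nu>)"
    "\<forall>i\<in>{1..n}. upper_value n U V c p i = ereal (x i) \<and> lower_value n U V c p i = ereal (x i)"
proof -
  let ?x = "xcost n U V c p"
  \<comment> \<open>Since \<open>Tmn\<close> is below \<open>Tmu\<close>, the fixed point is a
    supersolution for \<open>\<mu>\<close> paired with any \<open>\<nu>'\<close>. This supplies for
    the present policy the finiteness that the assumption grants only to some policy.\<close>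
  have fin1: "?x (stat1 \<mu>) (stat2 \<nu>') i < \<infinity>" if "\<nu>' \<in> SD2 n V" "i \<in> {1..n}" for \<nu>' i
    by (rule xcost_lt_inf[OF \<mu> that(1) _ that(2), of x])
      (use Tmn_le_Tmu[OF \<mu> that(1), of _ x] x1 in simp)
  have fin2: "- \<infinity> < ?x (stat1 \<mu>') (stat2 \<nu>) i" if "\<mu>' \<in> SD1 n U" "i \<in> {1..n}" for \<mu>' i
    by (rule xcost_gt_minf[OF that(1) \<nu> _ that(2), of x])
      (use Tnu_le_Tmn[OF that(1) \<nu>, of _ x] x2 in simp)
  show np: "non_prolonging n U V p (stat1 \<mu>) (stat2 \<nu>)"
    unfolding non_prolonging_iff[OF \<mu> \<nu>] by (rule finite_imp_transient[OF \<mu> \<nu> fin1[OF \<nu>] fin2[OF \<mu>]])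
  show "ess_proper1 n U V c p \<mu>"
    unfolding ess_proper1_def using np \<nu> prolonging_infinite[OF \<mu>] fin1 by (metis insertE less_irrefl singletonD)
  show "ess_proper2 n U V c p \<nu>"
    unfolding ess_proper2_def using np \<mu> prolonging_infinite[OF _ \<nu>] fin2 by (metis insertE less_irrefl singletonD)
  have up: "?x (stat1 \<mu>) \<pi>2 i \<le> ereal (x i)" if "\<pi>2 \<in> Pol2 n V" "i \<in> {1..n}" for \<pi>2 i
    by (rule xcost_le_fixed_point[OF \<mu> x1 fin1 that])
  have low: "ereal (x i) \<le> ?x \<pi>1 (stat2 \<nu>) i" if "\<pi>1 \<in> Pol1 n U" "i \<in> {1..n}" for \<pi>1 i
    by (rule xcost_ge_fixed_point[OF \<nu> x2 fin2 that])
  note \<mu>P = stat1_Pol[OF \<mu>] and \<nu>P = stat2_Pol[OF \<nu>]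
  have eq: "?x (stat1 \<mu>) (stat2 \<nu>) i = ereal (x i)" if "i \<in> {1..n}" for i
    using up[OF \<nu>P that] low[OF \<mu>P that] by (rule antisym)
  show "equilibrium n U V c p (stat1 \<mu>) (stat2 \<nu>)"
    unfolding equilibrium_def using up low eq by simp
  have s: "(SUP \<pi>2\<in>Pol2 n V. ?x (stat1 \<mu>) \<pi>2 i) = ereal (x i)" if "i \<in> {1..n}" for i
    using up[OF _ that] eq[OF that] \<nu>P by (intro antisym SUP_least) (auto intro: SUP_upper2)
  have t: "(INF \<pi>1\<in>Pol1 n U. ?x \<pi>1 (stat2 \<nu>) i) = ereal (x i)" if "i \<in> {1..n}" for i
    using low[OF _ that] eq[OF that] \<mu>P by (intro antisym INF_greatest) (auto intro: INF_lower2)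
  have u: "upper_value n U V c p i = ereal (x i)" if i: "i \<in> {1..n}" for i
  proof (rule antisym)
    show "upper_value n U V c p i \<le> ereal (x i)"
      unfolding upper_value_def using s[OF i] \<mu>P by (intro INF_lower2) auto
    show "ereal (x i) \<le> upper_value n U V c p i"
      unfolding upper_value_def using low[OF _ i] \<nu>P by (intro INF_greatest SUP_upper2)
  qed
  have l: "lower_value n U V c p i = ereal (x i)" if i: "i \<in> {1..n}" for i
  proof (rule antisym)
    show "lower_value n U V c p i \<le> ereal (x i)"
      unfolding lower_value_def using up[OF _ i] \<mu>P by (intro SUP_least INF_lower2)
    show "ereal (x i) \<le> lower_value n U V c p i"
      unfolding lower_value_def using t[OF i] \<nu>P by (intro SUP_upper2) auto
  qed
  show "optimal1 n U V c p (stat1 \<mu>)" "optimal2 n U V c p (stat2 \<nu>)"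
    unfolding optimal1_def optimal2_def using s t u l by simp_all
  show "\<forall>i\<in>{1..n}. upper_value n U V c p i = ereal (x i) \<and> lower_value n U V c p i = ereal (x i)"
    using u l by simp
qed

text \<open>\<open>a\<close> and \<open>b\<close> are the Bellman fixed points for the opponents'
  replies to \<open>\<mu>\<close> and to \<open>\<nu>\<close>. The iterates of \<open>Top\<close>
  decrease from \<open>a\<close>, and \<open>b\<close> bounds them from below.\<close>

lemma Top_fixed_point_exists:
  assumes minimax: "\<And>x i. i \<in> {1..n} \<Longrightarrow> Top n U V c p x i = Top' n U V c p x i"
    and \<mu>: "\<mu> \<in> SD1 n U" and \<nu>: "\<nu> \<in> SD2 n V"
    and fin1: "\<And>\<nu> i. \<nu> \<in> SD2 n V \<Longrightarrow> i \<in> {1..n} \<Longrightarrow> xcost n U V c p (stat1 \<mu>) (stat2 \<nu>) i < \<infinity>"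
    and fin2: "\<And>\<mu> i. \<mu> \<in> SD1 n U \<Longrightarrow> i \<in> {1..n} \<Longrightarrow> - \<infinity> < xcost n U V c p (stat1 \<mu>) (stat2 \<nu>) i"
  shows "\<exists>x. \<forall>i\<in>{1..n}. Top n U V c p x i = x i"
proof -
  interpret D: proper_decision n V "cost1 \<mu>" "prob1 \<mu>" by (rule proper1[OF \<mu> fin1])
  interpret D2: proper_decision n U "cost2 \<nu>" "prob2 \<nu>" by (rule proper2[OF \<nu> fin2])
  have Q: "substoch n (PM \<mu> \<nu>)" by (rule substoch_PM[OF \<mu> \<nu>])
  have tr: "transient n (PM \<mu> \<nu>)" by (rule finite_imp_transient[OF \<mu> \<nu> fin1[OF \<nu>] fin2[OF \<mu>]])
  have \<nu>1: "\<nu> \<in> SD1 n V" using \<nu> by (simp add: SD2_eq_SD1)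
  \<comment> \<open>\<open>fixed_point_exists\<close> wants one reply with a subsolution. The
    opposite policy serves for both problems, because the pair is transient.\<close>
  obtain w where "\<And>i. i \<in> {1..n} \<Longrightarrow> w i \<le> aff n (\<lambda>i. c i (\<mu> i) (\<nu> i)) (PM \<mu> \<nu>) w i"
    using transient_subsolution[OF Q tr] by metis
  then have "\<And>i. i \<in> {1..n} \<Longrightarrow> w i \<le> D.act \<nu> w i"
    using Tmn_act[OF \<mu>, of \<nu>] Tmn_aff[of \<mu> \<nu>] by simp
  from D.fixed_point_exists[OF \<nu>1 this] obtain a where "\<forall>i\<in>{1..n}. D.bell a i = a i" by blast
  then have a: "Tmu n V c p \<mu> a i = a i" if "i \<in> {1..n}" for i
    using Tmu_bell[OF \<mu> that] that by simp
  obtain w2 where w2: "\<And>i. i \<in> {1..n} \<Longrightarrow> w2 i \<le> aff n (\<lambda>i. - c i (\<mu> i) (\<nu> i)) (PM \<mu> \<nu>) w2 i"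
    using transient_subsolution[OF Q tr] by metis
  have "D2.act \<mu> = aff n (\<lambda>i. - c i (\<mu> i) (\<nu> i)) (PM \<mu> \<nu>)"
    by (simp add: D2.act_def PM_def[abs_def])
  then have "\<And>i. i \<in> {1..n} \<Longrightarrow> w2 i \<le> D2.act \<mu> w2 i" using w2 by simp
  from D2.fixed_point_exists[OF \<mu> this] obtain b' where b': "\<forall>i\<in>{1..n}. D2.bell b' i = b' i" by blast
  define b where "b i = - b' i" for i
  have b: "Tnu n U c p \<nu> b i = b i" if "i \<in> {1..n}" for i
    using bspec[OF b' that] unfolding Tnu_bell[OF \<nu> that] by (simp add: b_def)
  \<comment> \<open>For the pair itself \<open>b\<close> is a subsolution and \<open>a\<close> a
    supersolution. The finite-horizon costs of the pair lie between them up to terminal terms, which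
    vanish by transience.\<close>
  have ba: "b i \<le> a i" if i: "i \<in> {1..n}" for i
  proof -
    have M: "mono_sub n (Tmn n c p \<mu> \<nu>)" by (rule mono_sub_Tmn[OF \<mu> \<nu>])
    have b1: "b i \<le> aff n (\<lambda>i. c i (\<mu> i) (\<nu> i)) (PM \<mu> \<nu>) b i" if "i \<in> {1..n}" for i
      using Tnu_le_Tmn[OF \<mu> \<nu> that, of b] b[OF that] by (simp add: Tmn_aff)
    have a1: "aff n (\<lambda>i. c i (\<mu> i) (\<nu> i)) (PM \<mu> \<nu>) a i \<le> a i" if "i \<in> {1..n}" for i
      using Tmn_le_Tmu[OF \<mu> \<nu> that, of a] a[OF that] by (simp add: Tmn_aff)
    have "b i - (lin n (PM \<mu> \<nu>) ^^ t) b i \<le> a i - (lin n (PM \<mu> \<nu>) ^^ t) a i" for t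
      using aff_funpow_sub[OF Q b1 i, of t] aff_funpow_super[OF Q a1 i, of t] by simp
    moreover have "(\<lambda>t. b i - (lin n (PM \<mu> \<nu>) ^^ t) b i) \<longlonglongrightarrow> b i - 0"
      "(\<lambda>t. a i - (lin n (PM \<mu> \<nu>) ^^ t) a i) \<longlonglongrightarrow> a i - 0"
      by (intro tendsto_intros transient_lin_0[OF Q tr i])+
    ultimately have "b i - 0 \<le> a i - 0" by (intro LIMSEQ_le) auto
    then show ?thesis by simp
  qed
  let ?T = "Top n U V c p"
  have super: "?T a i \<le> a i" if "i \<in> {1..n}" for i
    using Top_le_Tmu[OF \<mu> that, of a] a[OF that] by simp
  \<comment> \<open>The minimax condition enters here: \<open>b\<close> is naturally a subsolution
    of \<open>Top'\<close>, while the iteration uses \<open>Top\<close>.\<close>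
  have sub: "b i \<le> ?T b i" if "i \<in> {1..n}" for i
    using Tnu_le_Top'[OF \<nu> that, of b] b[OF that] minimax[OF that] by simp
  have low: "b i \<le> (?T ^^ t) a i" if "i \<in> {1..n}" for i t
    using that
  proof (induction t arbitrary: i)
    case (Suc t)
    have "b i \<le> ?T b i" by (rule sub[OF Suc.prems])
    also have "\<dots> \<le> ?T ((?T ^^ t) a) i" by (rule mono_subD1[OF mono_sub_Top Suc.IH Suc.prems])
    finally show ?case by simp
  qed (use ba in simp)
  obtain x where "\<And>i. i \<in> {1..n} \<Longrightarrow> ?T x i = x i"
    using mono_sub_decreasing[OF mono_sub_Top super low] by metis
  then show ?thesis by blast
qed

end

theorem theorem2p1:
  fixes n :: nat
    and U :: "nat \<Rightarrow> 'u::polish_space set"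
    and V :: "nat \<Rightarrow> 'v::polish_space set"
    and c :: "nat \<Rightarrow> 'u \<Rightarrow> 'v \<Rightarrow> real"
    and p :: "nat \<Rightarrow> nat \<Rightarrow> 'u \<Rightarrow> 'v \<Rightarrow> real"
  assumes U_compact: "\<forall>i\<in>{1..n}. compact (U i)"
    and V_compact: "\<forall>i\<in>{1..n}. compact (V i)"
    and p_nonneg: "\<forall>i\<in>{1..n}. \<forall>u\<in>U i. \<forall>v\<in>V i. \<forall>j\<in>{0..n}. 0 \<le> p i j u v"
    and p_sum: "\<forall>i\<in>{1..n}. \<forall>u\<in>U i. \<forall>v\<in>V i. (\<Sum>j\<in>{0..n}. p i j u v) = 1"
    and cont_p: "\<forall>i\<in>{1..n}. \<forall>j\<in>{1..n}. continuous_on (U i \<times> V i) (\<lambda>(u, v). p i j u v)"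
    and lsc_c: "\<forall>i\<in>{1..n}. \<forall>v\<in>V i. lsc_on (U i) (\<lambda>u. c i u v)"
    and usc_c: "\<forall>i\<in>{1..n}. \<forall>u\<in>U i. usc_on (V i) (\<lambda>v. c i u v)"
    and minimax: "\<forall>x. \<forall>i\<in>{1..n}. Top n U V c p x i = Top' n U V c p x i"
    and ssp1: "\<exists>\<mu>\<in>SD1 n U. \<forall>\<nu>\<in>SD2 n V. \<forall>i\<in>{1..n}.
                 xcost n U V c p (stat1 \<mu>) (stat2 \<nu>) i < \<infinity>"
    and ssp2: "\<exists>\<nu>\<in>SD2 n V. \<forall>\<mu>\<in>SD1 n U. \<forall>i\<in>{1..n}.
                 xcost n U V c p (stat1 \<mu>) (stat2 \<nu>) i > -\<infinity>"
    and ssp3: "\<forall>\<mu>\<in>SD1 n U. \<forall>\<nu>\<in>SD2 n V. prolonging n U V p (stat1 \<mu>) (stat2 \<nu>) \<longrightarrow>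
                 (\<exists>i\<in>{1..n}. xcost n U V c p (stat1 \<mu>) (stat2 \<nu>) i \<in> {\<infinity>, -\<infinity>})"
  shows "\<exists>xs :: nat \<Rightarrow> real.
     (\<forall>i\<in>{1..n}. upper_value n U V c p i = ereal (xs i) \<and> lower_value n U V c p i = ereal (xs i)) \<and>
     (\<forall>i\<in>{1..n}. xs i = Top n U V c p xs i) \<and>
     (\<forall>y :: nat \<Rightarrow> real. (\<forall>i\<in>{1..n}. y i = Top n U V c p y i) \<longrightarrow> (\<forall>i\<in>{1..n}. y i = xs i)) \<and>
     (\<exists>\<mu>\<in>SD1 n U. \<exists>\<nu>\<in>SD2 n V.
        (\<forall>i\<in>{1..n}. xs i = Tmu n V c p \<mu> xs i \<and> xs i = Tnu n U c p \<nu> xs i)) \<and>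
     (\<forall>\<mu>\<in>SD1 n U. \<forall>\<nu>\<in>SD2 n V.
        (\<forall>i\<in>{1..n}. xs i = Tmu n V c p \<mu> xs i \<and> xs i = Tnu n U c p \<nu> xs i) \<longrightarrow>
          ess_proper1 n U V c p \<mu> \<and> ess_proper2 n U V c p \<nu> \<and>
          non_prolonging n U V p (stat1 \<mu>) (stat2 \<nu>) \<and>
          equilibrium n U V c p (stat1 \<mu>) (stat2 \<nu>) \<and>
          optimal1 n U V c p (stat1 \<mu>) \<and> optimal2 n U V c p (stat2 \<nu>))"
proof -
  from ssp1 obtain \<mu>0 where \<mu>0: "\<mu>0 \<in> SD1 n U"
    and fin1: "\<And>\<nu> i. \<nu> \<in> SD2 n V \<Longrightarrow> i \<in> {1..n} \<Longrightarrow> xcost n U V c p (stat1 \<mu>0) (stat2 \<nu>) i < \<infinity>"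
    by blast
  from ssp2 obtain \<nu>0 where \<nu>0: "\<nu>0 \<in> SD2 n V"
    and fin2: "\<And>\<mu> i. \<mu> \<in> SD1 n U \<Longrightarrow> i \<in> {1..n} \<Longrightarrow> - \<infinity> < xcost n U V c p (stat1 \<mu>) (stat2 \<nu>0) i"
    by blast
  interpret ssp_game n U V c p
  proof
    fix i u v assume *: "i \<in> {1..n}" "u \<in> U i" "v \<in> V i"
    have "(\<Sum>j\<in>{1..n}. p i j u v) \<le> (\<Sum>j\<in>{0..n}. p i j u v)"
      using p_nonneg * by (intro sum_mono2) auto
    then show "(\<Sum>j\<in>{1..n}. p i j u v) \<le> 1" using p_sum * by simp
  qed (use U_compact V_compact p_nonneg p_sum cont_p lsc_c usc_c \<mu>0 \<nu>0 ssp3 in auto)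
  obtain xs where xs: "\<And>i. i \<in> {1..n} \<Longrightarrow> Top n U V c p xs i = xs i"
    using Top_fixed_point_exists[OF _ \<mu>0 \<nu>0 fin1 fin2] minimax by metis
  \<comment> \<open>Attainment yields \<open>\<mu>\<close> from \<open>Top\<close> and
    \<open>\<nu>\<close> from \<open>Top'\<close>; by the minimax condition both operators fix
    \<open>x\<close>.\<close>
  have greedy: "\<exists>\<mu>\<in>SD1 n U. \<exists>\<nu>\<in>SD2 n V. \<forall>i\<in>{1..n}. x i = Tmu n V c p \<mu> x i \<and> x i = Tnu n U c p \<nu> x i"
    if "\<And>i. i \<in> {1..n} \<Longrightarrow> Top n U V c p x i = x i" for x
    using Top_attained[of x] Top'_attained[of x] minimax that by metis
  \<comment> \<open>Stated for an arbitrary fixed point: as the upper value does not depend on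
    \<open>x\<close>, uniqueness follows at once.\<close>
  have val: "\<forall>i\<in>{1..n}. upper_value n U V c p i = ereal (x i) \<and> lower_value n U V c p i = ereal (x i)"
    if "\<And>i. i \<in> {1..n} \<Longrightarrow> Top n U V c p x i = x i" for x
    using greedy[OF that] saddle_point(7)[of _ _ x] by metis
  show ?thesis
  proof (intro exI[of _ xs] conjI)
    show "\<forall>i\<in>{1..n}. upper_value n U V c p i = ereal (xs i) \<and> lower_value n U V c p i = ereal (xs i)"
      by (rule val[OF xs])
    show "\<forall>i\<in>{1..n}. xs i = Top n U V c p xs i" using xs by simp
    show "\<forall>y. (\<forall>i\<in>{1..n}. y i = Top n U V c p y i) \<longrightarrow> (\<forall>i\<in>{1..n}. y i = xs i)"
    proof (intro allI impI ballI)
      fix y i assume "\<forall>i\<in>{1..n}. y i = Top n U V c p y i" "i \<in> {1..n}"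
      then show "y i = xs i" using val[of y] val[OF xs] by (metis ereal.inject)
    qed
    show "\<exists>\<mu>\<in>SD1 n U. \<exists>\<nu>\<in>SD2 n V. \<forall>i\<in>{1..n}. xs i = Tmu n V c p \<mu> xs i \<and> xs i = Tnu n U c p \<nu> xs i"
      by (rule greedy[OF xs])
    show "\<forall>\<mu>\<in>SD1 n U. \<forall>\<nu>\<in>SD2 n V.
        (\<forall>i\<in>{1..n}. xs i = Tmu n V c p \<mu> xs i \<and> xs i = Tnu n U c p \<nu> xs i) \<longrightarrow>
          ess_proper1 n U V c p \<mu> \<and> ess_proper2 n U V c p \<nu> \<and>
          non_prolonging n U V p (stat1 \<mu>) (stat2 \<nu>) \<and>
          equilibrium n U V c p (stat1 \<mu>) (stat2 \<nu>) \<and>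
          optimal1 n U V c p (stat1 \<mu>) \<and> optimal2 n U V c p (stat2 \<nu>)"
    proof (intro ballI impI)
      fix \<mu> \<nu> assume *: "\<mu> \<in> SD1 n U" "\<nu> \<in> SD2 n V"
        "\<forall>i\<in>{1..n}. xs i = Tmu n V c p \<mu> xs i \<and> xs i = Tnu n U c p \<nu> xs i"
      have 1: "Tmu n V c p \<mu> xs i = xs i" and 2: "Tnu n U c p \<nu> xs i = xs i" if "i \<in> {1..n}" for i
        using bspec[OF *(3) that] by (rule conjunct1[THEN sym], rule conjunct2[THEN sym])
      from saddle_point[OF *(1,2) 1 2]
      show "ess_proper1 n U V c p \<mu> \<and> ess_proper2 n U V c p \<nu> \<and>
          non_prolonging n U V p (stat1 \<mu>) (stat2 \<nu>) \<and>
          equilibrium n U V c p (stat1 \<mu>) (stat2 \<nu>) \<and>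
          optimal1 n U V c p (stat1 \<mu>) \<and> optimal2 n U V c p (stat2 \<nu>)"
        by blast
    qed
  qed
qed

end
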